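(* Let $q$ be an odd prime power, $d\ge 2$, and let $\phi:\mathbb{F}_q^d\times\mathbb{F}_q^d\to\mathbb{F}_q$ be a distance type function. For any nonnegative functions $f,g:\mathbb{F}_q^d\to\mathbb{R}$ and any $\lambda\in\mathbb{F}_q^*$, $$\Big|\mathbb{E}_{x,y}\, f(x)g(y)d_\lambda(x,y)-\mathbb{E}_x f(x)\,\mathbb{E}_y g(y)\Big|\ \le\ C_\phi\, q^{-\frac{d-1}{2}}\,\|f\|_2\,\|g\|_2,$$ where $C_\phi=1$ if $\phi$ is defined by a bilinear form and $C_\phi=2$ if $\phi$ is defined by a quadratic form.
   Context: A distance type function is a function $\phi:\mathbb{F}_q^d\times\mathbb{F}_q^d\to\mathbb{F}_q$ that is either $\phi(x,y)=B(x,y)$ for a non-degenerate bilinear form $B$ ("defined by a bilinear form"), or $\phi(x,y)=Q(x-y)$ for a non-degenerate quadratic form $Q$ on $\mathbb{F}_q^d$ ("defined by a quadratic form"). For $\lambda\in\mathbb{F}_q^*$, $d_\lambda(x,y)=q$ if $\phi(x,y)=\lambda$ and $d_\lambda(x,y)=0$ otherwise. Averages are normalized: $\mathbb{E}_x f(x)=q^{-d}\sum_{x\in\mathbb{F}_q^d}f(x)$, and $\mathbb{E}_{x,y}=\mathbb{E}_x\mathbb{E}_y$. The norm is $\|f\|_2=\big(\mathbb{E}_x|f(x)|^2\big)^{1/2}$. *)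

theory Defs
  imports "HOL-Analysis.Analysis"
begin

text \<open>
  Throughout, a type \<open>'a::{field,finite}\<close> plays the role of \<open>F\<^sub>q\<close>, with \<open>q = CARD('a)\<close>, and
  \<open>'a ^ 'n\<close> that of \<open>F\<^sub>q\<^sup>d\<close>, with \<open>d = CARD('n)\<close>. As \<open>q\<close> is the cardinality of a field, it is
  automatically a prime power.
\<close>

definition bilinear_form :: "('a::field ^ 'n \<Rightarrow> 'a ^ 'n \<Rightarrow> 'a) \<Rightarrow> bool" where
  "bilinear_form B \<longleftrightarrow>
     (\<forall>x. Vector_Spaces.linear (*s) (*) (\<lambda>y. B x y)) \<and>
     (\<forall>y. Vector_Spaces.linear (*s) (*) (\<lambda>x. B x y))"

text \<open>Bilinear forms need not be symmetric, so both radicals are required to vanish.\<close>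

definition nondegenerate_bilinear_form :: "('a::field ^ 'n \<Rightarrow> 'a ^ 'n \<Rightarrow> 'a) \<Rightarrow> bool" where
  "nondegenerate_bilinear_form B \<longleftrightarrow> bilinear_form B \<and>
     (\<forall>x. (\<forall>y. B x y = 0) \<longrightarrow> x = 0) \<and>
     (\<forall>y. (\<forall>x. B x y = 0) \<longrightarrow> y = 0)"

definition polar_form :: "('a::field ^ 'n \<Rightarrow> 'a) \<Rightarrow> 'a ^ 'n \<Rightarrow> 'a ^ 'n \<Rightarrow> 'a" where
  "polar_form Q x y = Q (x + y) - Q x - Q y"

definition quadratic_form :: "('a::field ^ 'n \<Rightarrow> 'a) \<Rightarrow> bool" where
  "quadratic_form Q \<longleftrightarrow> (\<forall>c x. Q (c *s x) = c\<^sup>2 * Q x) \<and> bilinear_form (polar_form Q)"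

text \<open>
  The polar form is twice the symmetric bilinear form usually associated with \<open>Q\<close> in odd
  characteristic, so there the two notions of non-degeneracy agree.
\<close>

definition nondegenerate_quadratic_form :: "('a::field ^ 'n \<Rightarrow> 'a) \<Rightarrow> bool" where
  "nondegenerate_quadratic_form Q \<longleftrightarrow>
     quadratic_form Q \<and> nondegenerate_bilinear_form (polar_form Q)"

definition defined_by_bilinear_form :: "('a::field ^ 'n \<Rightarrow> 'a ^ 'n \<Rightarrow> 'a) \<Rightarrow> bool" where
  "defined_by_bilinear_form \<phi> \<longleftrightarrow>
     (\<exists>B. nondegenerate_bilinear_form B \<and> (\<forall>x y. \<phi> x y = B x y))"

definition defined_by_quadratic_form :: "('a::field ^ 'n \<Rightarrow> 'a ^ 'n \<Rightarrow> 'a) \<Rightarrow> bool" where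
  "defined_by_quadratic_form \<phi> \<longleftrightarrow>
     (\<exists>Q. nondegenerate_quadratic_form Q \<and> (\<forall>x y. \<phi> x y = Q (x - y)))"

definition distance_type :: "('a::field ^ 'n \<Rightarrow> 'a ^ 'n \<Rightarrow> 'a) \<Rightarrow> bool" where
  "distance_type \<phi> \<longleftrightarrow> defined_by_bilinear_form \<phi> \<or> defined_by_quadratic_form \<phi>"

text \<open>
  The constant \<open>C\<^sub>\<phi>\<close>. It is only meaningful for distance type functions, and for these the
  two cases exclude each other (see \<open>not_bilinear_and_quadratic\<close> below), so the second branch
  is the quadratic one.
\<close>

definition C_dist :: "('a::field ^ 'n \<Rightarrow> 'a ^ 'n \<Rightarrow> 'a) \<Rightarrow> real" where
  "C_dist \<phi> = (if defined_by_bilinear_form \<phi> then 1 else 2)"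

definition d_level ::
  "('a::{field,finite} ^ 'n \<Rightarrow> 'a ^ 'n \<Rightarrow> 'a) \<Rightarrow> 'a \<Rightarrow> 'a ^ 'n \<Rightarrow> 'a ^ 'n \<Rightarrow> real" where
  "d_level \<phi> l x y = (if \<phi> x y = l then real CARD('a) else 0)"

definition avg :: "('a::{field,finite} ^ 'n \<Rightarrow> real) \<Rightarrow> real" where
  "avg f = (\<Sum>x\<in>UNIV. f x) / real CARD('a) ^ CARD('n)"

definition norm2 :: "('a::{field,finite} ^ 'n \<Rightarrow> real) \<Rightarrow> real" where
  "norm2 f = sqrt (avg (\<lambda>x. \<bar>f x\<bar>\<^sup>2))"

lemma not_bilinear_and_quadratic:
  fixes \<phi> :: "'a::field ^ 'n \<Rightarrow> 'a ^ 'n \<Rightarrow> 'a"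
  shows "\<not> (defined_by_bilinear_form \<phi> \<and> defined_by_quadratic_form \<phi>)"
proof
  assume *: "defined_by_bilinear_form \<phi> \<and> defined_by_quadratic_form \<phi>"
  then have lin: "Vector_Spaces.linear (*s) (*) (\<lambda>y. \<phi> x y)" for x
    by (auto simp: defined_by_bilinear_form_def nondegenerate_bilinear_form_def bilinear_form_def)
  from * obtain Q where Q: "nondegenerate_quadratic_form Q" "\<And>x y. \<phi> x y = Q (x - y)"
    by (auto simp: defined_by_quadratic_form_def)
  have "Q x = 0" for x
  proof -
    interpret L: Vector_Spaces.linear "(*s)" "(*)" "\<lambda>y. \<phi> x y"
      by (rule lin)
    show ?thesis
      using L.zero Q(2)[of x 0] by simp
  qed
  then have "polar_form Q x y = 0" for x y
    by (simp add: polar_form_def)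
  then have "x = 0" for x :: "'a ^ 'n"
    using Q(1) by (auto simp: nondegenerate_quadratic_form_def nondegenerate_bilinear_form_def)
  from this[of "1"] show False
    by simp
qed

end

theory Submission
  imports Defs "HOL-Algebra.Algebraic_Closure_Type" "HOL-Number_Theory.Residues"
begin

text \<open>
  Expand the kernel \<open>d\<^sub>\<lambda> - 1\<close> in additive characters \<open>\<psi>\<close>. For a bilinear form, Cauchy--Schwarz and
  the orthogonality relations suffice: the off-diagonal entries of \<open>K\<^sup>T K\<close> are nonpositive, so they
  can be dropped for nonnegative functions.

  For a quadratic form the kernel is a convolution, with eigenvalues
  \<open>\<Sum>\<^sub>t G(t) \<psi>(- \<lambda> t - Q(\<xi>) / t)\<close> where \<open>G(t) = \<Sum>\<^sub>z \<psi>(t Q(z))\<close> has modulus \<open>q ^ (d / 2)\<close>. As a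
  function of \<open>t\<close>, \<open>G(t) / G(1)\<close> is either trivial or the quadratic character, so the eigenvalues are
  Kloosterman or Salie sums, both at most \<open>2 sqrt q\<close>. Salie sums are evaluated explicitly.

  The Weil bound for Kloosterman sums is proved by Stepanov's method. The \<open>L\<close>-function of a
  Kloosterman sum is the quadratic polynomial \<open>1 + K T + q T\<^sup>2\<close>, so the sums \<open>K\<^sub>n\<close> over the
  extensions of degree \<open>n\<close> are \<open>- (\<alpha> ^ n + \<beta> ^ n)\<close> with \<open>\<alpha> \<beta> = q\<close>. Summing \<open>K\<^sub>n\<close> over all
  multiplicative twists counts points on \<open>y ^ q - y = a x + b / x\<close>, which Stepanov's auxiliary
  polynomial bounds from below for even \<open>n\<close> up to \<open>O(q ^ (n / 2))\<close>; a root of modulus larger than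
  \<open>sqrt q\<close> would contradict this for large \<open>n\<close>.
\<close>

hide_const (open) Divisibility.prime Coset.order Polynomials.degree Polynomials.lead_coeff
  up_ring.monom up_ring.coeff module.smult

section \<open>Finite fields and additive characters\<close>

text \<open>Point counting controls only the sum of the Kloosterman sums over all twists, and only
  from one side, so one large sum might be cancelled by others. Even degrees exclude this: a twist
  contributes \<open>- (\<alpha> ^ (2 * m) + \<beta> ^ (2 * m))\<close>, which is at most
  \<open>2 * q ^ m\<close> whether its roots are real or complex conjugate. No twist can therefore
  make up for one that is very negative. Even degree also makes \<open>R = q ^ m\<close> the square
  root of the field size, and raising to the power \<open>R\<close> twice is then the identity on
  the field; the auxiliary polynomial is built on this.

  Extensions of all degrees are compared at once, so they are taken inside one algebraically closed
  field as fixed points of powers of Frobenius. In place of an Euler product over irreducible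
  polynomials, pairs \<open>(k, x)\<close> are counted for which the characteristic polynomial of
  \<open>x\<close> in degree \<open>k\<close> divides a given polynomial.

  The constant 2 of the quadratic case counts the two roots of modulus \<open>sqrt q\<close>, or the
  two Gauss sums in a Salie sum. The constant 1 of the bilinear case comes from the diagonal of
  \<open>K^T K\<close>.\<close>

lemma prime_CHAR_finite_field: "prime CHAR('a::{field,finite})"
  by (intro prime_CHAR_semidom finite_imp_CHAR_pos) simp

lemma ex_of_nat_inverse:
  assumes "0 < k" "k < CHAR('a::{field,finite})"
  shows "\<exists>e. of_nat e * of_nat k = (1 :: 'a)"
proof -
  have "coprime CHAR('a) k"
    using assms by (intro prime_imp_coprime prime_CHAR_finite_field) (auto dest: dvd_imp_le)
  then have "coprime k CHAR('a)" by (simp add: coprime_commute)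
  then obtain e where "[k * e = 1] (mod CHAR('a))"
    using cong_solve_coprime_nat by auto
  then have "of_nat (k * e) = (of_nat 1 :: 'a)"
    by (subst of_nat_eq_iff_cong_CHAR)
  then show ?thesis by (intro exI[of _ e]) (simp add: mult.commute)
qed

text \<open>If two representations used different multiples of \<open>x\<close>, the difference of
  the coefficients would be invertible modulo the characteristic and \<open>x\<close> would lie in
  \<open>H\<close>. So adjoining \<open>x\<close> to an additive subgroup multiplies its order by
  the characteristic.\<close>

lemma card_add_multiples:
  fixes H :: "'a::{field,finite} set"
  assumes H0: "0 \<in> H" and add: "\<And>x y. x \<in> H \<Longrightarrow> y \<in> H \<Longrightarrow> x - y \<in> H" and x: "x \<notin> H"
  shows "inj_on (\<lambda>(h, k). h + of_nat k * x) (H \<times> {..<CHAR('a)})"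
proof -
  have mult: "of_nat k * h \<in> H" if "h \<in> H" for k h
  proof (induction k)
    case (Suc k)
    have "of_nat (Suc k) * h = of_nat k * h - (0 - h)" by (simp add: algebra_simps)
    then show ?case using add[OF Suc add[OF H0 that]] by simp
  qed (simp add: H0)
  have *: "k \<le> k'" if "h + of_nat k * x = h' + of_nat k' * x" "h \<in> H" "h' \<in> H" "k < CHAR('a)"
    for h h' k k'
  proof (rule ccontr)
    assume "\<not> k \<le> k'"
    then have lt: "k' < k" by simp
    define d where "d = k - k'"
    have d: "0 < d" "d < CHAR('a)" using lt that(4) by (auto simp: d_def)
    have "of_nat d * x = h' - h"
      using that(1) lt by (simp add: d_def of_nat_diff algebra_simps)
    then have dx: "of_nat d * x \<in> H" using add that by simp
    obtain e where "of_nat e * of_nat d = (1 :: 'a)" using ex_of_nat_inverse[OF d] by blast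
    then have ex: "of_nat e * (of_nat d * x) = x" by (metis mult.assoc mult_1)
    show False using mult[OF dx, of e] x by (simp only: ex)
  qed
  show ?thesis
  proof (rule inj_onI, clarsimp)
    fix h k h' k' assume h: "h \<in> H" "k < CHAR('a)" "h' \<in> H" "k' < CHAR('a)"
      and eq: "h + of_nat k * x = h' + of_nat k' * x"
    have "k = k'" using *[OF eq] *[OF eq[symmetric]] h by simp
    then show "h = h' \<and> k = k'" using eq by simp
  qed
qed

lemma diff_closed_add_multiples:
  fixes H :: "'a::{field,finite} set"
  assumes H0: "0 \<in> H" and add: "\<And>x y. x \<in> H \<Longrightarrow> y \<in> H \<Longrightarrow> x - y \<in> H"
    and y: "y \<in> (\<lambda>(h, k). h + of_nat k * x) ` (H \<times> {..<CHAR('a)})"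
    and z: "z \<in> (\<lambda>(h, k). h + of_nat k * x) ` (H \<times> {..<CHAR('a)})"
  shows "y - z \<in> (\<lambda>(h, k). h + of_nat k * x) ` (H \<times> {..<CHAR('a)})"
proof -
  have pos: "0 < CHAR('a)" using prime_CHAR_finite_field[where 'a='a] prime_gt_0_nat by blast
  from y obtain h k where y: "y = h + of_nat k * x" "h \<in> H" by auto
  from z obtain h' k' where z: "z = h' + of_nat k' * x" "h' \<in> H" "k' < CHAR('a)" by auto
  \<comment> \<open>Adding \<open>CHAR('a) - k'\<close> represents \<open>k - k'\<close> without
    truncated subtraction; the reduction brings the coefficient back into range.\<close>
  let ?k = "(k + (CHAR('a) - k')) mod CHAR('a)"
  have "(of_nat ?k :: 'a) = of_nat (k + (CHAR('a) - k'))"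
    by (simp only: of_nat_eq_iff_cong_CHAR cong_def mod_mod_trivial)
  also have "\<dots> = of_nat k - of_nat k'" using z(3) by (simp add: of_nat_diff)
  finally have *: "(of_nat ?k :: 'a) = of_nat k - of_nat k'" .
  have "y - z = (h - h') + of_nat ?k * x" unfolding * using y z by (simp add: algebra_simps)
  moreover have "?k < CHAR('a)" using pos by simp
  moreover have "h - h' \<in> H" using y z by (intro add)
  ultimately show ?thesis by (intro image_eqI[of _ _ "(h - h', ?k)"]) auto
qed

lemma ex_max_card:
  fixes S :: "'a::finite set set"
  assumes "H0 \<in> S"
  shows "\<exists>H\<in>S. \<forall>H'\<in>S. card H' \<le> card H"
proof -
  have "Max (card ` S) \<in> card ` S" using assms by (intro Max_in) auto
  then obtain H where "H \<in> S" "card H = Max (card ` S)" by auto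
  then show ?thesis by (intro bexI[of _ H]) auto
qed

text \<open>A largest additive subgroup whose order is a power of the characteristic is everything:
  adjoining a missing element would give a larger one of the same kind.\<close>

lemma card_finite_field:
  "\<exists>r>0. CARD('a::{field,finite}) = CHAR('a) ^ r"
proof -
  let ?S = "{H :: 'a set. 0 \<in> H \<and> (\<forall>x\<in>H. \<forall>y\<in>H. x - y \<in> H) \<and> (\<exists>r. card H = CHAR('a) ^ r)}"
  have "{0} \<in> ?S" by (auto intro: exI[of _ 0])
  from ex_max_card[OF this] obtain H where H: "H \<in> ?S" and max: "\<forall>H'\<in>?S. card H' \<le> card H"
    by (elim bexE)
  from H obtain r where r: "card H = CHAR('a) ^ r" by auto
  have "H = UNIV"
  proof (rule ccontr)
    assume "H \<noteq> UNIV"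
    then obtain x where x: "x \<notin> H" by auto
    let ?H = "(\<lambda>(h, k). h + of_nat k * x) ` (H \<times> {..<CHAR('a)})"
    have c: "card ?H = CHAR('a) ^ Suc r"
      using card_add_multiples[of H x] H x by (simp add: card_image r card_cartesian_product)
    have pos: "1 < CHAR('a)" using prime_CHAR_finite_field[where 'a='a] prime_gt_1_nat by blast
    have "(0::'a) = 0 + of_nat 0 * x" by simp
    then have "0 \<in> ?H" using H pos by (intro image_eqI[of _ _ "(0,0)"]) auto
    moreover have "y - z \<in> ?H" if "y \<in> ?H" "z \<in> ?H" for y z
      by (rule diff_closed_add_multiples[OF _ _ that]) (use H in auto)
    ultimately have "?H \<in> ?S" using c by (intro CollectI conjI ballI exI[of _ "Suc r"])
    from bspec[OF max this] c r pos show False by simp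
  qed
  moreover have "r \<noteq> 0"
  proof
    assume "r = 0"
    then have "card (UNIV :: 'a set) = 1" using r \<open>H = UNIV\<close> by simp
    then show False using card_mono[of UNIV "{0, 1 :: 'a}"] by simp
  qed
  ultimately show ?thesis using r by blast
qed

lemma CARD_field_gt_1: "1 < CARD('a::{field,finite})"
proof -
  obtain r where r: "r > 0" "CARD('a) = CHAR('a) ^ r"
    using card_finite_field[where 'a='a] by (elim exE conjE)
  have "1 < CHAR('a)" using prime_CHAR_finite_field by (rule prime_gt_1_nat)
  then have "1 < CHAR('a) ^ r" using r(1) by (rule one_less_power)
  then show ?thesis by (simp only: r(2))
qed

lemma finite_field_power_CARD:
  fixes x :: "'a::{field,finite}"
  shows "x ^ CARD('a) = x"
proof (cases "x = 0")
  case False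
  have "x * (\<Prod>y\<in>UNIV-{0}. x * y) = x * x ^ (CARD('a) - 1) * \<Prod>(UNIV-{0})"
    by (simp add: prod.distrib mult_ac)
  also have "x * x ^ (CARD('a) - 1) = x ^ CARD('a)"
    using CARD_field_gt_1[where 'a='a] by (simp flip: power_Suc)
  also have "(\<Prod>y\<in>UNIV-{0}. x * y) = \<Prod>(UNIV-{0})"
    by (rule prod.reindex_bij_witness[of _ "\<lambda>y. y / x" "\<lambda>y. x * y"]) (use False in auto)
  finally show ?thesis by simp
qed simp

section \<open>Existence and orthogonality of a nontrivial additive character\<close>

locale additive_character =
  fixes \<psi> :: "'a::{field,finite} \<Rightarrow> complex"
  assumes psi_add: "\<psi> (x + y) = \<psi> x * \<psi> y"
    and norm_psi [simp]: "norm (\<psi> x) = 1"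
    and psi_nontrivial: "\<exists>c. \<psi> c \<noteq> 1"

text \<open>
  The character is trivial on an additive subgroup that is maximal among those avoiding \<open>1\<close>;
  such a subgroup is a complement of the prime field.
\<close>

lemma ex_additive_character: "\<exists>\<psi> :: 'a::{field,finite} \<Rightarrow> complex. additive_character \<psi>"
proof -
  let ?p = "CHAR('a)"
  have pos: "1 < ?p" using prime_CHAR_finite_field[where 'a='a] prime_gt_1_nat by blast
  let ?S = "{H :: 'a set. 0 \<in> H \<and> (\<forall>x\<in>H. \<forall>y\<in>H. x - y \<in> H) \<and> 1 \<notin> H}"
  have "{0} \<in> ?S" by auto
  from ex_max_card[OF this] obtain H where H: "H \<in> ?S" and max: "\<forall>H'\<in>?S. card H' \<le> card H"
    by (elim bexE)
  have H0: "0 \<in> H" and sub: "\<And>x y. x \<in> H \<Longrightarrow> y \<in> H \<Longrightarrow> x - y \<in> H" and H1: "1 \<notin> H"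
    using H by auto
  have neg: "- x \<in> H" if "x \<in> H" for x using sub[OF H0 that] by simp
  have add: "x + y \<in> H" if "x \<in> H" "y \<in> H" for x y
    using sub[OF that(1) neg[OF that(2)]] by simp
  have mult: "of_nat k * h \<in> H" if "h \<in> H" for k h
    by (induction k) (auto simp: H0 algebra_simps intro: add that)
  \<comment> \<open>The strictly larger group generated by \<open>H\<close> and \<open>x\<close>
    contains \<open>1\<close> by maximality. In that relation the coefficient of \<open>x\<close> is
    invertible because \<open>1\<close> is not in \<open>H\<close>, so \<open>x\<close> can be
    solved for.\<close>
  have split: "\<exists>h k. h \<in> H \<and> x = h + of_nat k" for x
  proof (cases "x \<in> H")
    case False
    let ?f = "\<lambda>(h, k). h + of_nat k * x"
    let ?H = "?f ` (H \<times> {..<?p})"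
    have c: "card ?H = card H * ?p"
      using card_add_multiples[of H x] H False by (simp add: card_image card_cartesian_product)
    have "card H > 0" using H0 by (auto simp: card_gt_0_iff)
    then have "card ?H > card H" using c pos by simp
    have "0 \<in> ?H" using H0 pos by (intro image_eqI[of _ _ "(0,0)"]) auto
    have "1 \<in> ?H"
    proof (rule ccontr)
      assume "1 \<notin> ?H"
      moreover have "y - z \<in> ?H" if "y \<in> ?H" "z \<in> ?H" for y z
        by (rule diff_closed_add_multiples[OF H0 sub that])
      ultimately have "?H \<in> ?S" using \<open>0 \<in> ?H\<close> by (intro CollectI conjI ballI)
      from bspec[OF max this] \<open>card ?H > card H\<close> show False by simp
    qed
    then obtain h k where hk: "h \<in> H" "k < ?p" "1 = h + of_nat k * x" by auto
    have "k \<noteq> 0"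
    proof
      assume "k = 0"
      then show False using hk H1 by simp
    qed
    then obtain e where e: "of_nat e * of_nat k = (1 :: 'a)" using ex_of_nat_inverse hk(2) by blast
    have "of_nat e * 1 = of_nat e * h + of_nat e * (of_nat k * x)"
      using hk(3) by (metis distrib_left)
    also have "of_nat e * (of_nat k * x) = x" using e by (metis mult.assoc mult_1)
    finally have "x = - (of_nat e * h) + of_nat e" by (simp add: algebra_simps)
    then show ?thesis using neg mult hk by blast
  qed (rule exI[of _ x], rule exI[of _ 0], simp)
  \<comment> \<open>The chosen integer is determined only modulo the characteristic, which is a
    period of the exponential.\<close>
  define \<psi> where "\<psi> x = cis (2 * pi * real (SOME k. x - of_nat k \<in> H) / real ?p)" for x :: 'a
  have uniq: "[k = k'] (mod ?p)" if "of_nat k - of_nat k' \<in> H" for k k'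
  proof -
    have *: "k < ?p \<Longrightarrow> k' < ?p \<Longrightarrow> of_nat k - of_nat k' \<in> H \<Longrightarrow> k = k'" for k k'
    proof -
      fix k k' assume k: "k < ?p" "k' < ?p" and d: "of_nat k - of_nat k' \<in> H"
      have inj: "inj_on (\<lambda>(h, k). h + of_nat k * 1) (H \<times> {..<?p})"
        by (rule card_add_multiples[OF H0 sub H1])
      have "(of_nat k - of_nat k' :: 'a, k') = (0, k)"
      proof (rule inj_onD[OF inj])
        show "(of_nat k - of_nat k', k') \<in> H \<times> {..<?p}" using d k(2) by (intro SigmaI) auto
        show "(0, k) \<in> H \<times> {..<?p}" using H0 k(1) by (intro SigmaI) auto
      qed simp
      then show "k = k'" by simp
    qed
    have "of_nat (j mod ?p) = (of_nat j :: 'a)" for j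
      by (simp only: of_nat_eq_iff_cong_CHAR cong_def mod_mod_trivial)
    then show ?thesis
      using *[of "k mod ?p" "k' mod ?p"] that pos by (simp add: cong_def)
  qed
  have psi: "\<psi> x = cis (2 * pi * real k / real ?p)" if "x - of_nat k \<in> H" for x k
  proof -
    define j where "j = (SOME k. x - of_nat k \<in> H)"
    have "x - of_nat j \<in> H" unfolding j_def by (rule someI[of _ k]) (rule that)
    from sub[OF that this] have "[j = k] (mod ?p)" by (intro uniq) simp
    then have "[int j = int k] (mod int ?p)" by (simp add: cong_int_iff)
    then obtain m where m: "int j = int k + int ?p * m" by (metis cong_iff_lin cong_sym)
    then have "real j = real k + real ?p * of_int m" by (metis of_int_add of_int_mult of_int_of_nat_eq)
    then have "2 * pi * real j / real ?p = 2 * pi * real k / real ?p + 2 * pi * of_int m"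
      using pos by (simp add: field_simps)
    moreover have "cis (2 * pi * of_int m) = 1" by (rule cis_multiple_2pi) simp
    ultimately show ?thesis by (simp add: \<psi>_def j_def[symmetric] cis_mult[symmetric])
  qed
  have "additive_character \<psi>"
  proof
    fix x y
    obtain h k where x: "h \<in> H" "x = h + of_nat k" using split by blast
    obtain h' k' where y: "h' \<in> H" "y = h' + of_nat k'" using split by blast
    have "x + y - of_nat (k + k') \<in> H" using add[OF x(1) y(1)] by (simp add: x y algebra_simps)
    from psi[OF this] have "\<psi> (x + y) = cis (2 * pi * real k / real ?p + 2 * pi * real k' / real ?p)"
      by (simp add: add_divide_distrib distrib_left)
    also have "\<dots> = \<psi> x * \<psi> y"
      using psi[of x k] psi[of y k'] x y by (simp add: cis_mult)
    finally show "\<psi> (x + y) = \<psi> x * \<psi> y" .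
    show "norm (\<psi> x) = 1" by (simp add: \<psi>_def)
  next
    have "\<psi> 1 = cis (2 * pi / real ?p)" using psi[of 1 1] H0 by simp
    moreover have "cis (2 * pi / real ?p) \<noteq> 1"
    proof
      assume "cis (2 * pi / real ?p) = 1"
      then have "cos (2 * pi / real ?p) = 1" by (simp add: complex_eq_iff)
      then obtain n :: int where "2 * pi / real ?p = real_of_int n * 2 * pi"
        by (auto simp: cos_one_2pi_int)
      then have "1 = real_of_int n * real ?p" using pos by (simp add: field_simps)
      then have "1 = n * int ?p" by (metis of_int_1 of_int_eq_iff of_int_mult of_int_of_nat_eq)
      then show False using pos by (metis dvd_triv_right int_dvd_int_iff nat_dvd_1_iff_1 nat_neq_iff of_nat_1)
    qed
    ultimately show "\<exists>c. \<psi> c \<noteq> 1" by metis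
  qed
  then show ?thesis by blast
qed

context additive_character
begin

lemma psi_0 [simp]: "\<psi> 0 = 1"
proof -
  have "\<psi> 0 \<noteq> 0" by (metis norm_psi norm_zero zero_neq_one)
  then show ?thesis using psi_add[of 0 0] by simp
qed

lemma psi_uminus: "\<psi> (- x) = cnj (\<psi> x)"
proof -
  have "\<psi> x * \<psi> (- x) = 1" using psi_add[of x "- x"] by simp
  moreover have "\<psi> x * cnj (\<psi> x) = 1" by (simp add: complex_norm_square[symmetric])
  moreover have "\<psi> x \<noteq> 0" by (metis norm_psi norm_zero zero_neq_one)
  ultimately show ?thesis by (metis mult_left_cancel)
qed

lemma psi_diff: "\<psi> (x - y) = \<psi> x * cnj (\<psi> y)"
  using psi_add[of x "- y"] by (simp add: psi_uminus)

lemma sum_psi: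
  "(\<Sum>x\<in>UNIV. \<psi> (t * x)) = (if t = 0 then of_nat CARD('a) else 0)"
proof (cases "t = 0")
  case False
  obtain c where c: "\<psi> c \<noteq> 1" using psi_nontrivial by blast
  have "(\<Sum>x\<in>UNIV. \<psi> (t * x)) = (\<Sum>x\<in>UNIV. \<psi> (t * (x + c / t)))"
    by (rule sum.reindex_bij_witness[of _ "\<lambda>x. x + c / t" "\<lambda>x. x - c / t"]) auto
  also have "\<dots> = \<psi> c * (\<Sum>x\<in>UNIV. \<psi> (t * x))"
    using False by (simp add: distrib_left psi_add sum_distrib_left mult.commute)
  finally have "(1 - \<psi> c) * (\<Sum>x\<in>UNIV. \<psi> (t * x)) = 0" by (simp add: algebra_simps)
  with c False show ?thesis by simp
qed simp

end

section \<open>Gauss and Salie sums\<close>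

lemma two_neq_0_if_odd_CARD:
  assumes "odd CARD('a::{field,finite})"
  shows "(2 :: 'a) \<noteq> 0"
proof
  assume "(2 :: 'a) = 0"
  then have "of_nat 2 = (0 :: 'a)" by simp
  then have "CHAR('a) dvd 2" by (simp only: of_nat_eq_0_iff_char_dvd)
  then have "CHAR('a) = 2"
    using prime_CHAR_finite_field[where 'a='a] by (metis primes_dvd_imp_eq two_is_prime_nat)
  then show False
    using assms CHAR_dvd_CARD[where 'a='a] by simp
qed

section \<open>The quadratic character\<close>

definition quad_char :: "'a::field \<Rightarrow> complex" where
  "quad_char x = (if x = 0 then 0 else if \<exists>y. x = y\<^sup>2 then 1 else - 1)"

lemma quad_char_0 [simp]: "quad_char 0 = 0"
  by (simp add: quad_char_def)

lemma quad_char_square: "x \<noteq> 0 \<Longrightarrow> quad_char (x\<^sup>2) = 1"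
  by (auto simp: quad_char_def)

lemma quad_char_1 [simp]: "quad_char 1 = 1"
  using quad_char_square[of 1] by simp

lemma quad_char_cases: "x \<noteq> 0 \<Longrightarrow> quad_char x = 1 \<or> quad_char x = - 1"
  by (auto simp: quad_char_def)

lemma quad_char_mult_square: "y \<noteq> 0 \<Longrightarrow> quad_char (x * y\<^sup>2) = quad_char x"
proof -
  assume y: "y \<noteq> 0"
  have "(\<exists>z. x * y\<^sup>2 = z\<^sup>2) \<longleftrightarrow> (\<exists>z. x = z\<^sup>2)"
  proof
    assume "\<exists>z. x * y\<^sup>2 = z\<^sup>2"
    then obtain z where "x * y\<^sup>2 = z\<^sup>2" ..
    then have "x = (z / y)\<^sup>2" using y by (simp add: field_simps)
    then show "\<exists>z. x = z\<^sup>2" ..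
  next
    assume "\<exists>z. x = z\<^sup>2"
    then obtain z where "x = z\<^sup>2" ..
    then have "x * y\<^sup>2 = (z * y)\<^sup>2" by (simp add: power_mult_distrib)
    then show "\<exists>z. x * y\<^sup>2 = z\<^sup>2" ..
  qed
  then show ?thesis using y by (simp add: quad_char_def)
qed

lemma card_nonzero_squares:
  assumes "(2 :: 'a::{field,finite}) \<noteq> 0"
  shows "2 * card {x :: 'a. quad_char x = 1} = CARD('a) - 1"
proof -
  let ?S = "{x :: 'a. quad_char x = 1}"
  have S: "?S = (\<lambda>x. x\<^sup>2) ` (UNIV - {0})"
    by (auto simp: quad_char_def split: if_splits)
  have two: "card {x :: 'a. x \<in> UNIV - {0} \<and> x\<^sup>2 = y} = 2" if y: "y \<in> ?S" for y
  proof -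
    from y obtain z where z: "z \<noteq> 0" "y = z\<^sup>2" unfolding S by auto
    then have "{x :: 'a. x \<in> UNIV - {0} \<and> x\<^sup>2 = y} = {z, - z}"
      by (auto simp: power2_eq_iff)
    moreover have "z \<noteq> - z"
    proof
      assume "z = - z"
      then have "2 * z = 0" by (metis add.right_inverse mult_2)
      then show False using z assms by simp
    qed
    ultimately show ?thesis by simp
  qed
  have "CARD('a) - 1 = card (UNIV - {0 :: 'a})" by (simp add: card_Diff_singleton)
  also have "\<dots> = (\<Sum>y\<in>?S. card {x :: 'a. x \<in> UNIV - {0} \<and> x\<^sup>2 = y})"
    unfolding card_eq_sum by (rule sum.group[symmetric]) (use S in \<open>auto intro: eq_refl\<close>)
  also have "\<dots> = 2 * card ?S" using two by simp
  finally show ?thesis by simp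
qed

lemma card_nonsquares:
  assumes "(2 :: 'a::{field,finite}) \<noteq> 0"
  shows "card {x :: 'a. quad_char x = - 1} = card {x :: 'a. quad_char x = 1}"
proof -
  have U: "UNIV - {0 :: 'a} = {x. quad_char x = 1} \<union> {x. quad_char x = - 1}"
    using quad_char_cases by auto
  have "CARD('a) - 1 = card (UNIV - {0 :: 'a})" by (simp add: card_Diff_singleton)
  also have "\<dots> = card ({x :: 'a. quad_char x = 1} \<union> {x. quad_char x = - 1})" by (simp only: U)
  also have "\<dots> = card {x :: 'a. quad_char x = 1} + card {x :: 'a. quad_char x = - 1}"
    by (intro card_Un_disjoint) auto
  finally show ?thesis using card_nonzero_squares[OF assms] by simp
qed

text \<open>Multiplication by the nonsquare \<open>x\<close> sends the nonzero squares injectively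
  into the nonsquares, and both sets have the same size. This is the case of two nonsquares in the
  multiplicativity of \<open>quad_char\<close>.\<close>

lemma nonsquare_mult_square:
  assumes 2: "(2 :: 'a::{field,finite}) \<noteq> 0" and x: "quad_char (x :: 'a) = - 1" and y: "quad_char y = - 1"
  shows "\<exists>s. s \<noteq> 0 \<and> y = x * s\<^sup>2"
proof -
  let ?S = "{x :: 'a. quad_char x = 1}" and ?N = "{x :: 'a. quad_char x = - 1}"
  have x0: "x \<noteq> 0" using x by auto
  have S: "z \<in> ?S \<longleftrightarrow> (\<exists>s. s \<noteq> 0 \<and> z = s\<^sup>2)" for z
    by (auto simp: quad_char_def split: if_splits)
  have "(*) x ` ?S \<subseteq> ?N"
  proof
    fix w assume "w \<in> (*) x ` ?S"
    then obtain z where "z \<in> ?S" "w = x * z" by (rule imageE)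
    moreover from this(1) obtain s where "s \<noteq> 0" "z = s\<^sup>2" using S by metis
    ultimately have "s \<noteq> 0" "w = x * s\<^sup>2" by auto
    then show "w \<in> ?N" using x by (simp add: quad_char_mult_square)
  qed
  moreover have "card ((*) x ` ?S) = card ?N"
    using x0 card_nonsquares[OF 2] by (simp add: card_image inj_on_def)
  ultimately have "(*) x ` ?S = ?N" by (intro card_subset_eq) auto
  then have "y \<in> (*) x ` ?S" using y by simp
  then obtain z where z: "z \<in> ?S" "y = x * z" by (rule imageE)
  moreover from z(1) obtain s where "s \<noteq> 0" "z = s\<^sup>2" using S by metis
  ultimately show ?thesis by auto
qed

lemma quad_char_mult:
  assumes 2: "(2 :: 'a::{field,finite}) \<noteq> 0"
  shows "quad_char (x * y :: 'a) = quad_char x * quad_char y"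
proof (cases "x = 0 \<or> y = 0")
  case False
  then have nz: "x \<noteq> 0" "y \<noteq> 0" by auto
  have sq: "\<exists>s. s \<noteq> 0 \<and> z = s\<^sup>2" if "quad_char z = 1" for z :: 'a
    using that by (auto simp: quad_char_def split: if_splits)
  consider "quad_char x = 1" | "quad_char y = 1" | "quad_char x = - 1" "quad_char y = - 1"
    using quad_char_cases nz by blast
  then show ?thesis
  proof cases
    case 1
    with sq obtain s where "s \<noteq> 0" "x = s\<^sup>2" by blast
    then show ?thesis using 1 quad_char_mult_square[of s y] by (simp add: mult.commute)
  next
    case 2
    with sq obtain s where "s \<noteq> 0" "y = s\<^sup>2" by blast
    then show ?thesis using 2 quad_char_mult_square[of s x] by simp
  next
    case 3
    with nonsquare_mult_square[OF 2] obtain s where s: "s \<noteq> 0" "y = x * s\<^sup>2" by blast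
    then have "x * y = (x * s)\<^sup>2" by (simp add: power2_eq_square mult_ac)
    then show ?thesis using 3 s nz quad_char_square[of "x * s"] by simp
  qed
qed auto

lemma quad_char_inverse:
  assumes "x \<noteq> 0"
  shows "quad_char (inverse x) = quad_char x"
proof -
  have "inverse x = x * (inverse x)\<^sup>2" using assms by (simp add: power2_eq_square)
  then show ?thesis using assms quad_char_mult_square[of "inverse x" x] by simp
qed

lemma quad_char_eq_0_iff [simp]: "quad_char x = 0 \<longleftrightarrow> x = 0"
  by (auto simp: quad_char_def)

lemma ex_nonsquare:
  assumes "(2 :: 'a::{field,finite}) \<noteq> 0"
  shows "\<exists>x :: 'a. quad_char x = - 1"
proof -
  have "1 \<in> {x :: 'a. quad_char x = 1}" by simp
  then have "card {x :: 'a. quad_char x = 1} > 0"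
    by (metis card_gt_0_iff empty_iff finite)
  then have "{x :: 'a. quad_char x = - 1} \<noteq> {}"
    using card_nonsquares[OF assms] by (metis card.empty less_numeral_extra(3))
  then show ?thesis by blast
qed

lemma sum_quad_char:
  assumes 2: "(2 :: 'a::{field,finite}) \<noteq> 0"
  shows "(\<Sum>x\<in>UNIV. quad_char (x :: 'a)) = 0"
proof -
  obtain e :: 'a where e: "quad_char e = - 1" using ex_nonsquare[OF 2] by blast
  then have e0: "e \<noteq> 0" by auto
  have "(\<Sum>x\<in>UNIV. quad_char (x :: 'a)) = (\<Sum>x\<in>UNIV. quad_char (e * x))"
    by (rule sum.reindex_bij_witness[of _ "\<lambda>x. e * x" "\<lambda>x. x / e"]) (use e0 in auto)
  also have "\<dots> = - (\<Sum>x\<in>UNIV. quad_char (x :: 'a))"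
    by (simp add: quad_char_mult[OF 2] e sum_negf)
  finally show ?thesis by simp
qed

section \<open>Moduli of Gauss and Salie sums\<close>

context additive_character
begin

text \<open>In \<open>g * cnj g\<close> the substitution \<open>t = u * v\<close> separates the
  variables: the sum over \<open>u\<close> detects \<open>v = 1\<close>, and what is left over is a
  multiple of the vanishing sum of \<open>quad_char\<close>.\<close>

lemma norm_gauss_sum:
  assumes 2: "(2 :: 'a) \<noteq> 0" and a: "a \<noteq> 0"
  shows "norm (\<Sum>t\<in>UNIV. quad_char t * \<psi> (a * t)) = sqrt (real CARD('a))"
proof -
  define g where "g = (\<Sum>t\<in>UNIV. quad_char t * \<psi> (a * t))"
  have cnj_q: "cnj (quad_char t) = quad_char t" for t :: 'a by (simp add: quad_char_def)
  have sq: "quad_char t * quad_char t = 1" if "t \<noteq> 0" for t :: 'a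
    using quad_char_cases[OF that] by auto
  have "g * cnj g = (\<Sum>u\<in>UNIV. \<Sum>t\<in>UNIV. quad_char t * quad_char u * \<psi> (a * (t - u)))"
    unfolding g_def cnj_sum sum_product
    by (subst sum.swap) (simp add: cnj_q right_diff_distrib psi_diff mult_ac)
  also have "\<dots> = (\<Sum>u\<in>UNIV-{0}. \<Sum>t\<in>UNIV. quad_char t * quad_char u * \<psi> (a * (t - u)))"
    by (intro sum.mono_neutral_right) auto
  also have "\<dots> = (\<Sum>u\<in>UNIV-{0}. \<Sum>v\<in>UNIV. quad_char v * \<psi> (a * (v - 1) * u))"
  proof (rule sum.cong[OF refl])
    fix u :: 'a assume u: "u \<in> UNIV - {0}"
    show "(\<Sum>t\<in>UNIV. quad_char t * quad_char u * \<psi> (a * (t - u)))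
        = (\<Sum>v\<in>UNIV. quad_char v * \<psi> (a * (v - 1) * u))"
    proof (rule sum.reindex_bij_witness[of _ "\<lambda>v. u * v" "\<lambda>t. t / u"])
      fix t :: 'a
      have "quad_char (t / u) = quad_char t * quad_char u"
        using u by (simp add: divide_inverse quad_char_mult[OF 2] quad_char_inverse)
      moreover have "a * (t / u - 1) * u = a * (t - u)"
        using u by (simp add: field_simps)
      ultimately show "quad_char (t / u) * \<psi> (a * (t / u - 1) * u)
          = quad_char t * quad_char u * \<psi> (a * (t - u))" by (simp only:)
    qed (use u in auto)
  qed
  also have "\<dots> = (\<Sum>v\<in>UNIV. quad_char v * (\<Sum>u\<in>UNIV-{0}. \<psi> (a * (v - 1) * u)))"
    by (subst sum.swap) (simp add: sum_distrib_left)
  also have "\<dots> = (\<Sum>v::'a\<in>UNIV. quad_char v * ((if v = 1 then of_nat CARD('a) else 0) - 1))"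
  proof (rule sum.cong[OF refl])
    fix v :: 'a
    have A: "(\<Sum>u\<in>UNIV. \<psi> (a * (v - 1) * u)) = (if v = 1 then of_nat CARD('a) else 0)"
      using a by (simp add: sum_psi)
    have B: "(\<Sum>u\<in>UNIV. \<psi> (a * (v - 1) * u)) = 1 + (\<Sum>u\<in>UNIV-{0}. \<psi> (a * (v - 1) * u))"
      by (subst sum.remove[of _ 0]) auto
    have "(\<Sum>u\<in>UNIV-{0}. \<psi> (a * (v - 1) * u)) = (if v = 1 then of_nat CARD('a) else 0) - 1"
      unfolding A[symmetric] B by (rule add_diff_cancel_left'[symmetric])
    then show "quad_char v * (\<Sum>u\<in>UNIV-{0}. \<psi> (a * (v - 1) * u))
        = quad_char v * ((if v = 1 then of_nat CARD('a) else 0) - 1)" by (simp only:)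
  qed
  also have "\<dots> = (\<Sum>v::'a\<in>UNIV. quad_char v * (if v = 1 then of_nat CARD('a) else 0)) - (\<Sum>v\<in>UNIV. quad_char (v::'a))"
    by (simp add: right_diff_distrib sum_subtractf)
  also have "\<dots> = of_nat CARD('a)"
    by (simp add: sum_quad_char[OF 2] if_distrib[of "\<lambda>x. _ * x"] sum.delta cong: if_cong)
  finally have "complex_of_real ((norm g)\<^sup>2) = of_real (real CARD('a))"
    by (simp only: complex_norm_square of_real_of_nat_eq)
  then have "(norm g)\<^sup>2 = real CARD('a)" by (simp only: of_real_eq_iff)
  then show ?thesis unfolding g_def[symmetric] by (metis norm_ge_zero real_sqrt_unique)
qed

text \<open>
  The substitution \<open>u = t + s\<^sup>2 / t\<close> turns a Salie sum into two shifted Gauss sums, since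
  \<open>u \<plusminus> 2 s = (t \<plusminus> s)\<^sup>2 / t\<close>.
\<close>

lemma sum_quad_char_fibre:
  assumes 2: "(2 :: 'a) \<noteq> 0" and s: "s \<noteq> (0 :: 'a)"
  shows "(\<Sum>t | t \<noteq> 0 \<and> t + s\<^sup>2 / t = u. quad_char t) = quad_char (u + 2 * s) + quad_char (u - 2 * s)"
proof (cases "\<exists>t. t \<noteq> 0 \<and> t + s\<^sup>2 / t = u")
  case True
  then obtain t where t: "t \<noteq> 0" "t + s\<^sup>2 / t = u" by blast
  have T: "{t. t \<noteq> 0 \<and> t + s\<^sup>2 / t = u} = {t, s\<^sup>2 / t}"
  proof (intro equalityI subsetI)
    fix x assume "x \<in> {t. t \<noteq> 0 \<and> t + s\<^sup>2 / t = u}"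
    then have x: "x \<noteq> 0" "x + s\<^sup>2 / x = t + s\<^sup>2 / t" using t by auto
    then have "t * (x * x) + t * s\<^sup>2 = t * (t * x) + x * s\<^sup>2" using t(1) by (simp add: field_simps)
    then have "(x - t) * (x * t - s\<^sup>2) = 0" by (simp add: algebra_simps)
    then have "x = t \<or> x * t = s\<^sup>2" by simp
    then show "x \<in> {t, s\<^sup>2 / t}" using t(1) by (auto simp: eq_divide_eq)
  qed (use t s in \<open>auto simp: add.commute\<close>)
  have plus: "u + 2 * s = t * ((t + s) / t)\<^sup>2"
    unfolding t(2)[symmetric] using t(1) by (simp add: field_simps power2_eq_square)
  have minus: "u - 2 * s = t * ((t - s) / t)\<^sup>2"
    unfolding t(2)[symmetric] using t(1) by (simp add: field_simps power2_eq_square)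
  have inv: "quad_char (s\<^sup>2 / t) = quad_char t"
    using quad_char_mult_square[OF s, of "inverse t"] quad_char_inverse[OF t(1)]
    by (simp add: divide_inverse mult.commute)
  show ?thesis
  proof (cases "t = s \<or> t = - s")
    \<comment> \<open>Here \<open>u\<close> is \<open>2 * s\<close> or \<open>- 2 * s\<close>: the
      fibre is a double point, and one of the two characters vanishes.\<close>
    case True
    then have "s\<^sup>2 / t = t" using s by (auto simp: power2_eq_square)
    moreover have "quad_char (u + 2 * s) + quad_char (u - 2 * s) = quad_char t"
    proof -
      have q: "t * (2 * t / t)\<^sup>2 = t * 2\<^sup>2" using t by simp
      have *: "quad_char (t * (2 * t / t)\<^sup>2) = quad_char t"
        unfolding q using 2 by (rule quad_char_mult_square)
      show ?thesis
        unfolding plus minus using True * by (auto simp flip: mult_2)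
    qed
    ultimately show ?thesis unfolding T by simp
  next
    case False
    then have nz: "t - s \<noteq> 0" "t + s \<noteq> 0" by (auto simp: eq_neg_iff_add_eq_0)
    have "s\<^sup>2 / t \<noteq> t"
    proof
      assume "s\<^sup>2 / t = t"
      then have "t\<^sup>2 = s\<^sup>2" using t(1) by (simp add: field_simps power2_eq_square)
      then show False using False by (simp add: power2_eq_iff)
    qed
    then have "(\<Sum>t | t \<noteq> 0 \<and> t + s\<^sup>2 / t = u. quad_char t) = quad_char t + quad_char t"
      unfolding T by (simp add: inv)
    moreover have "quad_char (u + 2 * s) = quad_char t" "quad_char (u - 2 * s) = quad_char t"
      unfolding plus minus using nz t(1) by (auto intro!: quad_char_mult_square)
    ultimately show ?thesis by simp
  qed
next
  case False
  then have empty: "{t. t \<noteq> 0 \<and> t + s\<^sup>2 / t = u} = {}" by blast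
  \<comment> \<open>The fibre consists of the roots of \<open>t^2 - u t + s^2\<close>. A square root
    \<open>w\<close> of the discriminant \<open>(u + 2 s) (u - 2 s)\<close> would give the root
    \<open>(u + w) / 2\<close>; without one, the two characters are opposite.\<close>
  have nsq: "(u + 2 * s) * (u - 2 * s) \<noteq> w\<^sup>2" for w
  proof
    assume w: "(u + 2 * s) * (u - 2 * s) = w\<^sup>2"
    define t where "t = (u + w) / 2"
    have eq: "t * (u - t) = s\<^sup>2"
    proof -
      have tw: "2 * t = u + w" using 2 by (simp add: t_def)
      have "4 * (t * (u - t)) = (2 * t) * (2 * u - 2 * t)" by (simp add: algebra_simps)
      also have "\<dots> = (u + w) * (u - w)" unfolding tw by (simp add: algebra_simps)
      also have "\<dots> = 4 * s\<^sup>2" using w by (simp add: algebra_simps power2_eq_square)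
      finally have "2 * 2 * (t * (u - t)) = 2 * 2 * s\<^sup>2" by simp
      then show ?thesis using 2 by (simp only: mult.assoc mult_left_cancel[OF 2])
    qed
    then have "t \<noteq> 0" using s by auto
    moreover have "t + s\<^sup>2 / t = u" unfolding eq[symmetric] using \<open>t \<noteq> 0\<close> by simp
    ultimately show False using False by blast
  qed
  then have "(u + 2 * s) * (u - 2 * s) \<noteq> 0" by (metis zero_power2)
  with nsq have "quad_char ((u + 2 * s) * (u - 2 * s)) = - 1" by (auto simp: quad_char_def)
  then have m: "quad_char (u + 2 * s) * quad_char (u - 2 * s) = - 1"
    by (simp add: quad_char_mult[OF 2])
  have "u + 2 * s \<noteq> 0" "u - 2 * s \<noteq> 0" using \<open>(u + 2 * s) * (u - 2 * s) \<noteq> 0\<close> by auto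
  then have "quad_char (u + 2 * s) + quad_char (u - 2 * s) = 0"
    using m quad_char_cases[of "u + 2 * s"] quad_char_cases[of "u - 2 * s"] by auto
  then show ?thesis unfolding empty by simp
qed

text \<open>The map \<open>t -> b / (a t)\<close> exchanges \<open>a t\<close> and
  \<open>b / t\<close> and multiplies \<open>quad_char t\<close> by \<open>quad_char (a b)\<close>,
  so the sum is its own negative when \<open>a b\<close> is a nonsquare. When
  \<open>a b = s^2\<close>, rescaling \<open>t\<close> by \<open>a\<close> gives the phase
  \<open>t + s^2 / t\<close>, and grouping by its value leaves two Gauss sums. For
  \<open>b = 0\<close> the sum is a Gauss sum.\<close>

lemma norm_salie_sum_le:
  assumes 2: "(2 :: 'a) \<noteq> 0" and a: "a \<noteq> 0"
  shows "norm (\<Sum>t\<in>UNIV-{0}. quad_char t * \<psi> (a * t + b / t)) \<le> 2 * sqrt (real CARD('a))"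
proof -
  define S where "S = (\<Sum>t\<in>UNIV-{0}. quad_char t * \<psi> (a * t + b / t))"
  consider "b = 0" | "b \<noteq> 0" "quad_char (a * b) = - 1" | "b \<noteq> 0" "quad_char (a * b) = 1"
    using quad_char_cases[of "a * b"] a by auto
  then have "norm S \<le> 2 * sqrt (real CARD('a))"
  proof cases
    case 1
    have "S = (\<Sum>t\<in>UNIV. quad_char t * \<psi> (a * t))"
      unfolding S_def 1 by (intro sum.mono_neutral_cong_left) auto
    then have "norm S = sqrt (real CARD('a))" using norm_gauss_sum[OF 2 a] by simp
    then show ?thesis by simp
  next
    case nsq: 2
    have qc: "quad_char (b / (a * t)) = - quad_char t" if "t \<noteq> 0" for t
    proof -
      have "b / (a * t) = (a * b) * inverse t * (inverse a)\<^sup>2"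
        using a by (simp add: field_simps power2_eq_square)
      then have "quad_char (b / (a * t)) = quad_char ((a * b) * inverse t)"
        using a quad_char_mult_square[of "inverse a"] by simp
      also have "\<dots> = - quad_char t"
        using that by (simp add: quad_char_mult[OF 2, of "a * b"] nsq quad_char_inverse)
      finally show ?thesis .
    qed
    have inv: "a * (b / (a * t)) = b / t" "b / (b / (a * t)) = a * t" "b / (a * (b / (a * t))) = t"
      "b / (a * t) \<noteq> 0" if "t \<noteq> 0" for t
      using a nsq(1) that by (auto simp: field_simps)
    have "S = (\<Sum>t\<in>UNIV-{0}. - (quad_char t * \<psi> (a * t + b / t)))"
      unfolding S_def
    proof (rule sum.reindex_bij_witness[of _ "\<lambda>t. b / (a * t)" "\<lambda>t. b / (a * t)"])
      fix t assume "t \<in> UNIV - {0 :: 'a}"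
      then have t: "t \<noteq> 0" by simp
      show "b / (a * (b / (a * t))) = t" "b / (a * (b / (a * t))) = t" using inv[OF t] by (simp_all only:)
      show "b / (a * t) \<in> UNIV - {0}" "b / (a * t) \<in> UNIV - {0}" using inv(4)[OF t] by simp_all
      show "- (quad_char (b / (a * t)) * \<psi> (a * (b / (a * t)) + b / (b / (a * t))))
          = quad_char t * \<psi> (a * t + b / t)"
        unfolding inv(1,2)[OF t] qc[OF t] by (simp add: add.commute)
    qed
    then have "S = - S" unfolding S_def by (simp add: sum_negf)
    then have "S = 0" by simp
    then show ?thesis by simp
  next
    case 3
    then obtain s where s: "a * b = s\<^sup>2"
      by (auto simp: quad_char_def split: if_splits)
    then have "s \<noteq> 0" using a 3 by auto
    note s = s this
    have b: "b = s\<^sup>2 / a" using a s by (simp add: field_simps)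
    define g where "g = (\<Sum>t\<in>UNIV. quad_char t * \<psi> (1 * t))"
    have shift: "(\<Sum>u\<in>UNIV. quad_char (u + c) * \<psi> u) = \<psi> (- c) * g" for c
    proof -
      have "(\<Sum>u\<in>UNIV. quad_char (u + c) * \<psi> u) = (\<Sum>u\<in>UNIV. quad_char u * \<psi> (u + - c))"
        by (rule sum.reindex_bij_witness[of _ "\<lambda>u. u - c" "\<lambda>u. u + c"]) auto
      then show ?thesis unfolding g_def psi_add by (simp add: sum_distrib_left mult_ac)
    qed
    have "S = quad_char a * (\<Sum>t\<in>UNIV-{0}. quad_char t * \<psi> (t + s\<^sup>2 / t))"
    proof -
      have qa: "quad_char (t / a) = quad_char a * quad_char t" for t
        using a by (simp add: divide_inverse quad_char_mult[OF 2] quad_char_inverse)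
      have "S = (\<Sum>t\<in>UNIV-{0}. quad_char (t / a) * \<psi> (t + s\<^sup>2 / t))"
        unfolding S_def b
        by (rule sum.reindex_bij_witness[of _ "\<lambda>t. t / a" "\<lambda>t. a * t"]) (use a in auto)
      then show ?thesis by (simp add: qa sum_distrib_left mult.assoc)
    qed
    also have "(\<Sum>t\<in>UNIV-{0}. quad_char t * \<psi> (t + s\<^sup>2 / t))
        = (\<Sum>u\<in>UNIV. \<Sum>t | t \<in> UNIV - {0} \<and> t + s\<^sup>2 / t = u. quad_char t * \<psi> (t + s\<^sup>2 / t))"
      by (rule sum.group[symmetric]) auto
    also have "\<dots> = (\<Sum>u\<in>UNIV. (\<Sum>t | t \<noteq> 0 \<and> t + s\<^sup>2 / t = u. quad_char t) * \<psi> u)"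
      unfolding sum_distrib_right by (intro sum.cong) auto
    also have "\<dots> = (\<Sum>u\<in>UNIV. quad_char (u + 2 * s) * \<psi> u) + (\<Sum>u\<in>UNIV. quad_char (u + - (2 * s)) * \<psi> u)"
      by (simp add: sum_quad_char_fibre[OF 2 s(2)] distrib_right sum.distrib)
    also have "\<dots> = (\<psi> (- (2 * s)) + \<psi> (2 * s)) * g"
      unfolding shift by (simp add: distrib_right)
    finally have "norm S = norm (quad_char a) * norm (\<psi> (- (2 * s)) + \<psi> (2 * s)) * norm g"
      by (simp add: norm_mult)
    moreover have "norm (quad_char a) = 1" using quad_char_cases[OF a] by auto
    moreover have "norm g = sqrt (real CARD('a))" unfolding g_def using 2 by (rule norm_gauss_sum) simp
    moreover have "norm (\<psi> (- (2 * s)) + \<psi> (2 * s)) \<le> 2"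
      using norm_triangle_ineq[of "\<psi> (- (2 * s))" "\<psi> (2 * s)"] by simp
    ultimately show ?thesis by (simp add: mult_right_mono)
  qed
  then show ?thesis unfolding S_def .
qed

end

section \<open>The L-function of a Kloosterman sum\<close>

lemma proots_prod_linear: "proots (\<Prod>x\<in>#A. [:- x, 1:]) = (A :: 'a::idom multiset)"
proof (induction A)
  case (add x A)
  have "(\<Prod>x\<in>#A. [:- x, 1:]) \<noteq> 0" by (auto simp: prod_mset_zero_iff)
  then have "proots ([:- x, 1:] * (\<Prod>x\<in>#A. [:- x, 1:])) = proots [:- x, 1:] + proots (\<Prod>x\<in>#A. [:- x, 1:])"
    by (intro proots_mult) simp_all
  also have "\<dots> = add_mset x A" unfolding add by simp
  finally show ?case by (simp only: image_mset_add_mset prod_mset.add_mset)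
qed simp

lemma order_simple_root:
  fixes p :: "'a::field poly"
  assumes p: "p \<noteq> 0" "poly p x = 0" and "poly (pderiv p) x \<noteq> 0"
  shows "order x p = 1"
proof -
  have "order x p \<noteq> 0" using p order_root by blast
  moreover have "\<not> 2 \<le> order x p"
  proof
    assume "2 \<le> order x p"
    then have "[:- x, 1:] ^ 2 dvd p" by (simp add: order_divides)
    then obtain s where s: "p = [:- x, 1:] ^ 2 * s" ..
    define l where "l = [:- x, 1:]"
    have "p = l * (l * s)" using s unfolding l_def by (simp only: power2_eq_square mult.assoc)
    then have "pderiv p = l * pderiv (l * s) + l * s * pderiv l" by (simp only: pderiv_mult)
    moreover have "poly l x = 0" by (simp add: l_def)
    ultimately have "poly (pderiv p) x = 0" by simp
    then show False using assms(3) by simp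
  qed
  ultimately show ?thesis by linarith
qed

lemma proots_factorization:
  fixes p :: "'a::alg_closed_field poly"
  assumes "p \<noteq> 0"
  shows "p = smult (lead_coeff p) (\<Prod>x\<in>#proots p. [:-x, 1:])"
    and size_proots_alg_closed: "size (proots p) = degree p"
proof -
  from alg_closed_imp_factorization[OF assms] obtain A
    where A: "size A = degree p" "p = smult (lead_coeff p) (\<Prod>x\<in>#A. [:-x, 1:])" by blast
  have "proots p = A"
    using assms by (subst A(2)) (simp add: proots_prod_linear)
  then show "p = smult (lead_coeff p) (\<Prod>x\<in>#proots p. [:-x, 1:])" "size (proots p) = degree p"
    using A by simp_all
qed

lemma dvd_if_proots_subset:
  fixes p q :: "'a::alg_closed_field poly"
  assumes "p \<noteq> 0" "q \<noteq> 0" "proots p \<subseteq># proots q"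
  shows "p dvd q"
proof -
  let ?f = "\<lambda>A. \<Prod>x\<in>#A. [:-x, 1:]"
  have "?f (proots p) dvd ?f (proots q)"
    using assms(3) by (intro prod_mset_subset_imp_dvd image_mset_subseteq_mono)
  then have "smult (lead_coeff p) (?f (proots p)) dvd smult (lead_coeff q) (?f (proots q))"
    using assms by (simp add: smult_dvd_iff dvd_smult)
  then show ?thesis using proots_factorization(1) assms by metis
qed

lemma card_roots_squarefree:
  fixes p :: "'a::alg_closed_field poly"
  assumes "p \<noteq> 0" "\<And>x. poly p x = 0 \<Longrightarrow> poly (pderiv p) x \<noteq> 0"
  shows "card {x. poly p x = 0} = degree p"
proof -
  have "size (proots p) = (\<Sum>x\<in>set_mset (proots p). count (proots p) x)"
    by (simp add: size_multiset_overloaded_eq)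
  also have "\<dots> = (\<Sum>x | poly p x = 0. order x p)" using assms(1) by simp
  also have "\<dots> = (\<Sum>x | poly p x = 0. 1)"
    using assms order_simple_root[of p] by (intro sum.cong) auto
  finally show ?thesis using size_proots_alg_closed[OF assms(1)] by simp
qed

section \<open>Finite subfields of the closure, their Frobenius and trace\<close>

definition frob_fixed :: "nat \<Rightarrow> nat \<Rightarrow> 'k::field set" where
  "frob_fixed q n = {x. x ^ (q ^ n) = x}"

definition frob_trace :: "nat \<Rightarrow> nat \<Rightarrow> 'k::field \<Rightarrow> 'k" where
  "frob_trace q n x = (\<Sum>i<n. x ^ (q ^ i))"

text \<open>Only the values of \<open>\<psi>\<close> on \<open>frob_fixed q 1\<close>, the copy of
  the field with \<open>q\<close> elements, are constrained. The extension of degree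
  \<open>n\<close> is \<open>frob_fixed q n\<close>, a subset of the same closed field, and
  \<open>frob_trace q n\<close> is its trace down to \<open>frob_fixed q 1\<close>.\<close>

locale closure_character =
  fixes q r :: nat and \<psi> :: "'k::alg_closed_field \<Rightarrow> complex"
  assumes prime_CHAR: "prime CHAR('k)"
    and q_eq: "q = CHAR('k) ^ r"
    and r_pos: "0 < r"
    and psi_add: "x \<in> frob_fixed q 1 \<Longrightarrow> y \<in> frob_fixed q 1 \<Longrightarrow> \<psi> (x + y) = \<psi> x * \<psi> y"
    and norm_psi: "x \<in> frob_fixed q 1 \<Longrightarrow> norm (\<psi> x) = 1"
    and psi_nontrivial: "\<exists>c\<in>frob_fixed q 1. \<psi> c \<noteq> 1"
begin

abbreviation Fq :: "nat \<Rightarrow> 'k set" where "Fq \<equiv> frob_fixed q"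
abbreviation Tr :: "nat \<Rightarrow> 'k \<Rightarrow> 'k" where "Tr \<equiv> frob_trace q"

lemma q_gt_1: "1 < q"
  unfolding q_eq using prime_gt_1_nat[OF prime_CHAR] r_pos by (rule one_less_power)

lemma q_pow_eq: "q ^ n = CHAR('k) ^ (r * n)"
  by (simp add: q_eq power_mult)

lemma q_pow_pos: "0 < q ^ n"
  using q_gt_1 by (intro zero_less_power) linarith

lemma frob_0 [simp]: "(0 :: 'k) ^ (q ^ n) = 0"
  using q_pow_pos[of n] by (simp only: power_0_left) simp

lemma of_nat_q: "of_nat (q ^ n) = (0 :: 'k)" if "0 < n"
proof -
  have "CHAR('k) dvd q ^ n" unfolding q_pow_eq using r_pos that by (intro dvd_power) simp_all
  then show ?thesis by (simp only: of_nat_eq_0_iff_char_dvd)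
qed

lemma frob_add: "(x + y) ^ (q ^ n) = x ^ (q ^ n) + y ^ (q ^ n)" for x y :: 'k
  by (rule freshmans_dream'[OF prime_CHAR q_pow_eq])

lemma frob_sum: "(\<Sum>i\<in>A. f i) ^ (q ^ n) = (\<Sum>i\<in>A. f i ^ (q ^ n))" for f :: "'b \<Rightarrow> 'k"
  by (rule freshmans_dream_sum'[OF prime_CHAR q_pow_eq])

lemma frob_uminus: "(- x) ^ (q ^ n) = - (x ^ (q ^ n))" for x :: 'k
proof -
  have "(x + - x) ^ (q ^ n) = x ^ (q ^ n) + (- x) ^ (q ^ n)" by (rule frob_add)
  moreover have "(x + - x) ^ (q ^ n) = 0" by simp
  ultimately show ?thesis by (metis add_eq_0_iff)
qed

lemma frob_diff: "(x - y) ^ (q ^ n) = x ^ (q ^ n) - y ^ (q ^ n)" for x y :: 'k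
  using frob_add[of x "- y" n] by (simp add: frob_uminus)

lemma frob_inj: "x ^ (q ^ n) = y ^ (q ^ n) \<longleftrightarrow> x = y" for x y :: 'k
proof
  assume "x ^ (q ^ n) = y ^ (q ^ n)"
  then have "(x - y) ^ (q ^ n) = 0" by (simp add: frob_diff)
  then show "x = y" by simp
qed simp

lemma frob_frob: "(x ^ (q ^ m)) ^ (q ^ n) = x ^ (q ^ (m + n))" for x :: 'k
  by (simp add: power_add flip: power_mult)

lemma Fq_0 [simp]: "0 \<in> Fq n" by (simp add: frob_fixed_def)
lemma Fq_1 [simp]: "1 \<in> Fq n" by (simp add: frob_fixed_def)
lemma Fq_add: "x \<in> Fq n \<Longrightarrow> y \<in> Fq n \<Longrightarrow> x + y \<in> Fq n" by (simp add: frob_fixed_def frob_add)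
lemma Fq_diff: "x \<in> Fq n \<Longrightarrow> y \<in> Fq n \<Longrightarrow> x - y \<in> Fq n" by (simp add: frob_fixed_def frob_diff)
lemma Fq_uminus: "x \<in> Fq n \<Longrightarrow> - x \<in> Fq n" by (simp add: frob_fixed_def frob_uminus)
lemma Fq_mult: "x \<in> Fq n \<Longrightarrow> y \<in> Fq n \<Longrightarrow> x * y \<in> Fq n"
  by (simp add: frob_fixed_def power_mult_distrib)
lemma Fq_divide: "x \<in> Fq n \<Longrightarrow> y \<in> Fq n \<Longrightarrow> x / y \<in> Fq n"
  by (simp add: frob_fixed_def power_divide)
lemma Fq_power: "x \<in> Fq n \<Longrightarrow> x ^ k \<in> Fq n"
  by (simp add: frob_fixed_def flip: power_mult) (metis mult.commute power_mult)
lemma Fq_numeral [simp]: "numeral k \<in> Fq n"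
proof -
  have "of_nat m \<in> Fq n" for m by (induction m) (auto intro: Fq_add)
  from this[of "numeral k"] show ?thesis by simp
qed

lemma Fq_mono: "x \<in> Fq m \<Longrightarrow> x \<in> Fq (m * k)"
proof (induction k)
  case (Suc k)
  then have "x ^ (q ^ (m * k)) = x" "x ^ (q ^ m) = x" by (auto simp: frob_fixed_def)
  then have "x ^ (q ^ (m * k + m)) = x" by (metis frob_frob)
  then show ?case by (simp add: frob_fixed_def add.commute)
qed (simp add: frob_fixed_def)

lemma Fq_1_subset: "x \<in> Fq 1 \<Longrightarrow> x \<in> Fq n"
  using Fq_mono[of x 1 n] by simp

text \<open>The polynomial \<open>X ^ (q ^ n) - X\<close> has derivative \<open>- 1\<close>, so all
  its roots in the closed field are simple.\<close>

lemma card_Fq: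
  assumes "0 < n"
  shows "card (Fq n) = q ^ n"
proof -
  let ?p = "monom 1 (q ^ n) - [:0, 1 :: 'k:]"
  have q: "1 < q ^ n" using q_gt_1 assms by (rule one_less_power)
  have deg: "degree ?p = q ^ n"
    using q by (subst diff_conv_add_uminus, subst degree_add_eq_left) (auto simp: degree_monom_eq)
  have nz: "?p \<noteq> 0"
  proof
    assume "?p = 0"
    then have "degree ?p = 0" by (simp only: degree_0)
    then show False using deg q by linarith
  qed
  have "pderiv (monom 1 (q ^ n)) = (0 :: 'k poly)"
    by (simp only: pderiv_monom of_nat_q[OF assms]) simp
  then have "pderiv ?p = - 1" by (simp only: pderiv_diff) (simp add: pderiv_pCons one_pCons)
  then have "poly (pderiv ?p) x \<noteq> 0" for x by simp
  from card_roots_squarefree[OF nz this] have "card {x. poly ?p x = 0} = q ^ n" by (simp add: deg)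
  moreover have "{x. poly ?p x = 0} = Fq n" by (auto simp: frob_fixed_def poly_monom)
  ultimately show ?thesis by simp
qed

lemma finite_Fq: "0 < n \<Longrightarrow> finite (Fq n)"
  using card_Fq q_pow_pos by (metis card.infinite less_irrefl)

lemma psi_0 [simp]: "\<psi> 0 = 1"
proof -
  have "\<psi> 0 \<noteq> 0" using norm_psi[of 0] by auto
  then show ?thesis using psi_add[of 0 0] by simp
qed

lemma sum_psi:
  assumes t: "t \<in> Fq 1"
  shows "(\<Sum>x\<in>Fq 1. \<psi> (t * x)) = (if t = 0 then of_nat q else 0)"
proof (cases "t = 0")
  case True
  then show ?thesis using card_Fq[of 1] by simp
next
  case False
  obtain c where c: "c \<in> Fq 1" "\<psi> c \<noteq> 1" using psi_nontrivial by blast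
  have ct: "c / t \<in> Fq 1" by (rule Fq_divide[OF c(1) t])
  have "(\<Sum>x\<in>Fq 1. \<psi> (t * x)) = (\<Sum>x\<in>Fq 1. \<psi> (t * (x + c / t)))"
    by (rule sum.reindex_bij_witness[of _ "\<lambda>x. x + c / t" "\<lambda>x. x - c / t"])
      (use ct in \<open>auto intro: Fq_add Fq_diff\<close>)
  also have "\<dots> = (\<Sum>x\<in>Fq 1. \<psi> c * \<psi> (t * x))"
  proof (rule sum.cong[OF refl])
    fix x assume "x \<in> Fq 1"
    then have "\<psi> (t * x + c) = \<psi> (t * x) * \<psi> c" by (intro psi_add Fq_mult t c)
    then show "\<psi> (t * (x + c / t)) = \<psi> c * \<psi> (t * x)" using False by (simp add: distrib_left)
  qed
  also have "\<dots> = \<psi> c * (\<Sum>x\<in>Fq 1. \<psi> (t * x))" by (rule sum_distrib_left[symmetric])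
  finally have "(\<Sum>x\<in>Fq 1. \<psi> (t * x)) = 0" using c(2) by (metis mult_cancel_right1)
  with False show ?thesis by simp
qed

lemma psi_uminus: "x \<in> Fq 1 \<Longrightarrow> \<psi> (- x) = cnj (\<psi> x)"
proof -
  assume x: "x \<in> Fq 1"
  have "\<psi> x * \<psi> (- x) = 1" using psi_add[OF x Fq_uminus[OF x]] by simp
  moreover have "\<psi> x * cnj (\<psi> x) = 1" using norm_psi[OF x] by (simp add: complex_norm_square[symmetric])
  moreover have "\<psi> x \<noteq> 0" using norm_psi[OF x] by auto
  ultimately show ?thesis by (metis mult_left_cancel)
qed

lemma Tr_add: "Tr n (x + y) = Tr n x + Tr n y"
  by (simp add: frob_trace_def frob_add sum.distrib)

lemma Tr_uminus: "Tr n (- x) = - Tr n x"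
  by (simp add: frob_trace_def frob_uminus sum_negf)

lemma Tr_scale: "t \<in> Fq 1 \<Longrightarrow> Tr n (t * x) = t * Tr n x"
proof -
  assume t: "t \<in> Fq 1"
  have "t ^ (q ^ i) = t" for i using Fq_1_subset[OF t, of i] by (simp add: frob_fixed_def)
  then show ?thesis by (simp add: frob_trace_def power_mult_distrib sum_distrib_left)
qed

lemma Tr_artin_schreier: "y \<in> Fq n \<Longrightarrow> Tr n (y ^ q - y) = 0"
proof -
  assume y: "y \<in> Fq n"
  have "Tr n (y ^ q - y) = (\<Sum>i<n. y ^ (q ^ Suc i) - y ^ (q ^ i))"
    by (simp add: frob_trace_def frob_diff flip: power_mult)
  also have "\<dots> = y ^ (q ^ n) - y"
    by (subst sum_lessThan_telescope) simp
  finally show ?thesis using y by (simp add: frob_fixed_def)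
qed

lemma Tr_in_Fq: "x \<in> Fq n \<Longrightarrow> Tr n x \<in> Fq 1"
proof -
  assume x: "x \<in> Fq n"
  have "(Tr n x) ^ (q ^ 1) - Tr n x = (\<Sum>i<n. (x ^ (q ^ i)) ^ (q ^ 1)) - Tr n x"
    unfolding frob_trace_def frob_sum ..
  also have "\<dots> = (\<Sum>i<n. x ^ (q ^ Suc i) - x ^ (q ^ i))"
    unfolding frob_frob frob_trace_def by (simp add: sum_subtractf)
  also have "\<dots> = x ^ (q ^ n) - x"
    by (subst sum_lessThan_telescope) simp
  finally show ?thesis using x by (simp add: frob_fixed_def)
qed

section \<open>Monic polynomials over the base field and a completely multiplicative character on
  them\<close>

definition frob_poly :: "nat \<Rightarrow> 'k poly \<Rightarrow> 'k poly" where
  "frob_poly n p = map_poly (\<lambda>c. c ^ (q ^ n)) p"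

lemma coeff_frob_poly [simp]: "coeff (frob_poly n p) i = coeff p i ^ (q ^ n)"
  unfolding frob_poly_def by (rule coeff_map_poly) simp

lemma frob_poly_mult: "frob_poly n (p * g) = frob_poly n p * frob_poly n g"
  by (rule poly_eqI) (simp add: coeff_mult frob_sum power_mult_distrib)

lemma frob_poly_add: "frob_poly n (p + g) = frob_poly n p + frob_poly n g"
  by (rule poly_eqI) (simp add: frob_add)

lemma frob_poly_diff: "frob_poly n (p - g) = frob_poly n p - frob_poly n g"
  by (rule poly_eqI) (simp add: frob_diff)

lemma frob_poly_1 [simp]: "frob_poly n 1 = 1"
  by (rule poly_eqI) simp

lemma frob_poly_prod: "frob_poly n (\<Prod>i\<in>A. f i) = (\<Prod>i\<in>A. frob_poly n (f i))"
  by (induction A rule: infinite_finite_induct) (simp_all add: frob_poly_mult)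

lemma frob_poly_power: "frob_poly n (p ^ k) = frob_poly n p ^ k"
  by (induction k) (simp_all add: frob_poly_mult)

lemma frob_poly_linear: "frob_poly n [:- x, 1:] = [:- (x ^ (q ^ n)), 1:]"
  by (rule poly_eqI) (simp add: coeff_pCons frob_uminus split: nat.split)

lemma frob_poly_eq_iff: "frob_poly n p = p \<longleftrightarrow> (\<forall>i. coeff p i \<in> Fq n)"
  by (simp add: poly_eq_iff frob_fixed_def)

definition monics :: "nat \<Rightarrow> 'k poly set" where
  "monics N = {h. lead_coeff h = 1 \<and> degree h = N \<and> frob_poly 1 h = h}"

definition kloosterman :: "nat \<Rightarrow> 'k \<Rightarrow> 'k \<Rightarrow> complex" where
  "kloosterman n a b = (\<Sum>x\<in>Fq n - {0}. \<psi> (Tr n (a * x + b / x)))"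

text \<open>For monic \<open>h\<close> with nonzero roots \<open>x_i\<close>, the two coefficients
  are minus the sum of the \<open>x_i\<close> and minus the sum of the \<open>1 / x_i\<close>, so
  the value is \<open>\<psi>\<close> at the sum of the \<open>a x_i + b / x_i\<close>. Both sums are
  additive in products of polynomials. Reading the subleading coefficient off
  \<open>reflect_poly\<close> keeps the formula correct in degree 0.\<close>

definition chi :: "'k \<Rightarrow> 'k \<Rightarrow> 'k poly \<Rightarrow> complex" where
  "chi a b h = (if coeff h 0 = 0 then 0
     else \<psi> (- (a * coeff (reflect_poly h) 1) - b * (coeff h 1 / coeff h 0)))"

text \<open>For \<open>x\<close> in \<open>Fq n\<close> this is the characteristic polynomial of
  multiplication by \<open>x\<close> on \<open>Fq n\<close> over the base field, hence a power of
  the minimal polynomial of \<open>x\<close>.\<close>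

definition charpoly :: "nat \<Rightarrow> 'k \<Rightarrow> 'k poly" where
  "charpoly n x = (\<Prod>i<n. [:- (x ^ (q ^ i)), 1:])"

text \<open>The coefficient of \<open>T ^ N\<close> in the L-function, the sum of
  \<open>chi a b h * T ^ degree h\<close> over all monic \<open>h\<close>.\<close>

definition L_coeff :: "'k \<Rightarrow> 'k \<Rightarrow> nat \<Rightarrow> complex" where
  "L_coeff a b N = (\<Sum>h\<in>monics N. chi a b h)"

lemma monics_D:
  assumes "h \<in> monics N"
  shows "lead_coeff h = 1" "degree h = N" "frob_poly 1 h = h"
  using assms unfolding monics_def by blast+

lemma monics_I: "lead_coeff h = 1 \<Longrightarrow> degree h = N \<Longrightarrow> frob_poly 1 h = h \<Longrightarrow> h \<in> monics N"
  by (simp only: monics_def mem_Collect_eq)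

lemma monics_nonzero: "h \<in> monics N \<Longrightarrow> h \<noteq> 0" by (auto simp: monics_def)

lemma coeff_monics: "h \<in> monics N \<Longrightarrow> coeff h i \<in> Fq 1"
  by (auto simp: monics_def frob_poly_eq_iff)

lemma coeff_reflect_monics: "h \<in> monics N \<Longrightarrow> coeff (reflect_poly h) i \<in> Fq 1"
  by (metis coeff_monics Fq_0 coeff_reflect_poly)

lemma coeff_1_mult: "coeff (p * g) 1 = coeff p 0 * coeff g 1 + coeff p 1 * coeff (g :: 'k poly) 0"
  by (simp add: coeff_mult atMost_Suc add.commute)

lemma reflect_1_mult:
  assumes "lead_coeff p = 1" "lead_coeff g = (1 :: 'k)"
  shows "coeff (reflect_poly (p * g)) 1 = coeff (reflect_poly p) 1 + coeff (reflect_poly g) 1"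
  using assms by (simp only: reflect_poly_mult coeff_1_mult coeff_0_reflect_poly) (simp add: add.commute)

lemma log_deriv_mult:
  assumes "coeff p 0 \<noteq> 0" "coeff (g :: 'k poly) 0 \<noteq> 0"
  shows "coeff (p * g) 1 / coeff (p * g) 0 = coeff p 1 / coeff p 0 + coeff g 1 / coeff g 0"
  using assms by (simp only: coeff_1_mult coeff_mult_0) (simp add: field_simps)

lemma chi_mult:
  assumes ab: "a \<in> Fq 1" "b \<in> Fq 1" and p: "p \<in> monics m" and g: "g \<in> monics n"
  shows "chi a b (p * g) = chi a b p * chi a b g"
proof (cases "coeff p 0 = 0 \<or> coeff g 0 = 0")
  case True
  then show ?thesis by (auto simp: chi_def coeff_mult_0)
next
  case False
  then have nz: "coeff p 0 \<noteq> 0" "coeff g 0 \<noteq> 0" "coeff (p * g) 0 \<noteq> 0" by (auto simp: coeff_mult_0)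
  let ?w = "\<lambda>h. - (a * coeff (reflect_poly h) 1) - b * (coeff h 1 / coeff h 0)"
  have w: "?w h \<in> Fq 1" if "h \<in> monics k" for h k
    using that ab by (intro Fq_diff Fq_uminus Fq_mult Fq_divide coeff_monics coeff_reflect_monics)
  have "?w (p * g) = ?w p + ?w g"
    unfolding log_deriv_mult[OF nz(1,2)] reflect_1_mult[OF monics_D(1)[OF p] monics_D(1)[OF g]]
    by (simp add: algebra_simps)
  then have "\<psi> (?w (p * g)) = \<psi> (?w p) * \<psi> (?w g)"
    using psi_add[OF w[OF p] w[OF g]] by (simp only:)
  then show ?thesis unfolding chi_def using nz by (simp only: if_False)
qed

lemma monics_mult: "p \<in> monics m \<Longrightarrow> g \<in> monics n \<Longrightarrow> p * g \<in> monics (m + n)"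
proof -
  assume p: "p \<in> monics m" and g: "g \<in> monics n"
  show ?thesis
  proof (rule monics_I)
    show "lead_coeff (p * g) = 1"
      by (simp only: lead_coeff_mult monics_D(1)[OF p] monics_D(1)[OF g] mult_1)
    show "degree (p * g) = m + n"
      using degree_mult_eq[OF monics_nonzero[OF p] monics_nonzero[OF g]] monics_D(2)[OF p] monics_D(2)[OF g] by simp
    show "frob_poly 1 (p * g) = p * g"
      by (simp only: frob_poly_mult monics_D(3)[OF p] monics_D(3)[OF g])
  qed
qed

lemma monics_cancel:
  assumes "p * g \<in> monics N" "p \<in> monics m"
  shows "m \<le> N" "g \<in> monics (N - m)"
proof -
  have nz: "p \<noteq> 0" "g \<noteq> 0" using monics_nonzero[OF assms(1)] by auto
  have deg: "N = m + degree g"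
    using degree_mult_eq[OF nz] monics_D(2)[OF assms(1)] monics_D(2)[OF assms(2)] by simp
  then show "m \<le> N" by simp
  have "lead_coeff p * lead_coeff g = 1"
    using monics_D(1)[OF assms(1)] by (simp only: lead_coeff_mult)
  then have "lead_coeff g = 1" using monics_D(1)[OF assms(2)] by (simp only: mult_1)
  moreover have "p * frob_poly 1 g = p * g"
    using monics_D(3)[OF assms(1)] by (simp only: frob_poly_mult monics_D(3)[OF assms(2)])
  then have "frob_poly 1 g = g" by (simp only: mult_left_cancel[OF nz(1)])
  ultimately show "g \<in> monics (N - m)" using deg by (intro monics_I) simp_all
qed

lemma finite_monics: "finite (monics N)"
proof (rule finite_subset)
  show "monics N \<subseteq> Poly ` {xs. set xs \<subseteq> Fq 1 \<and> length xs \<le> Suc N}"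
  proof
    fix h assume h: "h \<in> monics N"
    have "set (coeffs h) \<subseteq> Fq 1" using coeff_monics[OF h] by (auto simp: coeffs_def)
    moreover have "length (coeffs h) \<le> Suc N" 
      using length_coeffs_degree[OF monics_nonzero[OF h]] monics_D(2)[OF h] by simp
    ultimately show "h \<in> Poly ` {xs. set xs \<subseteq> Fq 1 \<and> length xs \<le> Suc N}"
      by (intro image_eqI[of _ _ "coeffs h"]) auto
  qed
  show "finite (Poly ` {xs. set xs \<subseteq> Fq 1 \<and> length xs \<le> Suc N})"
    using finite_Fq[of 1] by (intro finite_imageI finite_lists_length_le) auto
qed

section \<open>Characteristic polynomials and divisibility by them\<close>

lemma charpoly_0 [simp]: "charpoly 0 x = 1" by (simp add: charpoly_def)

lemma charpoly_Suc: "charpoly (Suc n) x = charpoly n x * [:- (x ^ (q ^ n)), 1:]"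
  by (simp add: charpoly_def mult.commute)

lemma lead_coeff_charpoly: "lead_coeff (charpoly n x) = 1"
  by (simp add: charpoly_def lead_coeff_prod)

lemma charpoly_nonzero: "charpoly n x \<noteq> 0"
  using lead_coeff_charpoly[of n x] by auto

lemma degree_charpoly: "degree (charpoly n x) = n"
  by (simp add: charpoly_def degree_prod_eq_sum_degree)

text \<open>Frobenius moves each linear factor to the next one, and \<open>x ^ (q ^ n) = x\<close>
  closes the cycle.\<close>

lemma frob_poly_charpoly:
  assumes "x \<in> Fq n"
  shows "frob_poly 1 (charpoly n x) = charpoly n x"
proof -
  let ?f = "\<lambda>i. [:- (x ^ (q ^ i)), 1:]"
  have "frob_poly 1 (charpoly n x) = (\<Prod>i<n. ?f (Suc i))"
    unfolding charpoly_def frob_poly_prod frob_poly_linear frob_frob by simp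
  moreover have "prod ?f {..<Suc n} = ?f 0 * (\<Prod>i<n. ?f (Suc i))" by (rule prod.lessThan_Suc_shift)
  moreover have "prod ?f {..<Suc n} = (\<Prod>i<n. ?f i) * ?f n" by (rule prod.lessThan_Suc)
  moreover have "?f n = ?f 0" using assms by (simp add: frob_fixed_def)
  ultimately have "?f 0 * frob_poly 1 (charpoly n x) = ?f 0 * charpoly n x"
    by (simp only: charpoly_def mult.commute)
  then show ?thesis by (metis mult_left_cancel pCons_eq_0_iff one_neq_zero)
qed

lemma charpoly_in_monics: "x \<in> Fq n \<Longrightarrow> charpoly n x \<in> monics n"
  by (intro monics_I lead_coeff_charpoly degree_charpoly frob_poly_charpoly)

lemma reflect_charpoly: "coeff (reflect_poly (charpoly n x)) 1 = - Tr n x"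
proof (induction n)
  case (Suc n)
  have "coeff (reflect_poly [:- (x ^ (q ^ n)), 1:]) 1 = - (x ^ (q ^ n))"
    by (simp add: coeff_reflect_poly)
  then show ?case
    using reflect_1_mult[of "charpoly n x" "[:- (x ^ (q ^ n)), 1:]"] Suc
    by (simp add: charpoly_Suc lead_coeff_charpoly frob_trace_def)
qed (simp add: frob_trace_def)

lemma coeff_0_charpoly: "coeff (charpoly n x) 0 = (\<Prod>i<n. - (x ^ (q ^ i)))"
  by (induction n) (simp_all add: charpoly_Suc coeff_mult_0 mult.commute)

lemma log_deriv_charpoly:
  assumes "x \<noteq> 0"
  shows "coeff (charpoly n x) 1 / coeff (charpoly n x) 0 = - Tr n (1 / x)"
proof (induction n)
  case (Suc n)
  have "coeff (charpoly n x) 0 \<noteq> 0" using assms by (simp add: coeff_0_charpoly)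
  from log_deriv_mult[OF this, of "[:- (x ^ (q ^ n)), 1:]"] show ?case
    using Suc assms by (simp add: charpoly_Suc frob_trace_def power_divide)
qed (simp add: frob_trace_def)

lemma chi_charpoly:
  assumes ab: "a \<in> Fq 1" "b \<in> Fq 1" and n: "0 < n"
  shows "chi a b (charpoly n x) = (if x = 0 then 0 else \<psi> (Tr n (a * x + b / x)))"
proof (cases "x = 0")
  case True
  then have "coeff (charpoly n x) 0 = 0" using n by (auto simp: coeff_0_charpoly)
  then show ?thesis using True by (simp add: chi_def)
next
  case False
  then have "coeff (charpoly n x) 0 \<noteq> 0" by (simp add: coeff_0_charpoly)
  moreover have "Tr n (a * x + b / x) = a * Tr n x + b * Tr n (1 / x)"
    using Tr_scale[OF ab(1), of n x] Tr_scale[OF ab(2), of n "1 / x"] by (simp add: Tr_add)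
  moreover have "chi a b (charpoly n x) = (if coeff (charpoly n x) 0 = 0 then 0
      else \<psi> (- (a * - Tr n x) - b * (- Tr n (1 / x))))"
    unfolding chi_def reflect_charpoly log_deriv_charpoly[OF False] ..
  ultimately show ?thesis using False by simp
qed

lemma kloosterman_eq_sum_chi:
  assumes "a \<in> Fq 1" "b \<in> Fq 1" "0 < n"
  shows "kloosterman n a b = (\<Sum>x\<in>Fq n. chi a b (charpoly n x))"
  unfolding kloosterman_def chi_charpoly[OF assms]
  using finite_Fq[OF assms(3)] by (intro sum.mono_neutral_cong_left) auto

text \<open>Frobenius fixes \<open>h\<close> and carries the linear factor at a point to the one at
  its \<open>q\<close>-th power, so multiplicity cannot drop along the orbit.\<close>

lemma order_frob_le:
  assumes "h \<in> monics N"
  shows "order x h \<le> order (x ^ (q ^ i)) h"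
proof (induction i)
  case (Suc i)
  let ?y = "x ^ (q ^ i)" and ?j = "order (x ^ (q ^ i)) h"
  have "[:- ?y, 1:] ^ ?j dvd h" by (rule order_1)
  then obtain s where "h = [:- ?y, 1:] ^ ?j * s" ..
  then have "frob_poly 1 h = frob_poly 1 ([:- ?y, 1:] ^ ?j * s)" by (rule arg_cong)
  also have "\<dots> = frob_poly 1 [:- ?y, 1:] ^ ?j * frob_poly 1 s"
    by (simp only: frob_poly_mult frob_poly_power)
  finally have "h = [:- (x ^ (q ^ Suc i)), 1:] ^ ?j * frob_poly 1 s"
    unfolding monics_D(3)[OF assms] frob_poly_linear frob_frob by simp
  then have "[:- (x ^ (q ^ Suc i)), 1:] ^ ?j dvd h" by (metis dvd_triv_left)
  then have "?j \<le> order (x ^ (q ^ Suc i)) h"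
    using monics_nonzero[OF assms] by (simp only: order_divides) simp
  with Suc show ?case by simp
qed simp

lemma charpoly_mult:
  assumes "x \<in> Fq e"
  shows "charpoly (e * j) x = charpoly e x ^ j"
proof (induction j)
  case (Suc j)
  have prod_add: "(\<Prod>i<m + n. f i) = (\<Prod>i<m. f i) * (\<Prod>i<n. f (m + i))" for m n and f :: "nat \<Rightarrow> 'k poly"
    by (induction n) (simp_all add: mult.assoc)
  have "x ^ (q ^ (e * j + i)) = x ^ (q ^ i)" for i
    using Fq_mono[OF assms, of j] by (simp add: frob_fixed_def flip: frob_frob)
  moreover have "charpoly (e * j + e) x = charpoly (e * j) x * (\<Prod>i<e. [:- (x ^ (q ^ (e * j + i))), 1:])" 
    using prod_add[where m = "e * j" and n = e] unfolding charpoly_def .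
  ultimately have "charpoly (e * j + e) x = charpoly (e * j) x * charpoly e x" by (simp only: charpoly_def)
  then show ?case using Suc by (simp add: add.commute mult.commute)
qed simp

text \<open>
  If \<open>x\<close> has exact period \<open>e\<close> under Frobenius, the polynomials \<open>charpoly k x\<close> with \<open>x \<in> Fq k\<close> are
  exactly the powers of its minimal polynomial \<open>charpoly e x\<close>, so the number of those dividing \<open>h\<close> is
  the multiplicity of \<open>x\<close> as a root of \<open>h\<close>.
\<close>

lemma card_charpoly_dvd:
  assumes h: "h \<in> monics N" and x: "poly h x = 0"
  shows "card {k. 0 < k \<and> x \<in> Fq k \<and> charpoly k x dvd h} = order x h"
proof -
  have h0: "h \<noteq> 0" using monics_nonzero[OF h] .
  have "poly h (x ^ (q ^ i)) = 0" for i
  proof -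
    have "order x h \<noteq> 0" using x h0 order_root by blast
    then have "order (x ^ (q ^ i)) h \<noteq> 0" using order_frob_le[OF h, of x i] by simp
    then show ?thesis using order_root by blast
  qed
  \<comment> \<open>The orbit of \<open>x\<close> stays among the finitely many roots of
    \<open>h\<close>, so it has a repetition; injectivity of Frobenius moves the repetition back to
    \<open>x\<close> itself, which is therefore periodic.\<close>
  then have "range (\<lambda>i. x ^ (q ^ i)) \<subseteq> {y. poly h y = 0}" by auto
  then have "finite (range (\<lambda>i. x ^ (q ^ i)))" using poly_roots_finite[OF h0] by (rule finite_subset)
  then have "\<not> inj (\<lambda>i. x ^ (q ^ i))" using finite_imageD[of "\<lambda>i. x ^ (q ^ i)" UNIV] by auto
  then obtain i j where ij: "i < j" "x ^ (q ^ i) = x ^ (q ^ j)"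
    unfolding inj_def by (metis linorder_neqE_nat)
  have "(x ^ (q ^ (j - i))) ^ (q ^ i) = x ^ (q ^ i)"
    unfolding frob_frob using ij by simp
  then have "x ^ (q ^ (j - i)) = x" by (simp only: frob_inj)
  then have ex: "0 < j - i \<and> x \<in> Fq (j - i)" using ij(1) by (simp add: frob_fixed_def)
  define e where "e = (LEAST k. 0 < k \<and> x \<in> Fq k)"
  have e: "0 < e" "x \<in> Fq e"
    using LeastI[of "\<lambda>k. 0 < k \<and> x \<in> Fq k", OF ex] unfolding e_def by auto
  have e_le: "e \<le> k" if "0 < k" "x \<in> Fq k" for k
    unfolding e_def by (rule Least_le) (use that in auto)
  have e_dvd: "e dvd k" if "x \<in> Fq k" for k
  proof -
    have "x ^ (q ^ (e * (k div e) + k mod e)) = x" using that by (simp add: frob_fixed_def)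
    moreover have "x ^ (q ^ (e * (k div e))) = x"
      using Fq_mono[OF e(2), of "k div e"] by (simp add: frob_fixed_def)
    ultimately have "x \<in> Fq (k mod e)" unfolding frob_frob[symmetric] by (simp add: frob_fixed_def)
    then have "k mod e = 0" using e_le[of "k mod e"] mod_less_divisor[OF e(1), of k] by fastforce
    then show ?thesis by (simp add: mod_eq_0_iff_dvd)
  qed
  have inj: "inj_on (\<lambda>i. x ^ (q ^ i)) {..<e}"
  proof -
    have *: False if "i < j" "j < e" "x ^ (q ^ i) = x ^ (q ^ j)" for i j
    proof -
      have "(x ^ (q ^ (j - i))) ^ (q ^ i) = x ^ (q ^ i)"
        unfolding frob_frob using that by simp
      then have "x ^ (q ^ (j - i)) = x" by (simp only: frob_inj)
      then have "x \<in> Fq (j - i)" by (simp add: frob_fixed_def)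
      then show False using e_le[of "j - i"] that by simp
    qed
    show ?thesis
    proof (rule inj_onI, rule ccontr)
      fix i j assume "i \<in> {..<e}" "j \<in> {..<e}" "x ^ (q ^ i) = x ^ (q ^ j)" "i \<noteq> j"
      then show False using *[of i j] *[of j i] by (cases "i < j") auto
    qed
  qed
  let ?S = "(\<lambda>i. x ^ (q ^ i)) ` {..<e}"
  have "charpoly e x = (\<Prod>y\<in>#mset_set ?S. [:- y, 1:])"
    unfolding prod_unfold_prod_mset[symmetric] charpoly_def using prod.reindex[OF inj, of "\<lambda>y. [:- y, 1:]"]
    by (simp add: o_def)
  then have proots_charpoly: "proots (charpoly e x) = mset_set ?S" by (simp add: proots_prod_linear)
  \<comment> \<open>The roots of \<open>charpoly e x\<close> are the \<open>e\<close> distinct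
    conjugates of \<open>x\<close>, each simple. All conjugates have at least the multiplicity of
    \<open>x\<close> in \<open>h\<close>, so that multiplicity alone decides which powers
    divide.\<close>
  have dvd_iff: "charpoly (e * j) x dvd h \<longleftrightarrow> j \<le> order x h" if "0 < j" for j
  proof
    assume "charpoly (e * j) x dvd h"
    moreover have "[:- (x ^ (q ^ 0)), 1:] dvd charpoly e x"
      unfolding charpoly_def using e(1) by (intro dvd_prodI) auto
    then have "[:- x, 1:] ^ j dvd charpoly e x ^ j" by (intro dvd_power_same) simp
    ultimately have "[:- x, 1:] ^ j dvd h" unfolding charpoly_mult[OF e(2)] by (rule dvd_trans[rotated])
    then show "j \<le> order x h" using h0 by (simp add: order_divides)
  next
    assume j: "j \<le> order x h"
    show "charpoly (e * j) x dvd h"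
    proof (rule dvd_if_proots_subset[OF charpoly_nonzero h0])
      have "count (proots (charpoly (e * j) x)) y \<le> count (proots h) y" for y
      proof (cases "y \<in> ?S")
        case True
        then obtain i where "y = x ^ (q ^ i)" by auto
        then have "j \<le> order y h" using order_frob_le[OF h, of x i] j by simp
        then show ?thesis
          using True h0 unfolding charpoly_mult[OF e(2)] proots_power proots_charpoly by simp
      next
        case False
        then show ?thesis unfolding charpoly_mult[OF e(2)] proots_power proots_charpoly by simp
      qed
      then show "proots (charpoly (e * j) x) \<subseteq># proots h" by (rule mset_subset_eqI)
    qed
  qed
  have "{k. 0 < k \<and> x \<in> Fq k \<and> charpoly k x dvd h} = (\<lambda>j. e * j) ` {1..order x h}"
  proof (intro equalityI subsetI)
    fix k assume k: "k \<in> {k. 0 < k \<and> x \<in> Fq k \<and> charpoly k x dvd h}"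
    then obtain j where "k = e * j" using e_dvd by (auto elim: dvdE)
    then show "k \<in> (\<lambda>j. e * j) ` {1..order x h}" using k dvd_iff by auto
  next
    fix k assume "k \<in> (\<lambda>j. e * j) ` {1..order x h}"
    then obtain j where "k = e * j" "j \<in> {1..order x h}" by (rule imageE)
    then have j: "k = e * j" "1 \<le> j" "j \<le> order x h" by simp_all
    then have "0 < k" "charpoly k x dvd h" using e(1) dvd_iff by auto
    moreover have "x \<in> Fq k" unfolding j(1) by (rule Fq_mono[OF e(2)])
    ultimately show "k \<in> {k. 0 < k \<and> x \<in> Fq k \<and> charpoly k x dvd h}" by simp
  qed
  moreover have "card ((\<lambda>j. e * j) ` {1..order x h}) = order x h"
    using e(1) by (subst card_image) (auto simp: inj_on_def)
  ultimately show ?thesis by simp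
qed

text \<open>Grouped by \<open>x\<close>, the pairs attach to each root of \<open>h\<close> as many
  degrees \<open>k\<close> as its multiplicity, and the multiplicities add up to the degree. This
  stands in for the logarithmic derivative of an Euler product.\<close>

lemma card_charpoly_dvd_pairs:
  assumes h: "h \<in> monics N"
  shows "card (SIGMA k:{1..N}. {x \<in> Fq k. charpoly k x dvd h}) = N"
proof -
  have h0: "h \<noteq> 0" using monics_nonzero[OF h] .
  let ?R = "{x. poly h x = 0}"
  have finR: "finite ?R" by (rule poly_roots_finite[OF h0])
  have root: "poly h x = 0" if "charpoly k x dvd h" "0 < k" for k x
  proof -
    have "[:- (x ^ (q ^ 0)), 1:] dvd charpoly k x"
      unfolding charpoly_def using that(2) by (intro dvd_prodI) auto
    then have "[:- x, 1:] dvd h" using that(1) by (simp add: dvd_trans)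
    then show ?thesis by (simp add: poly_eq_0_iff_dvd)
  qed
  have deg: "k \<le> N" if "charpoly k x dvd h" for k x
    using dvd_imp_degree_le[OF that h0] monics_D(2)[OF h] by (simp add: degree_charpoly)
  have "card (SIGMA k:{1..N}. {x \<in> Fq k. charpoly k x dvd h})
      = card (SIGMA x:?R. {k. 0 < k \<and> x \<in> Fq k \<and> charpoly k x dvd h})"
    by (rule bij_betw_same_card[of prod.swap], rule bij_betw_byWitness[where f' = prod.swap])
      (use root deg in auto)
  also have "\<dots> = (\<Sum>x\<in>?R. card {k. 0 < k \<and> x \<in> Fq k \<and> charpoly k x dvd h})"
  proof (rule card_SigmaI[OF finR], rule ballI)
    fix x
    have "{k. 0 < k \<and> x \<in> Fq k \<and> charpoly k x dvd h} \<subseteq> {..N}" using deg by auto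
    then show "finite {k. 0 < k \<and> x \<in> Fq k \<and> charpoly k x dvd h}" by (rule finite_subset) simp
  qed
  also have "\<dots> = (\<Sum>x\<in>?R. order x h)" using card_charpoly_dvd[OF h] by simp
  also have "\<dots> = size (proots h)" using h0 by (simp add: size_multiset_overloaded_eq)
  also have "\<dots> = N" using size_proots_alg_closed[OF h0] monics_D(2)[OF h] by simp
  finally show ?thesis .
qed

text \<open>In generating functions this reads \<open>T L'(T) = L(T) * (sum of K_k T^k)\<close>. The
  factor \<open>N\<close> is replaced by the number of pairs \<open>(k, x)\<close> with
  \<open>charpoly k x\<close> dividing \<open>h\<close>; writing \<open>h = charpoly k x * g\<close>
  and using multiplicativity of \<open>chi\<close> separates the sums over \<open>x\<close> and
  \<open>g\<close>.\<close>

lemma newton_identity: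
  assumes ab: "a \<in> Fq 1" "b \<in> Fq 1"
  shows "of_nat N * L_coeff a b N = (\<Sum>k=1..N. kloosterman k a b * L_coeff a b (N - k))"
proof -
  have fin: "finite (SIGMA k:{1..N}. {x \<in> Fq k. charpoly k x dvd h})" for h
    by (intro finite_SigmaI) (auto simp: finite_Fq)
  have "of_nat N * L_coeff a b N = (\<Sum>h\<in>monics N. of_nat (card (SIGMA k:{1..N}. {x \<in> Fq k. charpoly k x dvd h})) * chi a b h)"
    unfolding L_coeff_def sum_distrib_left by (intro sum.cong refl) (simp only: card_charpoly_dvd_pairs)
  also have "\<dots> = (\<Sum>h\<in>monics N. \<Sum>k=1..N. \<Sum>x | x \<in> Fq k \<and> charpoly k x dvd h. chi a b h)"
    by (intro sum.cong refl) (subst sum.Sigma, auto simp: finite_Fq)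
  also have "\<dots> = (\<Sum>k=1..N. \<Sum>h\<in>monics N. \<Sum>x | x \<in> Fq k \<and> charpoly k x dvd h. chi a b h)"
    by (rule sum.swap)
  also have "\<dots> = (\<Sum>k=1..N. kloosterman k a b * L_coeff a b (N - k))"
  proof (rule sum.cong[OF refl])
    fix k assume k: "k \<in> {1..N}"
    have "(\<Sum>h\<in>monics N. \<Sum>x | x \<in> Fq k \<and> charpoly k x dvd h. chi a b h)
        = (\<Sum>x\<in>Fq k. \<Sum>h | h \<in> monics N \<and> charpoly k x dvd h. chi a b h)"
      by (rule sum.swap_restrict[OF finite_monics finite_Fq]) (use k in simp)
    also have "\<dots> = (\<Sum>x\<in>Fq k. chi a b (charpoly k x) * L_coeff a b (N - k))"
    proof (rule sum.cong[OF refl])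
      fix x assume x: "x \<in> Fq k"
      have "(\<Sum>h | h \<in> monics N \<and> charpoly k x dvd h. chi a b h) = (\<Sum>g\<in>monics (N - k). chi a b (charpoly k x * g))"
      proof (rule sum.reindex_bij_betw[symmetric], rule bij_betwI')
        fix g g' show "charpoly k x * g = charpoly k x * g' \<longleftrightarrow> g = g'" using charpoly_nonzero by simp
      next
        fix g assume "g \<in> monics (N - k)"
        then show "charpoly k x * g \<in> {h \<in> monics N. charpoly k x dvd h}"
          using monics_mult[OF charpoly_in_monics[OF x]] k by fastforce
      next
        fix h assume "h \<in> {h \<in> monics N. charpoly k x dvd h}"
        then obtain g where "h \<in> monics N" "h = charpoly k x * g" by (auto elim: dvdE)
        then show "\<exists>g\<in>monics (N - k). h = charpoly k x * g" using monics_cancel(2)[OF _ charpoly_in_monics[OF x]] by auto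
      qed
      also have "\<dots> = chi a b (charpoly k x) * L_coeff a b (N - k)"
        unfolding L_coeff_def sum_distrib_left by (intro sum.cong refl chi_mult[OF ab charpoly_in_monics[OF x]])
      finally show "(\<Sum>h | h \<in> monics N \<and> charpoly k x dvd h. chi a b h) = chi a b (charpoly k x) * L_coeff a b (N - k)" .
    qed
    also have "\<dots> = kloosterman k a b * L_coeff a b (N - k)"
      using k kloosterman_eq_sum_chi[OF ab, of k] by (simp add: sum_distrib_right)
    finally show "(\<Sum>h\<in>monics N. \<Sum>x | x \<in> Fq k \<and> charpoly k x dvd h. chi a b h) = kloosterman k a b * L_coeff a b (N - k)" .
  qed
  finally show ?thesis .
qed

section \<open>The L-function is a quadratic polynomial\<close>

lemma L_coeff_0: "L_coeff a b 0 = 1"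
proof -
  have "monics 0 = {1}"
  proof (intro equalityI subsetI)
    fix h assume "h \<in> monics 0"
    note h = monics_D[OF this]
    from h(2) obtain c where "h = [:c:]" by (rule degree_eq_zeroE)
    with h(1) show "h \<in> {1}" by (simp add: one_pCons)
  qed (auto intro: monics_I)
  then show ?thesis by (simp add: L_coeff_def chi_def)
qed

text \<open>At \<open>X^2 + s X + p\<close> with \<open>p\<close> nonzero the character is
  \<open>\<psi> ((- a - b / p) * s)\<close>. The sum over \<open>s\<close> is zero unless
  \<open>p = - (b / a)\<close>, and that one value contributes \<open>q\<close>.\<close>

lemma L_coeff_2:
  assumes ab: "a \<in> Fq 1" "b \<in> Fq 1" "a \<noteq> 0" "b \<noteq> 0"
  shows "L_coeff a b 2 = of_nat q"
proof -
  let ?h = "\<lambda>(p, s). [:p, s, 1 :: 'k:]"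
  have chi: "chi a b (?h (p, s)) = (if p = 0 then 0 else \<psi> ((- a - b / p) * s))" for p s
    by (simp add: chi_def coeff_reflect_poly algebra_simps numeral_2_eq_2)
  have bij: "bij_betw ?h (Fq 1 \<times> Fq 1) (monics 2)"
  proof (rule bij_betwI')
    fix z z' show "?h z = ?h z' \<longleftrightarrow> z = z'" by (cases z, cases z') simp
  next
    fix z assume "z \<in> Fq 1 \<times> Fq 1"
    then show "?h z \<in> monics 2"
      by (auto intro!: monics_I simp: frob_poly_eq_iff coeff_pCons simp del: One_nat_def split: nat.split)
  next
    fix h assume h: "h \<in> monics 2"
    have "h = [:coeff h 0, coeff h 1, 1:]"
    proof (rule poly_eqI)
      fix i
      have "coeff h i = 0" if "2 < i" using that monics_D(2)[OF h] by (simp add: coeff_eq_0)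
      moreover have "coeff h 2 = 1" using monics_D(1,2)[OF h] by simp
      ultimately show "coeff h i = coeff [:coeff h 0, coeff h 1, 1:] i"
        by (auto simp: coeff_pCons numeral_2_eq_2 split: nat.split)
    qed
    then show "\<exists>z\<in>Fq 1 \<times> Fq 1. h = ?h z"
      using coeff_monics[OF h] by (intro bexI[of _ "(coeff h 0, coeff h 1)"]) auto
  qed
  have "L_coeff a b 2 = (\<Sum>z\<in>Fq 1 \<times> Fq 1. chi a b (?h z))"
    unfolding L_coeff_def by (rule sum.reindex_bij_betw[OF bij, symmetric])
  also have "\<dots> = (\<Sum>p\<in>Fq 1. \<Sum>s\<in>Fq 1. chi a b (?h (p, s)))"
    unfolding sum.cartesian_product by (intro sum.cong) auto
  also have "\<dots> = (\<Sum>p\<in>Fq 1. if p = - (b / a) then of_nat q else 0)"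
  proof (rule sum.cong[OF refl])
    fix p assume p: "p \<in> Fq 1"
    have "- a - b / p \<in> Fq 1" by (intro Fq_diff Fq_uminus Fq_divide ab p)
    from sum_psi[OF this] have *: "(\<Sum>s\<in>Fq 1. \<psi> ((- a - b / p) * s)) = (if - a - b / p = 0 then of_nat q else 0)" .
    show "(\<Sum>s\<in>Fq 1. chi a b (?h (p, s))) = (if p = - (b / a) then of_nat q else 0)"
    proof (cases "p = 0")
      case False
      have "- a - b / p = 0 \<longleftrightarrow> p = - (b / a)"
        using False ab by (auto simp: field_simps)
      then show ?thesis unfolding chi using * False by simp
    next
      case True
      then show ?thesis unfolding chi using ab by simp
    qed
  qed
  also have "\<dots> = of_nat q"
    using finite_Fq[of 1] ab by (simp add: sum.delta Fq_uminus Fq_divide del: One_nat_def)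
  finally show ?thesis .
qed

text \<open>For \<open>N \<ge> 3\<close> the coefficient of \<open>X ^ (N - 1)\<close> is distinct
  from those of \<open>1\<close> and \<open>X\<close>. Adding \<open>d\<close> to it permutes the
  monic polynomials and changes the argument of \<open>\<psi>\<close> by \<open>- a d\<close>. The
  choice \<open>d = - (c / a)\<close> makes this \<open>c\<close>, so the sum equals
  \<open>\<psi> c\<close> times itself, with \<open>\<psi> c\<close> different from 1.\<close>

lemma L_coeff_ge_3:
  assumes ab: "a \<in> Fq 1" "b \<in> Fq 1" "a \<noteq> 0" and N: "3 \<le> N"
  shows "L_coeff a b N = 0"
proof -
  obtain c where c: "c \<in> Fq 1" "\<psi> c \<noteq> 1" using psi_nontrivial by blast
  define d where "d = - (c / a)"
  have d: "d \<in> Fq 1" unfolding d_def by (intro Fq_uminus Fq_divide c ab)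
  let ?m = "monom d (N - 1)"
  have frob_m: "frob_poly 1 ?m = ?m" "frob_poly 1 (- ?m) = - ?m"
    using d by (auto simp: frob_poly_eq_iff Fq_uminus simp del: One_nat_def)
  have deg_m: "degree ?m < N" "degree (- ?m) < N" using N degree_monom_le[of d "N - 1"] by auto
  have shift: "h + m \<in> monics N" if "h \<in> monics N" "degree m < N" "frob_poly 1 m = m" for h m
  proof (rule monics_I)
    have dh: "degree h = N" by (rule monics_D(2)[OF that(1)])
    show dhm: "degree (h + m) = N" using that(2) dh by (simp add: degree_add_eq_left)
    show "lead_coeff (h + m) = 1"
      using monics_D(1)[OF that(1)] coeff_eq_0[OF that(2)] by (simp only: dhm dh coeff_add add_0_right)
    show "frob_poly 1 (h + m) = h + m"
      by (simp only: frob_poly_add monics_D(3)[OF that(1)] that(3))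
  qed
  have chi: "chi a b (h + ?m) = \<psi> c * chi a b h" if h: "h \<in> monics N" for h
  proof -
    have hm: "h + ?m \<in> monics N" by (rule shift[OF h deg_m(1) frob_m(1)])
    have r: "coeff (reflect_poly g) 1 = coeff g (N - 1)" if "g \<in> monics N" for g
      using monics_D(2)[OF that] N by (simp add: coeff_reflect_poly)
    let ?w = "- (a * coeff (reflect_poly h) 1) - b * (coeff h 1 / coeff h 0)"
    have w: "?w \<in> Fq 1" by (intro Fq_diff Fq_uminus Fq_mult Fq_divide coeff_monics[OF h] coeff_reflect_monics[OF h] ab)
    have c01: "coeff (h + ?m) 0 = coeff h 0" "coeff (h + ?m) 1 = coeff h 1" using N by auto
    have "- (a * coeff (reflect_poly (h + ?m)) 1) - b * (coeff (h + ?m) 1 / coeff (h + ?m) 0) = c + ?w"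
      unfolding r[OF hm] r[OF h] c01 using ab by (simp add: d_def algebra_simps)
    then have "\<psi> (- (a * coeff (reflect_poly (h + ?m)) 1) - b * (coeff (h + ?m) 1 / coeff (h + ?m) 0)) = \<psi> c * \<psi> ?w"
      using psi_add[OF c(1) w] by (simp only:)
    then show ?thesis
      unfolding chi_def c01(1)
      by (cases "coeff h 0 = 0") (simp_all only: if_True if_False mult_zero_right simp_thms)
  qed
  have "L_coeff a b N = (\<Sum>h\<in>monics N. chi a b (h + ?m))"
    unfolding L_coeff_def
  proof (rule sum.reindex_bij_witness[of _ "\<lambda>h. h + ?m" "\<lambda>h. h + - ?m"])
    fix h assume "h \<in> monics N"
    then show "h + ?m \<in> monics N" "h + - ?m \<in> monics N" using shift deg_m frob_m by blast+
  qed auto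
  also have "\<dots> = \<psi> c * L_coeff a b N" unfolding L_coeff_def sum_distrib_left by (intro sum.cong refl chi)
  finally show ?thesis using c(2) by (metis mult_cancel_right1)
qed

text \<open>These are the Newton identities for the coefficients
  \<open>1, K_1, q, 0, 0, ...\<close>; from \<open>N = 3\<close> on, the left side vanishes and only
  the last three terms of the sum survive.\<close>

lemma kloosterman_recurrence:
  assumes ab: "a \<in> Fq 1" "b \<in> Fq 1" "a \<noteq> 0" "b \<noteq> 0"
  shows "kloosterman 2 a b = 2 * of_nat q - kloosterman 1 a b * kloosterman 1 a b"
    and "kloosterman (n + 3) a b = - (kloosterman 1 a b * kloosterman (n + 2) a b) - of_nat q * kloosterman (n + 1) a b"
proof -
  have L1: "L_coeff a b 1 = kloosterman 1 a b"
    using newton_identity[OF ab(1,2), of 1] by (simp add: L_coeff_0)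
  have "of_nat 2 * L_coeff a b 2 = kloosterman 1 a b * L_coeff a b (2 - 1) + kloosterman 2 a b * L_coeff a b (2 - 2)"
    unfolding newton_identity[OF ab(1,2)] by (simp add: numeral_2_eq_2)
  then show "kloosterman 2 a b = 2 * of_nat q - kloosterman 1 a b * kloosterman 1 a b"
    using L1 by (simp add: L_coeff_0 L_coeff_2[OF ab] algebra_simps)
  have "0 = (\<Sum>k=1..n+3. kloosterman k a b * L_coeff a b (n + 3 - k))"
    using newton_identity[OF ab(1,2), of "n + 3"] L_coeff_ge_3[OF ab(1,2,3), of "n + 3"] by simp
  also have "\<dots> = (\<Sum>k\<in>{n+1,n+2,n+3}. kloosterman k a b * L_coeff a b (n + 3 - k))"
    by (rule sum.mono_neutral_right) (auto intro!: L_coeff_ge_3[OF ab(1,2,3)])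
  also have "\<dots> = kloosterman (n + 1) a b * L_coeff a b 2 + kloosterman (n + 2) a b * L_coeff a b 1 + kloosterman (n + 3) a b * L_coeff a b 0"
    by (simp add: numeral_3_eq_3 numeral_2_eq_2)
  finally have sum0: "kloosterman (n + 1) a b * of_nat q + kloosterman (n + 2) a b * kloosterman 1 a b + kloosterman (n + 3) a b = 0"
    unfolding L1 L_coeff_0 L_coeff_2[OF ab] by simp
  have "z = - (K * y) - Q * x" if "x * Q + y * K + z = 0" for x y z K Q :: complex
  proof -
    have "z = (x * Q + y * K + z) - K * y - Q * x" by (simp add: algebra_simps)
    then show ?thesis using that by simp
  qed
  from this[OF sum0] show "kloosterman (n + 3) a b = - (kloosterman 1 a b * kloosterman (n + 2) a b) - of_nat q * kloosterman (n + 1) a b" .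
qed

text \<open>By the two conditions, \<open>\<alpha>\<close> and \<open>\<beta>\<close> are the
  reciprocal roots of \<open>1 + K T + q T^2\<close>, and negated power sums satisfy the same
  recurrence and initial values.\<close>

lemma kloosterman_eq_power_sum:
  assumes ab: "a \<in> Fq 1" "b \<in> Fq 1" "a \<noteq> 0" "b \<noteq> 0"
    and roots: "\<alpha> + \<beta> = - kloosterman 1 a b" "\<alpha> * \<beta> = of_nat q"
  shows "kloosterman (Suc n) a b = - (\<alpha> ^ Suc n + \<beta> ^ Suc n)"
proof (induction n rule: less_induct)
  case (less n)
  have k1: "kloosterman 1 a b = - (\<alpha> + \<beta>)" using roots(1) by simp
  consider "n = 0" | "n = 1" | m where "n = m + 2" by (metis add.commute add_2_eq_Suc not0_implies_Suc One_nat_def)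
  then show ?case
  proof cases
    case 1
    then show ?thesis using k1 by simp
  next
    case 2
    then show ?thesis
      using kloosterman_recurrence(1)[OF ab] unfolding k1 roots(2)[symmetric]
      by (simp add: numeral_2_eq_2 algebra_simps)
  next
    case (3 m)
    have "kloosterman (m + 3) a b = - (kloosterman 1 a b * kloosterman (m + 2) a b) - of_nat q * kloosterman (m + 1) a b"
      by (rule kloosterman_recurrence(2)[OF ab])
    moreover have "kloosterman (m + 2) a b = - (\<alpha> ^ (m + 2) + \<beta> ^ (m + 2))"
      using less.IH[of "m + 1"] 3 by simp
    moreover have "kloosterman (m + 1) a b = - (\<alpha> ^ (m + 1) + \<beta> ^ (m + 1))"
      using less.IH[of m] 3 by simp
    ultimately have "kloosterman (m + 3) a b = - (- (\<alpha> + \<beta>) * - (\<alpha> ^ (m + 2) + \<beta> ^ (m + 2)))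
        - \<alpha> * \<beta> * - (\<alpha> ^ (m + 1) + \<beta> ^ (m + 1))"
      unfolding k1 roots(2)[symmetric] by (simp only:)
    also have "\<dots> = - (\<alpha> ^ (m + 3) + \<beta> ^ (m + 3))"
      by (simp add: algebra_simps numeral_3_eq_3 numeral_2_eq_2)
    finally show ?thesis using 3 by (simp add: numeral_3_eq_3)
  qed
qed

end

section \<open>Stepanov's method\<close>

definition polys_over :: "nat \<Rightarrow> 'a::zero set \<Rightarrow> 'a poly set" where
  "polys_over n S = {p. (\<forall>i\<ge>n. coeff p i = 0) \<and> (\<forall>i. coeff p i \<in> S)}"

lemma polys_over_Suc:
  assumes "0 \<in> S"
  shows "polys_over (Suc n) S = (\<lambda>(c, p). pCons c p) ` (S \<times> polys_over n S)"
proof (intro equalityI subsetI)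
  fix p assume p: "p \<in> polys_over (Suc n) S"
  obtain c g where cg: "p = pCons c g" by (cases p)
  have "coeff g i = 0" if "n \<le> i" for i
    using p that unfolding polys_over_def cg by (auto dest: spec[of _ "Suc i"])
  moreover have "coeff g i \<in> S" for i
    using p unfolding polys_over_def cg by (auto dest: spec[of _ "Suc i"])
  moreover have "c \<in> S"
    using p unfolding polys_over_def cg by (auto dest: spec[of _ 0])
  ultimately show "p \<in> (\<lambda>(c, p). pCons c p) ` (S \<times> polys_over n S)"
    by (intro image_eqI[of _ _ "(c, g)"]) (auto simp: polys_over_def cg)
qed (auto simp: polys_over_def coeff_pCons split: nat.split)

lemma card_polys_over:
  assumes "finite S" "0 \<in> S"
  shows "finite (polys_over n S) \<and> card (polys_over n S) = card S ^ n"
proof (induction n)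
  case 0
  have "polys_over 0 S = {0}" using assms(2) by (auto simp: polys_over_def poly_eq_iff)
  then show ?case by simp
next
  case (Suc n)
  have "inj_on (\<lambda>(c, p). pCons c p) (S \<times> polys_over n S)" by (auto simp: inj_on_def)
  then show ?case
    using Suc assms(1) by (simp add: polys_over_Suc[OF assms(2)] card_image card_cartesian_product)
qed

lemma degree_polys_over:
  assumes "p \<in> polys_over n S"
  shows "degree p \<le> n - 1"
  using assms by (intro degree_le) (auto simp: polys_over_def)

lemma dvd_monom_imp_0:
  fixes p :: "'a::field poly"
  assumes "monom 1 n dvd p" "degree p < n"
  shows "p = 0"
proof (rule ccontr)
  assume "p \<noteq> 0"
  then have "degree (monom (1::'a) n) \<le> degree p" using assms(1) by (intro dvd_imp_degree_le)
  then show False using assms(2) by (simp add: degree_monom_eq)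
qed

section \<open>The auxiliary polynomial\<close>

context closure_character
begin

lemma frob_add_poly: "(p + g) ^ (q ^ n) = p ^ (q ^ n) + g ^ (q ^ n)" for p g :: "'k poly"
  by (rule freshmans_dream'[where n = "r * n"]) (simp_all only: semiring_char_poly prime_CHAR q_pow_eq)

lemma frob_diff_poly: "(p - g) ^ (q ^ n) = p ^ (q ^ n) - g ^ (q ^ n)" for p g :: "'k poly"
  using frob_add_poly[of "p - g" g n] by simp

text \<open>
  Modulo \<open>X ^ R\<close> a relation with leading terms \<open>v 0\<close> and \<open>u 0\<close> forces
  \<open>f * (v 0)\<^sup>2 = f(0) ^ R * (u 0)\<^sup>2\<close>, which is impossible at a simple root of \<open>f\<close>.
\<close>

lemma stepanov_independent:
  fixes f :: "'k poly"
  assumes z: "order z f = 1" and f0: "coeff f 0 \<noteq> 0" and R: "q ^ m = 2 * \<rho> + 1"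
    and deg: "2 * A + degree f \<le> 2 * \<rho> + 2"
  shows "(\<And>j. v j \<in> polys_over A S) \<Longrightarrow> (\<And>j. u j \<in> polys_over A S) \<Longrightarrow>
    (\<Sum>j<J. monom 1 (j * q ^ m) * (v j + f ^ \<rho> * u j)) = 0 \<Longrightarrow> j < J \<Longrightarrow> v j = 0 \<and> u j = 0"
proof (induction J arbitrary: v u j)
  case (Suc J)
  let ?R = "q ^ m" and ?X = "monom (1 :: 'k) (q ^ m)"
  \<comment> \<open>Splitting off \<open>j = 0\<close> leaves a multiple of \<open>X ^ R\<close>;
    \<open>T1\<close> and \<open>T2\<close> are its cofactors.\<close>
  define T1 where "T1 = (\<Sum>j<J. monom 1 (j * ?R) * v (Suc j))"
  define T2 where "T2 = (\<Sum>j<J. monom 1 (j * ?R) * u (Suc j))"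
  have T: "(\<Sum>j<J. monom 1 (j * ?R) * (v (Suc j) + f ^ \<rho> * u (Suc j))) = T1 + f ^ \<rho> * T2"
    by (simp add: T1_def T2_def distrib_left sum.distrib sum_distrib_left mult_ac)
  have X: "monom 1 (Suc j * ?R) = ?X * monom 1 (j * ?R)" for j
    by (simp add: mult_monom add.commute)
  have "0 = v 0 + f ^ \<rho> * u 0 + (\<Sum>j<J. monom 1 (Suc j * ?R) * (v (Suc j) + f ^ \<rho> * u (Suc j)))"
    using Suc.prems(3) by (simp only: sum.lessThan_Suc_shift mult_0 monom_eq_1 mult_1)
  also have "\<dots> = v 0 + f ^ \<rho> * u 0 + ?X * (T1 + f ^ \<rho> * T2)"
    unfolding T[symmetric] X by (simp only: sum_distrib_left mult.assoc)
  finally have rel: "v 0 + f ^ \<rho> * u 0 + ?X * (T1 + f ^ \<rho> * T2) = 0" ..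
  then have "v 0 + ?X * T1 = - (f ^ \<rho> * (u 0 + ?X * T2))"
    by (simp add: algebra_simps eq_neg_iff_add_eq_0)
  \<comment> \<open>Squaring and multiplying by \<open>f\<close> turns \<open>f ^ \<rho>\<close>
    into \<open>f ^ (2 * \<rho> + 1) = f ^ R\<close>. As an \<open>R\<close>-th power in
    characteristic \<open>p\<close>, this is congruent to the constant \<open>f(0) ^ R\<close>
    modulo \<open>X ^ R\<close>.\<close>
  then have "f * (v 0 + ?X * T1)\<^sup>2 = f * (f ^ \<rho> * (u 0 + ?X * T2))\<^sup>2" by simp
  also have "\<dots> = f ^ ?R * (u 0 + ?X * T2)\<^sup>2"
    unfolding R by (simp add: power_mult_distrib power_mult[symmetric] mult.commute[of 2])
  finally have sq: "f * (v 0 + ?X * T1)\<^sup>2 = f ^ ?R * (u 0 + ?X * T2)\<^sup>2" .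
  obtain c g where f: "f = pCons c g" by (cases f)
  have c: "c \<noteq> 0" using f0 f by simp
  have "f = [:c:] + monom 1 1 * g" unfolding f by (simp add: monom_Suc monom_0 flip: one_pCons)
  then have "f ^ ?R = ([:c:] + monom 1 1 * g) ^ ?R" by (rule arg_cong)
  also have "\<dots> = [:c ^ ?R:] + ?X * g ^ ?R"
    unfolding frob_add_poly power_mult_distrib poly_const_pow by (simp add: monom_power)
  finally have fR: "f ^ ?R = [:c ^ ?R:] + ?X * g ^ ?R" .
  have "f * (v 0)\<^sup>2 - [:c ^ ?R:] * (u 0)\<^sup>2
      = ?X * (g ^ ?R * (u 0 + ?X * T2)\<^sup>2 + [:c ^ ?R:] * (2 * u 0 * T2 + ?X * T2\<^sup>2)
          - f * (2 * v 0 * T1 + ?X * T1\<^sup>2))"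
    (is "?L = ?X * ?Y")
  proof -
    have "f * (v 0 + ?X * T1)\<^sup>2 = f * (v 0)\<^sup>2 + ?X * (f * (2 * v 0 * T1 + ?X * T1\<^sup>2))"
      by (simp add: power2_eq_square algebra_simps)
    moreover have "f ^ ?R * (u 0 + ?X * T2)\<^sup>2
        = [:c ^ ?R:] * (u 0)\<^sup>2 + ?X * (g ^ ?R * (u 0 + ?X * T2)\<^sup>2 + [:c ^ ?R:] * (2 * u 0 * T2 + ?X * T2\<^sup>2))"
      unfolding fR by (simp only: power2_eq_square distrib_left distrib_right mult_2 mult_ac add_ac)
    ultimately have "f * (v 0)\<^sup>2 + ?X * (f * (2 * v 0 * T1 + ?X * T1\<^sup>2))
      = [:c ^ ?R:] * (u 0)\<^sup>2 + ?X * (g ^ ?R * (u 0 + ?X * T2)\<^sup>2 + [:c ^ ?R:] * (2 * u 0 * T2 + ?X * T2\<^sup>2))"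
      using sq by simp
    moreover have "a - b = x * (s - p)" if "a + x * p = b + x * s" for a b x s p :: "'k poly"
    proof -
      have "a - b = (a + x * p) - b - x * p" by simp
      also have "\<dots> = x * (s - p)" unfolding that by (simp add: algebra_simps)
      finally show ?thesis .
    qed
    ultimately show ?thesis by blast
  qed
  then have dvd: "?X dvd ?L" by (metis dvd_triv_left)
  have eq0: "v 0 = 0 \<and> u 0 = 0"
  proof (cases "A = 0")
    case True
    then show ?thesis using Suc.prems(1,2)[of 0] by (auto simp: polys_over_def poly_eq_iff)
  next
    case False
    have dv: "degree (v 0) \<le> A - 1" "degree (u 0) \<le> A - 1"
      using Suc.prems(1,2) degree_polys_over by blast+
    have "degree (f * (v 0)\<^sup>2) \<le> degree f + 2 * (A - 1)"
      using degree_mult_le[of f "(v 0)\<^sup>2"] degree_power_le[of "v 0" 2] dv(1) by linarith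
    moreover have "degree ([:c ^ ?R:] * (u 0)\<^sup>2) \<le> 2 * (A - 1)"
      using degree_mult_le[of "[:c ^ ?R:]" "(u 0)\<^sup>2"] degree_power_le[of "u 0" 2] dv(2) by simp
    ultimately have "degree ?L \<le> degree f + 2 * (A - 1)"
      by (intro degree_diff_le) auto
    \<comment> \<open>The degree hypothesis gives
      \<open>degree f + 2 * (A - 1) \<le> 2 * \<rho> = R - 1\<close>, so the congruence modulo
      \<open>X ^ R\<close> is an equality.\<close>
    also have "\<dots> < ?R" unfolding R using deg False by simp
    finally have "?L = 0" by (rule dvd_monom_imp_0[OF dvd])
    then have e: "f * (v 0)\<^sup>2 = smult (c ^ ?R) ((u 0)\<^sup>2)" by simp
    have f_nz: "f \<noteq> 0" using f0 by auto
    show ?thesis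
    proof (cases "v 0 = 0")
      case True
      then show ?thesis using e c by simp
    next
      case v: False
      then have u: "u 0 \<noteq> 0" using e f_nz by auto
      \<comment> \<open>At the simple root \<open>z\<close> of \<open>f\<close>, the left side of
        the equality has odd multiplicity and the right side even multiplicity.\<close>
      have "order z (f * (v 0)\<^sup>2) = 1 + 2 * order z (v 0)"
        using v f_nz z by (simp add: order_mult power2_eq_square)
      moreover have "order z (smult (c ^ ?R) ((u 0)\<^sup>2)) = 2 * order z (u 0)"
        using u c by (simp add: order_smult order_mult power2_eq_square)
      ultimately have "1 + 2 * order z (v 0) = 2 * order z (u 0)" using e by simp
      then show ?thesis by presburger
    qed
  qed
  then have "?X * (T1 + f ^ \<rho> * T2) = 0" using rel by simp
  then have "T1 + f ^ \<rho> * T2 = 0" by (simp add: monom_eq_0_iff)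
  then have "(\<Sum>j<J. monom 1 (j * ?R) * (v (Suc j) + f ^ \<rho> * u (Suc j))) = 0" by (simp only: T)
  from Suc.IH[OF Suc.prems(1,2) this] have "j' < J \<Longrightarrow> v (Suc j') = 0 \<and> u (Suc j') = 0" for j' .
  then show ?case using eq0 Suc.prems(4) by (cases j) auto
qed simp

lemma frob_poly_0: "frob_poly n 0 = 0"
  by (simp add: frob_poly_def)

lemma polys_over_Fq_iff: "p \<in> polys_over n (Fq k) \<longleftrightarrow> (\<forall>i\<ge>n. coeff p i = 0) \<and> frob_poly k p = p"
  by (simp add: polys_over_def frob_poly_eq_iff)

lemma polys_over_diff:
  "p \<in> polys_over n (Fq k) \<Longrightarrow> g \<in> polys_over n (Fq k) \<Longrightarrow> p - g \<in> polys_over n (Fq k)"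
  by (simp add: polys_over_Fq_iff frob_poly_diff)

text \<open>The exponent \<open>\<rho> * (R + 1)\<close> is \<open>(R^2 - 1) / 2\<close>, so for
  \<open>\<epsilon>\<close> equal to 1 or -1 this counts nonzero square or nonsquare values of
  \<open>f\<close> on the field with \<open>R^2\<close> elements. At such a point,
  \<open>f ^ \<rho>\<close> times the \<open>R\<close>-th power of \<open>G\<close> takes the value
  of a polynomial of much lower degree than expected. The coefficients of \<open>G\<close> are
  chosen to make that polynomial identically zero; \<open>G\<close> is nonzero by independence, and
  its degree bounds the count.\<close>

lemma stepanov_bound:
  fixes f :: "'k poly"
  assumes z: "order z f = 1" and f0: "coeff f 0 \<noteq> 0" and R: "q ^ m = 2 * \<rho> + 1" and m: "0 < m"
    and deg: "degree f = 2 * \<delta>" and f: "frob_poly 1 f = f" and small: "2 * \<delta>\<^sup>2 < q ^ m"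
    and eps: "\<epsilon> \<in> Fq 1" "\<epsilon> \<noteq> 0"
  shows "2 * card {y \<in> Fq (2 * m). poly f y ^ (\<rho> * (q ^ m + 1)) = \<epsilon>} \<le> q ^ (2 * m) + 4 * \<delta> * q ^ m"
proof -
  let ?R = "q ^ m"
  have m2: "0 < 2 * m" using m by simp
  have RR: "q ^ (2 * m) = ?R * ?R" by (simp add: mult_2 power_add)
  have "\<delta> * \<delta> \<le> \<rho>" using small unfolding R power2_eq_square by linarith
  moreover have "\<delta> \<le> \<delta> * \<delta>" by simp
  ultimately have \<delta>\<rho>: "\<delta> \<le> \<rho>" by linarith
  obtain k where k: "\<rho> = \<delta> + k" using \<delta>\<rho> le_Suc_ex by blast
  \<comment> \<open>\<open>A = \<rho> - \<delta> + 1\<close> is the largest value that the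
    independence lemma allows. \<open>J\<close> is chosen so that there are more unknown
    coefficients than conditions.\<close>
  define A where "A = k + 1"
  define J where "J = \<rho> + \<delta> + 1"
  define MM where "MM = J + 2 * \<delta> * \<rho> + (A - 1) * ?R"
  let ?F = "Fq (2 * m)"
  let ?W = "{..<J} \<rightarrow>\<^sub>E (polys_over A ?F \<times> polys_over A ?F)"
  \<comment> \<open>This is the polynomial that \<open>f ^ \<rho> * G ^ R\<close> reduces to at the
    counted points, by \<open>y ^ (R * R) = y\<close> and
    \<open>f(y) ^ (\<rho> * (R + 1)) = \<epsilon>\<close>.\<close>
  define \<Phi> where "\<Phi> w = (\<Sum>j<J. monom 1 j * (f ^ \<rho> * fst (w j) ^ ?R + [:\<epsilon>:] * snd (w j) ^ ?R))"
    for w :: "nat \<Rightarrow> 'k poly \<times> 'k poly"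
  have finF: "finite ?F" by (rule finite_Fq[OF m2])
  have cF: "card ?F = q ^ (2 * m)" by (rule card_Fq[OF m2])
  note cP = card_polys_over[OF finF Fq_0, unfolded cF]
  have f': "frob_poly (2 * m) f = f"
    using f Fq_1_subset by (simp add: frob_poly_eq_iff del: One_nat_def)
  have eps': "frob_poly (2 * m) [:\<epsilon>:] = [:\<epsilon>:]"
    using Fq_1_subset[OF eps(1), of "2 * m"] by (auto simp: frob_poly_eq_iff coeff_pCons split: nat.split)
  have \<Phi>_in: "\<Phi> w \<in> polys_over MM ?F" if w: "w \<in> ?W" for w
  proof -
    have w1: "fst (w j) \<in> polys_over A ?F" "snd (w j) \<in> polys_over A ?F" if "j < J" for j
      using w that by (auto simp: PiE_def Pi_def mem_Times_iff)
    have frobm: "frob_poly (2 * m) (monom 1 j) = monom 1 j" for j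
      by (auto simp: frob_poly_eq_iff)
    have frob_sum_poly: "frob_poly (2 * m) (\<Sum>j<J. g j) = (\<Sum>j<J. frob_poly (2 * m) (g j))" for g and J :: nat
      by (induction J) (simp_all add: frob_poly_add frob_poly_0)
    have "frob_poly (2 * m) (\<Phi> w) = \<Phi> w"
      unfolding \<Phi>_def frob_sum_poly
    proof (rule sum.cong[OF refl])
      fix j assume "j \<in> {..<J}"
      then have "frob_poly (2 * m) (fst (w j)) = fst (w j)" "frob_poly (2 * m) (snd (w j)) = snd (w j)"
        using w1 by (simp_all add: polys_over_Fq_iff)
      then show "frob_poly (2 * m) (monom 1 j * (f ^ \<rho> * fst (w j) ^ ?R + [:\<epsilon>:] * snd (w j) ^ ?R))
          = monom 1 j * (f ^ \<rho> * fst (w j) ^ ?R + [:\<epsilon>:] * snd (w j) ^ ?R)"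
        by (simp only: frob_poly_mult frob_poly_add frob_poly_power frobm f' eps')
    qed
    moreover have "degree (\<Phi> w) \<le> (J - 1) + (2 * \<delta> * \<rho> + (A - 1) * ?R)"
      unfolding \<Phi>_def
    proof (rule degree_sum_le)
      fix j assume "j \<in> {..<J}"
      then have j: "j < J" by simp
      have "degree (fst (w j) ^ ?R) \<le> (A - 1) * ?R" "degree (snd (w j) ^ ?R) \<le> (A - 1) * ?R"
        using degree_power_le[of "fst (w j)" ?R] degree_power_le[of "snd (w j)" ?R]
          mult_le_mono1[OF degree_polys_over[OF w1(1)[OF j]], of ?R]
          mult_le_mono1[OF degree_polys_over[OF w1(2)[OF j]], of ?R] by linarith+
      moreover have "degree (f ^ \<rho>) \<le> 2 * \<delta> * \<rho>" using degree_power_le[of f \<rho>] deg by simp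
      ultimately have "degree (f ^ \<rho> * fst (w j) ^ ?R) \<le> 2 * \<delta> * \<rho> + (A - 1) * ?R"
        "degree ([:\<epsilon>:] * snd (w j) ^ ?R) \<le> 2 * \<delta> * \<rho> + (A - 1) * ?R"
        using degree_mult_le[of "f ^ \<rho>" "fst (w j) ^ ?R"] degree_mult_le[of "[:\<epsilon>:]" "snd (w j) ^ ?R"]
        by auto
      then have "degree (f ^ \<rho> * fst (w j) ^ ?R + [:\<epsilon>:] * snd (w j) ^ ?R) \<le> 2 * \<delta> * \<rho> + (A - 1) * ?R"
        by (rule degree_add_le)
      moreover have "degree (monom (1 :: 'k) j) \<le> J - 1" using j by (simp add: degree_monom_eq)
      ultimately show "degree (monom 1 j * (f ^ \<rho> * fst (w j) ^ ?R + [:\<epsilon>:] * snd (w j) ^ ?R))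
          \<le> (J - 1) + (2 * \<delta> * \<rho> + (A - 1) * ?R)"
        by (intro order_trans[OF degree_mult_le] add_mono)
    qed simp
    then have "degree (\<Phi> w) < MM" unfolding MM_def J_def by simp
    ultimately show ?thesis by (auto simp: polys_over_Fq_iff intro: coeff_eq_0)
  qed
  \<comment> \<open>There are \<open>2 * A * J\<close> unknowns and \<open>MM\<close> conditions;
    the surplus is exactly \<open>R - 2 * \<delta>^2\<close>, which is where the hypothesis
    \<open>small\<close> originates.\<close>
  have "MM < 2 * A * J"
  proof -
    have "MM = 2 * \<rho> * \<rho> + 2 * \<rho> + 1" unfolding MM_def J_def A_def R k by (simp add: algebra_simps)
    moreover have "2 * A * J + 2 * (\<delta> * \<delta>) = 2 * \<rho> * \<rho> + 4 * \<rho> + 2"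
      unfolding J_def A_def k by (simp add: algebra_simps)
    ultimately show ?thesis using \<open>\<delta> * \<delta> \<le> \<rho>\<close> by linarith
  qed
  moreover have "1 < q ^ (2 * m)" using q_gt_1 m2 by (rule one_less_power)
  ultimately have "(q ^ (2 * m)) ^ MM < (q ^ (2 * m)) ^ (2 * A * J)"
    by (intro power_strict_increasing)
  also have "\<dots> = card ?W"
    using cP[of A] by (simp add: card_PiE card_cartesian_product mult_2 power_add[symmetric] power_mult)
  finally have "card (polys_over MM ?F) < card ?W" using cP by simp
  \<comment> \<open>\<open>\<Phi>\<close> is additive but only semilinear for the
    \<open>R\<close>-th power map, so cardinalities are compared rather than dimensions. The
    difference of two families with the same image is a nonzero solution.\<close>
  then have "\<not> inj_on \<Phi> ?W"
    using card_inj_on_le[of \<Phi> ?W "polys_over MM ?F"] \<Phi>_in cP[of MM] by fastforce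
  then obtain w w' where w: "w \<in> ?W" "w' \<in> ?W" "\<Phi> w = \<Phi> w'" "w \<noteq> w'" by (auto simp: inj_on_def)
  then obtain j0 where j0: "j0 < J" "w j0 \<noteq> w' j0" by (metis PiE_ext lessThan_iff)
  define v where "v j = (if j < J then fst (w j) - fst (w' j) else 0)" for j
  define u where "u j = (if j < J then snd (w j) - snd (w' j) else 0)" for j
  have zero_in: "0 \<in> polys_over A ?F" by (simp add: polys_over_def)
  have vu: "v j \<in> polys_over A ?F" "u j \<in> polys_over A ?F" for j
  proof -
    have "fst (w j) \<in> polys_over A ?F" "snd (w j) \<in> polys_over A ?F"
      "fst (w' j) \<in> polys_over A ?F" "snd (w' j) \<in> polys_over A ?F" if "j < J"
      using w that by (auto simp: PiE_def Pi_def mem_Times_iff)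
    then show "v j \<in> polys_over A ?F" "u j \<in> polys_over A ?F"
      unfolding v_def u_def using zero_in by (auto intro: polys_over_diff)
  qed
  have vanish: "(\<Sum>j<J. monom 1 j * (f ^ \<rho> * v j ^ ?R + [:\<epsilon>:] * u j ^ ?R)) = 0"
  proof -
    have "(\<Sum>j<J. monom 1 j * (f ^ \<rho> * v j ^ ?R + [:\<epsilon>:] * u j ^ ?R)) = \<Phi> w - \<Phi> w'"
      unfolding \<Phi>_def sum_subtractf[symmetric]
    proof (rule sum.cong[OF refl])
      fix j assume "j \<in> {..<J}"
      then have vR: "v j ^ ?R = fst (w j) ^ ?R - fst (w' j) ^ ?R" "u j ^ ?R = snd (w j) ^ ?R - snd (w' j) ^ ?R"
        by (simp_all add: v_def u_def frob_diff_poly)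
      show "monom 1 j * (f ^ \<rho> * v j ^ ?R + [:\<epsilon>:] * u j ^ ?R)
        = monom 1 j * (f ^ \<rho> * fst (w j) ^ ?R + [:\<epsilon>:] * snd (w j) ^ ?R)
          - monom 1 j * (f ^ \<rho> * fst (w' j) ^ ?R + [:\<epsilon>:] * snd (w' j) ^ ?R)"
        unfolding vR by (simp add: algebra_simps)
    qed
    then show ?thesis using w(3) by simp
  qed
  define G where "G = (\<Sum>j<J. monom 1 (j * ?R) * (v j + f ^ \<rho> * u j))"
  have "G \<noteq> 0"
  proof
    assume "G = 0"
    then have "(\<Sum>j<J. monom 1 (j * ?R) * (v j + f ^ \<rho> * u j)) = 0" by (simp only: G_def)
    moreover have "2 * A + degree f \<le> 2 * \<rho> + 2" unfolding deg A_def k by simp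
    ultimately have "v j0 = 0 \<and> u j0 = 0"
      by (intro stepanov_independent[where v = v and u = u and J = J and j = j0, OF z f0 R _ vu _ j0(1)])
    then show False using j0 by (simp add: v_def u_def prod_eq_iff)
  qed
  have degG: "degree G \<le> (J - 1) * ?R + (2 * \<delta> * \<rho> + (A - 1))"
    unfolding G_def
  proof (rule degree_sum_le)
    fix j assume "j \<in> {..<J}"
    then have j: "j \<le> J - 1" by simp
    have "degree (f ^ \<rho>) \<le> 2 * \<delta> * \<rho>" using degree_power_le[of f \<rho>] deg by simp
    then have "degree (f ^ \<rho> * u j) \<le> 2 * \<delta> * \<rho> + (A - 1)"
      using degree_polys_over[OF vu(2)[of j]] by (intro order_trans[OF degree_mult_le] add_mono)
    moreover have "degree (v j) \<le> 2 * \<delta> * \<rho> + (A - 1)" using degree_polys_over[OF vu(1)[of j]] by simp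
    ultimately have "degree (v j + f ^ \<rho> * u j) \<le> 2 * \<delta> * \<rho> + (A - 1)" by (intro degree_add_le)
    moreover have "degree (monom (1 :: 'k) (j * ?R)) \<le> (J - 1) * ?R"
      using mult_le_mono1[OF j, of ?R] by (simp add: degree_monom_eq)
    ultimately show "degree (monom 1 (j * ?R) * (v j + f ^ \<rho> * u j)) \<le> (J - 1) * ?R + (2 * \<delta> * \<rho> + (A - 1))"
      by (intro order_trans[OF degree_mult_le] add_mono)
  qed simp
  have "{y \<in> ?F. poly f y ^ (\<rho> * (?R + 1)) = \<epsilon>} \<subseteq> {y. poly G y = 0}"
  proof (clarify)
    fix y assume y: "y \<in> ?F" and e: "\<epsilon> = poly f y ^ (\<rho> * (?R + 1))"
    have "1 < ?R" using q_gt_1 m by (rule one_less_power)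
    then have "\<rho> \<noteq> 0" unfolding R by simp
    then have fy: "poly f y \<noteq> 0" using eps(2) e by (auto simp: power_0_left)
    have yR: "(y ^ (j * ?R)) ^ ?R = y ^ j" for j
    proof -
      have "(y ^ (j * ?R)) ^ ?R = (y ^ (?R * ?R)) ^ j"
        by (simp only: power_mult[symmetric] mult_ac)
      then show ?thesis using y unfolding RR[symmetric] by (simp add: frob_fixed_def)
    qed
    \<comment> \<open>The \<open>R\<close>-th power lowers \<open>y ^ (j * R)\<close> to
      \<open>y ^ j\<close>. Multiplying by \<open>f(y) ^ \<rho>\<close> then completes the exponent
      in front of \<open>u j\<close> to the one whose value is \<open>\<epsilon>\<close>.\<close>
    have "(poly G y) ^ ?R = (\<Sum>j<J. y ^ j * (poly (v j) y ^ ?R + (poly f y ^ \<rho>) ^ ?R * poly (u j) y ^ ?R))"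
      unfolding G_def poly_sum frob_sum
      by (simp add: poly_monom power_mult_distrib yR frob_add)
    then have "poly f y ^ \<rho> * (poly G y) ^ ?R
        = (\<Sum>j<J. y ^ j * (poly f y ^ \<rho> * poly (v j) y ^ ?R + poly f y ^ \<rho> * (poly f y ^ \<rho>) ^ ?R * poly (u j) y ^ ?R))"
      by (simp add: sum_distrib_left distrib_left mult_ac)
    also have "poly f y ^ \<rho> * (poly f y ^ \<rho>) ^ ?R = \<epsilon>"
      unfolding e by (simp add: power_mult distrib_left power_add)
    also have "(\<Sum>j<J. y ^ j * (poly f y ^ \<rho> * poly (v j) y ^ ?R + \<epsilon> * poly (u j) y ^ ?R))
      = poly (\<Sum>j<J. monom 1 j * (f ^ \<rho> * v j ^ ?R + [:\<epsilon>:] * u j ^ ?R)) y"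
      by (simp add: poly_sum poly_monom)
    finally have "poly f y ^ \<rho> * (poly G y) ^ ?R = 0" unfolding vanish by simp
    then show "poly G y = 0" using fy by simp
  qed
  then have "card {y \<in> ?F. poly f y ^ (\<rho> * (?R + 1)) = \<epsilon>} \<le> card {y. poly G y = 0}"
    by (intro card_mono poly_roots_finite \<open>G \<noteq> 0\<close>)
  also have "\<dots> \<le> degree G" by (rule card_poly_roots_bound[OF \<open>G \<noteq> 0\<close>])
  finally have "2 * card {y \<in> ?F. poly f y ^ (\<rho> * (?R + 1)) = \<epsilon>} \<le> 2 * ((J - 1) * ?R + (2 * \<delta> * \<rho> + (A - 1)))"
    using degG by simp
  also have "\<dots> \<le> ?R * ?R + 4 * \<delta> * ?R"
    unfolding J_def A_def R k by (simp add: algebra_simps)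
  finally show ?thesis unfolding RR .
qed

end

section \<open>The Weil bound\<close>

text \<open>For \<open>K^2 < 4 q\<close> the roots are conjugate of modulus \<open>sqrt q\<close>;
  otherwise they are real and their even powers are nonnegative, which gives the lower bound in both
  cases. If \<open>4 q < K^2\<close>, the real roots differ, so the sum of their squares exceeds
  \<open>2 q\<close> and one square exceeds \<open>q\<close>.\<close>

lemma quadratic_root_powers:
  fixes K q :: real
  assumes q: "0 < q"
  obtains \<alpha> \<beta> :: complex where "\<alpha> + \<beta> = - of_real K" "\<alpha> * \<beta> = of_real q"
    "\<And>m. - 2 * q ^ m \<le> Re (\<alpha> ^ (2 * m) + \<beta> ^ (2 * m))"
    "4 * q < K\<^sup>2 \<Longrightarrow> \<exists>c>q. \<forall>m. c ^ m \<le> Re (\<alpha> ^ (2 * m) + \<beta> ^ (2 * m))"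
proof (cases "4 * q \<le> K\<^sup>2")
  case True
  define s where "s = sqrt (K\<^sup>2 - 4 * q)"
  have s: "s\<^sup>2 = K\<^sup>2 - 4 * q" using True by (simp add: s_def)
  define x y where "x = (- K + s) / 2" and "y = (- K - s) / 2"
  have xy: "x + y = - K" "x * y = q"
    using s by (simp_all add: x_def y_def field_simps power2_eq_square)
  have re: "Re (of_real x ^ (2 * m) + of_real y ^ (2 * m)) = (x\<^sup>2) ^ m + (y\<^sup>2) ^ m" for m
    by (simp add: power_mult flip: of_real_power)
  show ?thesis
  proof (rule that[of "of_real x" "of_real y"])
    show "complex_of_real x + of_real y = - of_real K"
      using arg_cong[OF xy(1), of complex_of_real] by simp
    show "complex_of_real x * of_real y = of_real q"
      using arg_cong[OF xy(2), of complex_of_real] by simp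
  next
    fix m
    have "- 2 * q ^ m \<le> 0" "0 \<le> (x\<^sup>2) ^ m + (y\<^sup>2) ^ m" using q by auto
    then show "- 2 * q ^ m \<le> Re (of_real x ^ (2 * m) + of_real y ^ (2 * m))"
      by (simp only: re)
  next
    assume "4 * q < K\<^sup>2"
    then have "x \<noteq> y" using s by (auto simp: x_def y_def)
    then have "0 < (x - y)\<^sup>2" by simp
    then have "2 * q < x\<^sup>2 + y\<^sup>2" using xy(2) by (simp add: power2_diff)
    then consider "q < x\<^sup>2" | "q < y\<^sup>2" by linarith
    then show "\<exists>c>q. \<forall>m. c ^ m \<le> Re (of_real x ^ (2 * m) + of_real y ^ (2 * m))"
      unfolding re
    proof cases
      case 1
      then show "\<exists>c>q. \<forall>m. c ^ m \<le> (x\<^sup>2) ^ m + (y\<^sup>2) ^ m" by (intro exI[of _ "x\<^sup>2"]) simp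
    next
      case 2
      then show "\<exists>c>q. \<forall>m. c ^ m \<le> (x\<^sup>2) ^ m + (y\<^sup>2) ^ m" by (intro exI[of _ "y\<^sup>2"]) simp
    qed
  qed
next
  case False
  define s where "s = sqrt (4 * q - K\<^sup>2)"
  have s: "s\<^sup>2 = 4 * q - K\<^sup>2" using False by (simp add: s_def)
  define z where "z = Complex (- K / 2) (s / 2)"
  have nz: "(norm z)\<^sup>2 = q" using s by (simp add: z_def cmod_power2 power_divide field_simps)
  show ?thesis
  proof (rule that[of z "cnj z"])
    show "z + cnj z = - of_real K" by (simp add: z_def complex_eq_iff)
    show "z * cnj z = of_real q" using nz by (simp add: complex_norm_square[symmetric])
    fix m
    have "norm (z ^ (2 * m)) = q ^ m" by (simp add: norm_power power_mult nz)
    then have "- (q ^ m) \<le> Re (z ^ (2 * m))" by (metis abs_Re_le_cmod abs_le_D2 minus_le_iff)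
    moreover have "Re (cnj z ^ (2 * m)) = Re (z ^ (2 * m))" by (simp flip: complex_cnj_power)
    ultimately show "- 2 * q ^ m \<le> Re (z ^ (2 * m) + cnj z ^ (2 * m))" by simp
  qed (use False in simp)
qed

section \<open>Point counts on the Artin--Schreier curve and the bound for Kloosterman sums\<close>

context closure_character
begin

lemma two_neq_0_if_odd:
  assumes "odd q"
  shows "(2 :: 'k) \<noteq> 0"
proof
  assume "(2 :: 'k) = 0"
  then have "of_nat 2 = (0 :: 'k)" by simp
  then have "CHAR('k) dvd 2" by (simp only: of_nat_eq_0_iff_char_dvd)
  then have "CHAR('k) = 2" using prime_CHAR by (metis primes_dvd_imp_eq two_is_prime_nat)
  then show False using assms r_pos by (simp add: q_eq)
qed

text \<open>Conjugation amounts to \<open>x -> - x\<close>. Reality of the sums makes the dichotomy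
  for real quadratic polynomials applicable.\<close>

lemma cnj_kloosterman:
  assumes "a \<in> Fq 1" "b \<in> Fq 1" "0 < n"
  shows "cnj (kloosterman n a b) = kloosterman n a b"
proof -
  have "cnj (kloosterman n a b) = (\<Sum>x\<in>Fq n - {0}. \<psi> (Tr n (a * - x + b / - x)))"
    unfolding kloosterman_def cnj_sum
  proof (rule sum.cong[OF refl])
    fix x assume "x \<in> Fq n - {0}"
    then have "a * x + b / x \<in> Fq n"
      by (intro Fq_add Fq_mult Fq_divide Fq_1_subset[OF assms(1)] Fq_1_subset[OF assms(2)]) auto
    then have "cnj (\<psi> (Tr n (a * x + b / x))) = \<psi> (- Tr n (a * x + b / x))"
      by (intro psi_uminus[symmetric] Tr_in_Fq)
    also have "- Tr n (a * x + b / x) = Tr n (a * - x + b / - x)" by (simp flip: Tr_uminus)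
    finally show "cnj (\<psi> (Tr n (a * x + b / x))) = \<psi> (Tr n (a * - x + b / - x))" .
  qed
  also have "\<dots> = kloosterman n a b"
    unfolding kloosterman_def
    by (rule sum.reindex_bij_witness[of _ uminus uminus]) (auto intro: Fq_uminus)
  finally show ?thesis .
qed

lemma sum_kloosterman:
  assumes ab: "a \<in> Fq 1" "b \<in> Fq 1" and n: "0 < n"
  shows "(\<Sum>t\<in>Fq 1. kloosterman n (t * a) (t * b))
    = of_nat (q * card {x \<in> Fq n - {0}. Tr n (a * x + b / x) = 0})"
proof -
  have "(\<Sum>t\<in>Fq 1. kloosterman n (t * a) (t * b)) = (\<Sum>t\<in>Fq 1. \<Sum>x\<in>Fq n - {0}. \<psi> (Tr n (a * x + b / x) * t))"
    unfolding kloosterman_def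
  proof (intro sum.cong refl)
    fix t x assume "t \<in> Fq 1"
    then have "Tr n (t * (a * x + b / x)) = t * Tr n (a * x + b / x)" by (rule Tr_scale)
    then show "\<psi> (Tr n (t * a * x + t * b / x)) = \<psi> (Tr n (a * x + b / x) * t)"
      by (simp add: distrib_left mult_ac)
  qed
  also have "\<dots> = (\<Sum>x\<in>Fq n - {0}. \<Sum>t\<in>Fq 1. \<psi> (Tr n (a * x + b / x) * t))"
    by (rule sum.swap)
  also have "\<dots> = (\<Sum>x\<in>Fq n - {0}. if Tr n (a * x + b / x) = 0 then of_nat q else 0)"
  proof (rule sum.cong[OF refl])
    fix x assume "x \<in> Fq n - {0}"
    then have "a * x + b / x \<in> Fq n"
      by (intro Fq_add Fq_mult Fq_divide Fq_1_subset[OF ab(1)] Fq_1_subset[OF ab(2)]) auto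
    then show "(\<Sum>t\<in>Fq 1. \<psi> (Tr n (a * x + b / x) * t))
        = (if Tr n (a * x + b / x) = 0 then of_nat q else 0)"
      by (intro sum_psi Tr_in_Fq)
  qed
  also have "\<dots> = (\<Sum>x\<in>{x \<in> Fq n - {0}. Tr n (a * x + b / x) = 0}. of_nat q)"
    using finite_Fq[OF n] by (intro sum.inter_filter[symmetric]) simp
  finally show ?thesis by (simp add: mult.commute)
qed

text \<open>
  Completing the square in \<open>a * x\<^sup>2 - (y ^ q - y) * x + b = 0\<close> turns points of the Artin--Schreier
  curve \<open>y ^ q - y = a * x + b / x\<close> into points of the hyperelliptic curve
  \<open>s\<^sup>2 = (y ^ q - y)\<^sup>2 - 4 * a * b\<close>.
\<close>

lemma card_trace_zero:
  assumes odd: "odd q" and ab: "a \<in> Fq 1" "b \<in> Fq 1" "a \<noteq> 0" "b \<noteq> 0" and n: "0 < n"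
  shows "2 * card {y \<in> Fq n. \<exists>s\<in>Fq n. s \<noteq> 0 \<and> (y ^ q - y)\<^sup>2 - 4 * a * b = s\<^sup>2}
    \<le> q * card {x \<in> Fq n - {0}. Tr n (a * x + b / x) = 0}"
proof -
  have 2: "(2 :: 'k) \<noteq> 0" by (rule two_neq_0_if_odd[OF odd])
  let ?Y = "{y \<in> Fq n. \<exists>s\<in>Fq n. s \<noteq> 0 \<and> (y ^ q - y)\<^sup>2 - 4 * a * b = s\<^sup>2}"
  let ?T = "{x \<in> Fq n - {0}. Tr n (a * x + b / x) = 0}"
  let ?P = "SIGMA x:?T. {y. y ^ q - y = a * x + b / x}"
  have fin: "finite (Fq n)" by (rule finite_Fq[OF n])
  have fibre: "finite {y. y ^ q - y = v} \<and> card {y. y ^ q - y = v} \<le> q" for v :: 'k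
  proof -
    let ?p = "monom 1 q - [:v, 1 :: 'k:]"
    have deg: "degree ?p = q"
      using q_gt_1 by (subst diff_conv_add_uminus, subst degree_add_eq_left) (auto simp: degree_monom_eq)
    then have nz: "?p \<noteq> 0" using q_gt_1 by (metis degree_0 not_one_less_zero)
    have "{y. y ^ q - y = v} = {y. poly ?p y = 0}" by (auto simp: poly_monom algebra_simps)
    then show ?thesis using poly_roots_finite[OF nz] card_poly_roots_bound[OF nz] deg by simp
  qed
  obtain s where s: "\<And>y. y \<in> ?Y \<Longrightarrow> s y \<in> Fq n \<and> s y \<noteq> 0 \<and> (y ^ q - y)\<^sup>2 - 4 * a * b = (s y)\<^sup>2"
    using bchoice[of ?Y "\<lambda>y s. s \<in> Fq n \<and> s \<noteq> 0 \<and> (y ^ q - y)\<^sup>2 - 4 * a * b = s\<^sup>2"] by blast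
  \<comment> \<open>The sign \<open>e\<close> selects one of the two solutions \<open>x\<close> of
    \<open>a x^2 - g x + b = 0\<close> with \<open>g = y ^ q - y\<close>. They are distinct since
    \<open>s y\<close> is nonzero, so each good \<open>y\<close> gives two points of the
    curve.\<close>
  define h where "h = (\<lambda>(y, e). ((y ^ q - y + e * s y) / (2 * a), y))"
  have "inj_on h (?Y \<times> {1, - 1})"
  proof (rule inj_onI)
    fix z z' assume z: "z \<in> ?Y \<times> {1, - 1}" "z' \<in> ?Y \<times> {1, - 1}" "h z = h z'"
    obtain y e y' e' where zz: "z = (y, e)" "z' = (y', e')" by (cases z, cases z') auto
    have "y = y'" using z(3) by (simp add: h_def zz)
    moreover have "e = e'"
      using z(3) 2 ab(3) s[of y] z(1) \<open>y = y'\<close> by (auto simp: h_def zz)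
    ultimately show "z = z'" by (simp add: zz)
  qed
  moreover have "h ` (?Y \<times> {1, - 1}) \<subseteq> ?P"
  proof
    fix p assume "p \<in> h ` (?Y \<times> {1, - 1})"
    then obtain y e where y: "y \<in> ?Y" and e: "e = 1 \<or> e = - 1" and p: "p = h (y, e)" by auto
    have yF: "y \<in> Fq n" using y by simp
    have sy: "s y \<in> Fq n" "(y ^ q - y)\<^sup>2 - 4 * a * b = (s y)\<^sup>2" using s[OF y] by auto
    define g where "g = y ^ q - y"
    define x where "x = (g + e * s y) / (2 * a)"
    have ee: "e * e = 1" using e by auto
    \<comment> \<open>Multiplying the quadratic by \<open>4 * a\<close> completes the square in
      \<open>2 * a * x\<close>.\<close>
    have "4 * a * (a * x * x - g * x + b) = (2 * a * x) * (2 * a * x) - 2 * g * (2 * a * x) + 4 * a * b"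
      by (simp add: algebra_simps)
    also have "2 * a * x = g + e * s y" using 2 ab(3) by (simp add: x_def)
    also have "(g + e * s y) * (g + e * s y) - 2 * g * (g + e * s y) + 4 * a * b
        = (e * e) * (s y)\<^sup>2 - (g\<^sup>2 - 4 * a * b)"
      by (simp add: algebra_simps power2_eq_square)
    also have "\<dots> = 0" using sy(2) ee by (simp add: g_def)
    finally have "2 * 2 * a * (a * x * x - g * x + b) = 0" by simp
    then have quad: "a * x * x - g * x + b = 0" using 2 ab(3) by (metis mult_eq_0_iff)
    then have x0: "x \<noteq> 0" using ab(4) by auto
    have g: "g = a * x + b / x" using quad x0 by (simp add: field_simps)
    have "g \<in> Fq n" unfolding g_def by (intro Fq_diff Fq_power yF)
    moreover have "e \<in> Fq n" using e by (auto intro: Fq_uminus)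
    ultimately have xF: "x \<in> Fq n" unfolding x_def
      by (intro Fq_divide Fq_add Fq_mult sy(1) Fq_numeral Fq_1_subset[OF ab(1)])
    have "Tr n (a * x + b / x) = 0"
      unfolding g[symmetric] g_def by (rule Tr_artin_schreier[OF yF])
    then show "p \<in> ?P" using xF x0 g by (simp add: p h_def x_def g_def)
  qed
  moreover have finP: "finite ?P" using fin fibre by (intro finite_SigmaI) auto
  ultimately have "card (?Y \<times> {1, - 1 :: 'k}) \<le> card ?P" by (rule card_inj_on_le)
  moreover have "(1 :: 'k) \<noteq> - 1"
  proof
    assume "(1 :: 'k) = - 1"
    then have "(1 :: 'k) + 1 = 0" by (metis add.right_inverse)
    then show False using 2 by simp
  qed
  ultimately have "2 * card ?Y \<le> card ?P" by (simp add: card_cartesian_product)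
  also have "\<dots> = (\<Sum>x\<in>?T. card {y. y ^ q - y = a * x + b / x})"
    using fin fibre by (intro card_SigmaI) auto
  also have "\<dots> \<le> (\<Sum>x\<in>?T. q)" using fibre by (intro sum_mono) simp
  finally show ?thesis by (simp add: mult.commute)
qed

text \<open>Stepanov's bound with \<open>\<epsilon> = - 1\<close> limits the nonsquare values from
  above, and \<open>f\<close> has at most \<open>2 * q\<close> zeros, so the rest of the field must
  give nonzero squares. Here \<open>f\<close> has degree \<open>2 * q\<close>, that is
  \<open>\<delta> = q\<close>.\<close>

lemma card_nonzero_square_values:
  assumes odd: "odd q" and c: "c \<in> Fq 1" "c \<noteq> 0" and m: "0 < m" and small: "2 * q\<^sup>2 < q ^ m"
  shows "q ^ (2 * m)
    \<le> 2 * card {y \<in> Fq (2 * m). \<exists>s\<in>Fq (2 * m). s \<noteq> 0 \<and> (y ^ q - y)\<^sup>2 - 4 * c = s\<^sup>2} + 8 * q * q ^ m"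
proof -
  have 2: "(2 :: 'k) \<noteq> 0" by (rule two_neq_0_if_odd[OF odd])
  then have 4: "(4 :: 'k) \<noteq> 0" by (metis mult_2 mult_eq_0_iff numeral_Bit0)
  let ?F = "Fq (2 * m)" and ?R = "q ^ m"
  have m2: "0 < 2 * m" using m by simp
  have fin: "finite ?F" by (rule finite_Fq[OF m2])
  obtain \<rho> where \<rho>: "?R = 2 * \<rho> + 1" using odd by (metis even_power oddE)
  have exp: "q ^ (2 * m) = 2 * (\<rho> * (?R + 1)) + 1"
    unfolding mult_2 power_add \<rho> by (simp add: algebra_simps)
  define g where "g = monom 1 q - [:0, 1 :: 'k:]"
  define f where "f = g * g - [:4 * c:]"
  have degg: "degree g = q"
    unfolding g_def using q_gt_1
    by (subst diff_conv_add_uminus, subst degree_add_eq_left) (auto simp: degree_monom_eq)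
  have g0: "g \<noteq> 0" using degg q_gt_1 by auto
  have degf: "degree f = 2 * q"
  proof -
    have "degree (g * g) = 2 * q" using g0 degg by (simp add: degree_mult_eq)
    then show ?thesis unfolding f_def using q_gt_1
      by (subst diff_conv_add_uminus, subst degree_add_eq_left) auto
  qed
  have pf: "poly f y = (y ^ q - y)\<^sup>2 - 4 * c" for y
    by (simp add: f_def g_def poly_monom power2_eq_square)
  have pg: "pderiv g = - 1"
  proof -
    have "pderiv (monom 1 q) = (0 :: 'k poly)"
      using of_nat_q[of 1] by (simp add: pderiv_monom)
    then show ?thesis unfolding g_def by (simp only: pderiv_diff) (simp add: pderiv_pCons one_pCons)
  qed
  have "pderiv f = - (2 * g)"
    unfolding f_def by (simp add: pderiv_diff pderiv_mult pg pderiv_pCons)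
  \<comment> \<open>Since \<open>f = g^2 - 4 c\<close> and \<open>g' = - 1\<close>, a root of
    \<open>f\<close> has \<open>g\<close> nonzero and hence is simple.\<close>
  then have pdf: "poly (pderiv f) z = - (2 * poly g z)" for z by simp
  obtain z where z: "poly f z = 0"
    using alg_closed_imp_poly_has_root[of f] degf q_gt_1 by auto
  have "poly g z \<noteq> 0"
    using z c(2) 4 by (auto simp: f_def)
  then have "poly (pderiv f) z \<noteq> 0" using 2 by (simp add: pdf)
  moreover have f_nz: "f \<noteq> 0" using degf q_gt_1 by auto
  ultimately have ord: "order z f = 1" using z by (intro order_simple_root)
  have f0: "coeff f 0 \<noteq> 0"
    using c(2) 4 q_gt_1 by (simp add: f_def g_def coeff_mult_0)
  have "frob_poly 1 g = g"
    unfolding g_def frob_poly_diff using q_gt_1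
    by (auto simp: poly_eq_iff coeff_pCons simp del: One_nat_def split: nat.split)
  moreover have "frob_poly 1 [:4 * c:] = [:4 * c:]"
    using Fq_mult[OF Fq_numeral c(1)] by (auto simp: frob_poly_eq_iff coeff_pCons simp del: One_nat_def split: nat.split)
  ultimately have ff: "frob_poly 1 f = f" unfolding f_def by (simp only: frob_poly_diff frob_poly_mult)
  have m1: "- 1 \<in> Fq 1" by (intro Fq_uminus Fq_1)
  let ?Y = "{y \<in> ?F. \<exists>s\<in>?F. s \<noteq> 0 \<and> (y ^ q - y)\<^sup>2 - 4 * c = s\<^sup>2}"
  let ?N = "{y \<in> ?F. poly f y ^ (\<rho> * (?R + 1)) = - 1}"
  have N: "2 * card ?N \<le> q ^ (2 * m) + 4 * q * ?R"
    by (rule stepanov_bound[OF ord f0 \<rho> m degf ff small m1]) simp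
  have "?F \<subseteq> ?Y \<union> ?N \<union> {y. poly f y = 0}"
  proof
    fix y assume y: "y \<in> ?F"
    define e where "e = poly f y"
    have eF: "e \<in> ?F"
      unfolding e_def pf by (intro Fq_diff Fq_power Fq_mult Fq_numeral Fq_1_subset[OF c(1)] y)
    then have "e ^ (2 * (\<rho> * (?R + 1)) + 1) = e" unfolding exp[symmetric] by (simp add: frob_fixed_def)
    moreover have pow: "x ^ (2 * k + 1) = (x ^ k)\<^sup>2 * x" for x :: 'k and k
      by (simp only: power_add power_even_eq power_one_right)
    ultimately have "(e ^ (\<rho> * (?R + 1)))\<^sup>2 * e = 1 * e" by (simp only: mult_1)
    then have e2: "e = 0 \<or> (e ^ (\<rho> * (?R + 1)))\<^sup>2 = 1" by (simp only: mult_cancel_right)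
    show "y \<in> ?Y \<union> ?N \<union> {y. poly f y = 0}"
    proof (cases "e = 0 \<or> e ^ (\<rho> * (?R + 1)) = - 1")
      case True
      then show ?thesis using y by (auto simp: e_def)
    next
      case False
      then have e1: "e \<noteq> 0" "e ^ (\<rho> * (?R + 1)) = 1" using e2 by (auto simp: power2_eq_1_iff)
      \<comment> \<open>The square root is taken in the closed field; Euler's criterion
        \<open>e ^ (\<rho> * (R + 1)) = 1\<close> shows that Frobenius fixes it.\<close>
      obtain s where s: "s ^ 2 = e" using nth_root_exists[of 2 e] by auto
      have "s ^ (q ^ (2 * m)) = (s ^ 2) ^ (\<rho> * (?R + 1)) * s"
        unfolding exp by (simp only: power_add power_mult power_one_right)
      then have "s \<in> ?F" using e1(2) s by (simp add: frob_fixed_def)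
      moreover have "s \<noteq> 0" using e1 s by auto
      ultimately show ?thesis using y s by (auto simp: e_def pf)
    qed
  qed
  moreover have "finite (?Y \<union> ?N \<union> {y. poly f y = 0})"
    using fin poly_roots_finite[OF f_nz] by simp
  ultimately have "card ?F \<le> card (?Y \<union> ?N \<union> {y. poly f y = 0})" by (intro card_mono)
  also have "\<dots> \<le> card ?Y + card ?N + card {y. poly f y = 0}"
    using card_Un_le[of "?Y \<union> ?N" "{y. poly f y = 0}"] card_Un_le[of ?Y ?N] by linarith
  also have "card {y. poly f y = 0} \<le> 2 * q" using card_poly_roots_bound[OF f_nz] degf by simp
  finally have "q ^ (2 * m) \<le> card ?Y + card ?N + 2 * q" using card_Fq[OF m2] by simp
  then have "2 * q ^ (2 * m) \<le> 2 * card ?Y + (q ^ (2 * m) + 4 * q * ?R) + 4 * q" using N by linarith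
  moreover have "4 * q \<le> 4 * q * ?R" using q_pow_pos[of m] by simp
  ultimately show ?thesis by linarith
qed

text \<open>The term \<open>t = 0\<close> equals \<open>q ^ (2 * m) - 1\<close> and cancels the main
  term of the point count, leaving only the error of order \<open>q ^ m\<close>.\<close>

lemma sum_kloosterman_lower_bound:
  assumes odd: "odd q" and ab: "a \<in> Fq 1" "b \<in> Fq 1" "a \<noteq> 0" "b \<noteq> 0"
    and m: "0 < m" and small: "2 * q\<^sup>2 < q ^ m"
  shows "- 8 * real q * real q ^ m \<le> (\<Sum>t\<in>Fq 1 - {0}. Re (kloosterman (2 * m) (t * a) (t * b)))"
proof -
  have m2: "0 < 2 * m" using m by simp
  let ?T = "{x \<in> Fq (2 * m) - {0}. Tr (2 * m) (a * x + b / x) = 0}"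
  have c: "a * b \<in> Fq 1" "a * b \<noteq> 0" using ab Fq_mult by auto
  have "q ^ (2 * m) \<le> q * card ?T + 8 * q * q ^ m"
    using card_nonzero_square_values[OF odd c m small] card_trace_zero[OF odd ab m2]
    by (simp only: mult.assoc)
  then have "real (q ^ (2 * m)) \<le> real (q * card ?T + 8 * q * q ^ m)" by (simp only: of_nat_le_iff)
  then have le: "real q ^ (2 * m) \<le> real (q * card ?T) + 8 * real q * real q ^ m" by simp
  have "kloosterman (2 * m) (0 * a) (0 * b) = (\<Sum>x\<in>Fq (2 * m) - {0}. 1)"
    unfolding kloosterman_def by (simp add: frob_trace_def)
  also have "\<dots> = of_nat (q ^ (2 * m) - 1)"
    using card_Fq[OF m2] finite_Fq[OF m2] by (simp add: card_Diff_singleton)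
  finally have "Re (kloosterman (2 * m) (0 * a) (0 * b)) \<le> real q ^ (2 * m)" by simp
  moreover have "(\<Sum>t\<in>Fq 1. Re (kloosterman (2 * m) (t * a) (t * b))) = real (q * card ?T)"
    using sum_kloosterman[OF ab(1,2) m2] by (simp only: Re_sum[symmetric] complex_Re_of_nat)
  moreover have "(\<Sum>t\<in>Fq 1. Re (kloosterman (2 * m) (t * a) (t * b)))
      = Re (kloosterman (2 * m) (0 * a) (0 * b)) + (\<Sum>t\<in>Fq 1 - {0}. Re (kloosterman (2 * m) (t * a) (t * b)))"
    using finite_Fq[of 1] by (intro sum.remove) auto
  ultimately show ?thesis using le by linarith
qed

text \<open>A violation makes the sum for \<open>(a, b)\<close> in degree \<open>2 * m\<close> at
  most \<open>- (c ^ m)\<close> with \<open>c > q\<close>, while every other twist is at most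
  \<open>2 * q ^ m\<close>. This contradicts the lower bound for large \<open>m\<close>.\<close>

theorem norm_kloosterman_le:
  assumes odd: "odd q" and ab: "a \<in> Fq 1" "b \<in> Fq 1" "a \<noteq> 0" "b \<noteq> 0"
  shows "norm (kloosterman 1 a b) \<le> 2 * sqrt (real q)"
proof (rule ccontr)
  assume "\<not> norm (kloosterman 1 a b) \<le> 2 * sqrt (real q)"
  have q0: "0 < real q" using q_gt_1 by simp
  have real: "kloosterman 1 a b = of_real (Re (kloosterman 1 a b))" if "a \<in> Fq 1" "b \<in> Fq 1" for a b
    using cnj_kloosterman[OF that, of 1] by (simp add: complex_eq_iff)
  have upper: "Re (kloosterman (2 * m) a b) \<le> 2 * real q ^ m"
    if ab: "a \<in> Fq 1" "b \<in> Fq 1" "a \<noteq> 0" "b \<noteq> 0" and m: "0 < m" for a b m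
  proof -
    obtain \<alpha> \<beta> where "\<alpha> + \<beta> = - of_real (Re (kloosterman 1 a b))" "\<alpha> * \<beta> = of_real (real q)"
      and le: "\<And>m. - 2 * real q ^ m \<le> Re (\<alpha> ^ (2 * m) + \<beta> ^ (2 * m))"
      using quadratic_root_powers[OF q0, of "Re (kloosterman 1 a b)"] by metis
    then have "kloosterman (Suc (2 * m - 1)) a b = - (\<alpha> ^ Suc (2 * m - 1) + \<beta> ^ Suc (2 * m - 1))"
      using real[OF ab(1,2)] by (intro kloosterman_eq_power_sum[OF ab]) simp_all
    moreover have "Suc (2 * m - 1) = 2 * m" using m by simp
    ultimately show ?thesis using le[of m] by simp
  qed
  obtain c where c: "real q < c" "\<And>m. 0 < m \<Longrightarrow> Re (kloosterman (2 * m) a b) \<le> - (c ^ m)"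
  proof -
    obtain \<alpha> \<beta> where "\<alpha> + \<beta> = - of_real (Re (kloosterman 1 a b))" "\<alpha> * \<beta> = of_real (real q)"
      and le: "4 * real q < (Re (kloosterman 1 a b))\<^sup>2 \<Longrightarrow> \<exists>c>real q. \<forall>m. c ^ m \<le> Re (\<alpha> ^ (2 * m) + \<beta> ^ (2 * m))"
      using quadratic_root_powers[OF q0, of "Re (kloosterman 1 a b)"] by metis
    then have kloosterman: "kloosterman (Suc n) a b = - (\<alpha> ^ Suc n + \<beta> ^ Suc n)" for n
      using real[OF ab(1,2)] by (intro kloosterman_eq_power_sum[OF ab]) simp_all
    have "2 * sqrt (real q) < \<bar>Re (kloosterman 1 a b)\<bar>"
      using \<open>\<not> norm (kloosterman 1 a b) \<le> 2 * sqrt (real q)\<close> by (subst (asm) real[OF ab(1,2)]) simp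
    then have "(2 * sqrt (real q))\<^sup>2 < \<bar>Re (kloosterman 1 a b)\<bar>\<^sup>2" by (intro power_strict_mono) auto
    then have "4 * real q < (Re (kloosterman 1 a b))\<^sup>2" by (simp add: power_mult_distrib)
    from le[OF this] obtain c where c: "real q < c" "\<And>m. c ^ m \<le> Re (\<alpha> ^ (2 * m) + \<beta> ^ (2 * m))" by blast
    have "Re (kloosterman (2 * m) a b) \<le> - (c ^ m)" if "0 < m" for m
    proof -
      have "Suc (2 * m - 1) = 2 * m" using that by simp
      then show ?thesis using kloosterman[of "2 * m - 1"] c(2)[of m] by simp
    qed
    with c(1) show thesis by (rule that)
  qed
  \<comment> \<open>The constant 10 combines 8 from the point count with 2 from each of at most
    \<open>q\<close> further twists.\<close>
  have bound: "c ^ m \<le> 10 * real q * real q ^ m" if m: "0 < m" and small: "2 * q\<^sup>2 < q ^ m" for m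
  proof -
    have "- 8 * real q * real q ^ m \<le> (\<Sum>t\<in>Fq 1 - {0}. Re (kloosterman (2 * m) (t * a) (t * b)))"
      by (rule sum_kloosterman_lower_bound[OF odd ab m small])
    also have "\<dots> = Re (kloosterman (2 * m) (1 * a) (1 * b)) + (\<Sum>t\<in>Fq 1 - {0} - {1}. Re (kloosterman (2 * m) (t * a) (t * b)))"
      using finite_Fq[of 1] by (intro sum.remove) auto
    also have "\<dots> \<le> - (c ^ m) + (\<Sum>t\<in>Fq 1 - {0} - {1}. 2 * real q ^ m)"
    proof (intro add_mono sum_mono)
      show "Re (kloosterman (2 * m) (1 * a) (1 * b)) \<le> - (c ^ m)" using c(2)[OF m] by simp
      fix t assume "t \<in> Fq 1 - {0} - {1}"
      then show "Re (kloosterman (2 * m) (t * a) (t * b)) \<le> 2 * real q ^ m"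
        using ab by (intro upper m Fq_mult) auto
    qed
    also have "(\<Sum>t\<in>Fq 1 - {0} - {1}. 2 * real q ^ m) \<le> real q * (2 * real q ^ m)"
    proof -
      have "card (Fq 1 - {0} - {1}) \<le> q"
        using card_Fq[of 1] card_mono[OF finite_Fq[of 1], of "Fq 1 - {0} - {1}"] by auto
      then show ?thesis by (simp add: mult_right_mono)
    qed
    finally show ?thesis by simp
  qed
  have "1 < c / real q" using c(1) q0 by simp
  then obtain k where k: "10 * real q < (c / real q) ^ k" using real_arch_pow by blast
  \<comment> \<open>\<open>k\<close> makes the geometric growth exceed \<open>10 * q\<close>; the 5
    secures \<open>2 * q^2 < q ^ m\<close>.\<close>
  define m where "m = max k 5"
  have m: "0 < m" "k \<le> m" "5 \<le> m" by (auto simp: m_def)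
  have "2 * q\<^sup>2 < q ^ m"
  proof -
    have "2 * q\<^sup>2 \<le> q * q\<^sup>2" using q_gt_1 by simp
    also have "\<dots> = q ^ 3" by (simp add: power2_eq_square power3_eq_cube)
    also have "\<dots> < q ^ m" using q_gt_1 m by (intro power_strict_increasing) auto
    finally show ?thesis .
  qed
  from bound[OF m(1) this] have "(c / real q) ^ m \<le> 10 * real q"
    using q0 by (simp add: power_divide divide_le_eq)
  moreover have "(c / real q) ^ k \<le> (c / real q) ^ m"
    using \<open>1 < c / real q\<close> m by (intro power_increasing) auto
  ultimately show False using k by linarith
qed

end

lemma (in additive_character) norm_kloosterman_sum_le:
  assumes odd: "odd CARD('a)" and ab: "a \<noteq> 0" "b \<noteq> 0"
  shows "norm (\<Sum>t\<in>UNIV-{0}. \<psi> (a * t + b / t)) \<le> 2 * sqrt (real CARD('a))"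
proof -
  obtain r where r: "r > 0" "CARD('a) = CHAR('a) ^ r"
    using card_finite_field[where 'a='a] by (elim exE conjE)
  define q where "q = CARD('a)"
  have q1: "1 < q" unfolding q_def by (rule CARD_field_gt_1)
  \<comment> \<open>The embedded field consists of roots of \<open>X ^ q - X\<close>, which has at
    most \<open>q\<close> of them, so it is the whole fixed set and the character can be transported
    along the embedding.\<close>
  have F: "frob_fixed q 1 = range (to_ac :: 'a \<Rightarrow> _)"
  proof (rule card_seteq[symmetric])
    let ?p = "monom 1 q - [:0, 1 :: 'a alg_closure:]"
    have deg: "degree ?p = q"
      using q1 by (subst diff_conv_add_uminus, subst degree_add_eq_left) (auto simp: degree_monom_eq)
    then have nz: "?p \<noteq> 0" using q1 by (metis degree_0 not_one_less_zero)
    have roots: "frob_fixed q 1 = {y. poly ?p y = 0}" by (auto simp: frob_fixed_def poly_monom)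
    show "finite (frob_fixed q 1 :: 'a alg_closure set)" unfolding roots by (rule poly_roots_finite[OF nz])
    show "range to_ac \<subseteq> (frob_fixed q 1 :: 'a alg_closure set)"
      using finite_field_power_CARD[where 'a='a] by (auto simp: frob_fixed_def q_def simp flip: to_ac_power)
    have "card (frob_fixed q 1 :: 'a alg_closure set) \<le> q"
      unfolding roots using card_poly_roots_bound[OF nz] deg by simp
    also have "q = card (range (to_ac :: 'a \<Rightarrow> _))" by (simp add: card_image inj_to_ac q_def)
    finally show "card (frob_fixed q 1 :: 'a alg_closure set) \<le> card (range (to_ac :: 'a \<Rightarrow> _))" .
  qed
  interpret C: closure_character q r "\<lambda>x. \<psi> (of_ac x)"
  proof
    show "prime CHAR('a alg_closure)" using prime_CHAR_finite_field[where 'a='a] by simp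
    show "q = CHAR('a alg_closure) ^ r" using r by (simp add: q_def)
    fix x y :: "'a alg_closure" assume "x \<in> frob_fixed q 1" "y \<in> frob_fixed q 1"
    then obtain u v where "x = to_ac u" "y = to_ac v" unfolding F by auto
    then show "\<psi> (of_ac (x + y)) = \<psi> (of_ac x) * \<psi> (of_ac y)"
      by (simp add: psi_add flip: to_ac_add)
  next
    obtain c where "\<psi> c \<noteq> 1" using psi_nontrivial by blast
    then show "\<exists>c\<in>frob_fixed q 1. \<psi> (of_ac c) \<noteq> 1" unfolding F by (intro bexI[of _ "to_ac c"]) auto
  qed (use r in auto)
  have "(\<Sum>t\<in>UNIV-{0}. \<psi> (a * t + b / t)) = C.kloosterman 1 (to_ac a) (to_ac b)"
    unfolding C.kloosterman_def F
    by (rule sum.reindex_bij_witness[of _ of_ac to_ac])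
      (auto simp: frob_trace_def simp flip: to_ac_mult to_ac_divide to_ac_add)
  also have "norm \<dots> \<le> 2 * sqrt (real q)"
  proof (rule C.norm_kloosterman_le)
    show "odd q" using odd by (simp add: q_def)
    show "to_ac a \<in> frob_fixed q 1" "to_ac b \<in> frob_fixed q 1" unfolding F by simp_all
    show "to_ac a \<noteq> 0" "to_ac b \<noteq> 0" using ab by simp_all
  qed
  finally show ?thesis by (simp add: q_def)
qed

section \<open>Bilinear and quadratic forms\<close>

lemma bilinear_form_simps:
  assumes "bilinear_form B"
  shows "B (x + y) z = B x z + B y z" "B z (x + y) = B z x + B z y"
    "B (c *s x) z = c * B x z" "B z (c *s x) = c * B z x"
    "B (x - y) z = B x z - B y z" "B z (x - y) = B z x - B z y"
    "B 0 z = 0" "B z 0 = 0"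
proof -
  have r: "Vector_Spaces.linear (*s) (*) (\<lambda>y. B z y)" and l: "Vector_Spaces.linear (*s) (*) (\<lambda>x. B x z)"
    using assms by (auto simp: bilinear_form_def)
  interpret r: Vector_Spaces.linear "(*s)" "(*)" "\<lambda>y. B z y" by (rule r)
  interpret l: Vector_Spaces.linear "(*s)" "(*)" "\<lambda>x. B x z" by (rule l)
  show "B (x + y) z = B x z + B y z" "B z (x + y) = B z x + B z y"
    "B (c *s x) z = c * B x z" "B z (c *s x) = c * B z x"
    "B (x - y) z = B x z - B y z" "B z (x - y) = B z x - B z y"
    "B 0 z = 0" "B z 0 = 0"
    by (rule l.add r.add l.scale r.scale l.diff r.diff l.zero r.zero)+
qed

lemma nondegenerate_bilinear_form_flip:
  "nondegenerate_bilinear_form B \<Longrightarrow> nondegenerate_bilinear_form (\<lambda>x y. B y x)"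
  by (auto simp: nondegenerate_bilinear_form_def bilinear_form_def)

lemma CARD_vector: "CARD('a::finite ^ 'n) = CARD('a) ^ CARD('n)"
  by (simp add: CARD_vec)

lemma avg_eq: "avg f = (\<Sum>x\<in>UNIV. f x) / real CARD('a ^ 'n)"
  for f :: "'a::{field,finite} ^ 'n \<Rightarrow> real"
  by (simp add: avg_def CARD_vector)

text \<open>With \<open>N = q ^ d\<close>, each \<open>norm2\<close> absorbs one
  \<open>1 / sqrt N\<close> from the averages, and the remaining factor
  \<open>sqrt (q N) / N\<close> is \<open>q\<close> to the power
  \<open>- (d - 1) / 2\<close>.\<close>

lemma correlation_bound:
  fixes \<phi> :: "'a::{field,finite} ^ 'n \<Rightarrow> 'a ^ 'n \<Rightarrow> 'a" and f g :: "'a ^ 'n \<Rightarrow> real"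
  assumes le: "\<bar>\<Sum>x\<in>UNIV. \<Sum>y\<in>UNIV. f x * g y * (d_level \<phi> l x y - 1)\<bar>
    \<le> C * sqrt (real CARD('a) * real CARD('a ^ 'n)) * sqrt (\<Sum>x\<in>UNIV. (f x)\<^sup>2) * sqrt (\<Sum>y\<in>UNIV. (g y)\<^sup>2)"
  shows "\<bar>avg (\<lambda>x. avg (\<lambda>y. f x * g y * d_level \<phi> l x y)) - avg f * avg g\<bar>
    \<le> C * real CARD('a) powr (- ((real CARD('n) - 1) / 2)) * norm2 f * norm2 g"
proof -
  define N where "N = real CARD('a ^ 'n)"
  define q where "q = real CARD('a)"
  have q: "0 < q" using CARD_field_gt_1[where 'a='a] by (simp add: q_def)
  have N: "N = q ^ CARD('n)" by (simp add: N_def q_def CARD_vector)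
  have N0: "0 < N" using q by (simp add: N)
  have "avg (\<lambda>x. avg (\<lambda>y. f x * g y * d_level \<phi> l x y)) - avg f * avg g
      = (\<Sum>x\<in>UNIV. \<Sum>y\<in>UNIV. f x * g y * d_level \<phi> l x y) / (N * N)
        - (\<Sum>x\<in>UNIV. \<Sum>y\<in>UNIV. f x * g y) / (N * N)"
    by (simp add: avg_eq N_def sum_divide_distrib[symmetric] sum_product)
  also have "\<dots> = (\<Sum>x\<in>UNIV. \<Sum>y\<in>UNIV. f x * g y * (d_level \<phi> l x y - 1)) / (N * N)"
    by (simp add: right_diff_distrib sum_subtractf diff_divide_distrib)
  finally have "\<bar>avg (\<lambda>x. avg (\<lambda>y. f x * g y * d_level \<phi> l x y)) - avg f * avg g\<bar>
      = \<bar>\<Sum>x\<in>UNIV. \<Sum>y\<in>UNIV. f x * g y * (d_level \<phi> l x y - 1)\<bar> / (N * N)"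
    using N0 by (simp add: abs_mult)
  also have "\<dots> \<le> C * sqrt (q * N) * sqrt (\<Sum>x\<in>UNIV. (f x)\<^sup>2) * sqrt (\<Sum>y\<in>UNIV. (g y)\<^sup>2) / (N * N)"
    using le N0 unfolding N_def q_def by (intro divide_right_mono) auto
  also have "\<dots> = C * (sqrt q / sqrt N) * (sqrt (\<Sum>x\<in>UNIV. (f x)\<^sup>2) / sqrt N) * (sqrt (\<Sum>y\<in>UNIV. (g y)\<^sup>2) / sqrt N)"
  proof -
    have "sqrt (q * N) = sqrt q * sqrt N" "N = sqrt N * sqrt N" "sqrt N \<noteq> 0"
      using N0 by (simp_all add: real_sqrt_mult)
    moreover have "C * (b * s) * A * B / ((s * s) * (s * s)) = C * (b / s) * (A / s) * (B / s)"
      if "s \<noteq> 0" for A B b s :: real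
      using that by (simp add: field_simps)
    ultimately show ?thesis by metis
  qed
  also have "sqrt q / sqrt N = q powr (- ((real CARD('n) - 1) / 2))"
  proof -
    have "sqrt q / sqrt N = q powr (1/2) / (q powr real CARD('n)) powr (1/2)"
      using q N0 by (simp add: N powr_half_sqrt powr_realpow)
    also have "\<dots> = q powr (1/2 - real CARD('n) / 2)"
      by (simp add: powr_powr powr_diff)
    also have "1/2 - real CARD('n) / 2 = - ((real CARD('n) - 1) / 2)" by (simp add: field_simps)
    finally show ?thesis .
  qed
  also have "sqrt (\<Sum>x\<in>UNIV. (f x)\<^sup>2) / sqrt N = norm2 f"
    by (simp add: norm2_def avg_eq N_def real_sqrt_divide)
  also have "sqrt (\<Sum>x\<in>UNIV. (g x)\<^sup>2) / sqrt N = norm2 g"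
    by (simp add: norm2_def avg_eq N_def real_sqrt_divide)
  finally show ?thesis by (simp add: q_def)
qed

text \<open>The squares \<open>u^2\<close> and the elements \<open>t - v^2\<close> form two sets of
  \<open>(q + 1) / 2\<close> elements each, so they meet.\<close>

lemma sum_of_two_squares:
  assumes 2: "(2 :: 'a::{field,finite}) \<noteq> 0"
  shows "\<exists>u v. (t :: 'a) = u\<^sup>2 + v\<^sup>2"
proof -
  let ?S = "range (\<lambda>x :: 'a. x\<^sup>2)" and ?T = "range (\<lambda>x :: 'a. t - x\<^sup>2)"
  have S: "?S = insert 0 {x. quad_char x = 1}"
    by (auto simp: quad_char_def image_iff split: if_splits)
  have cS: "2 * card ?S = CARD('a) + 1"
    unfolding S using card_nonzero_squares[OF 2] CARD_field_gt_1[where 'a='a] by simp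
  have "?T = (\<lambda>x. t - x) ` ?S" by auto
  then have cT: "card ?T = card ?S" by (simp only:) (rule card_image, simp add: inj_on_def)
  have "?S \<inter> ?T \<noteq> {}"
  proof
    assume "?S \<inter> ?T = {}"
    then have "card (?S \<union> ?T) = card ?S + card ?T" by (intro card_Un_disjoint) auto
    moreover have "card (?S \<union> ?T) \<le> CARD('a)" by (intro card_mono) auto
    ultimately show False using cS cT by linarith
  qed
  then obtain u v where "u\<^sup>2 = t - v\<^sup>2" by auto
  then have "t = u\<^sup>2 + v\<^sup>2" by simp
  then show ?thesis by blast
qed

context additive_character
begin

section \<open>Bilinear forms\<close>

lemma sum_psi_bilinear:
  fixes B :: "'a ^ 'n \<Rightarrow> 'a ^ 'n \<Rightarrow> 'a"
  assumes B: "nondegenerate_bilinear_form B"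
  shows "(\<Sum>y\<in>UNIV. \<psi> (B x y)) = (if x = 0 then of_nat CARD('a ^ 'n) else 0)"
proof (cases "x = 0")
  case True
  then show ?thesis using B by (simp add: nondegenerate_bilinear_form_def bilinear_form_simps)
next
  case False
  note bil = bilinear_form_simps[of B]
  have bB: "bilinear_form B" using B by (simp add: nondegenerate_bilinear_form_def)
  from False B obtain y0 where y0: "B x y0 \<noteq> 0" by (auto simp: nondegenerate_bilinear_form_def)
  obtain c where c: "\<psi> c \<noteq> 1" using psi_nontrivial by blast
  define y1 where "y1 = (c / B x y0) *s y0"
  have "B x y1 = c" using y0 by (simp add: y1_def bil(4)[OF bB])
  then have shift: "\<psi> (B x (y + y1)) = \<psi> c * \<psi> (B x y)" for y
    by (simp add: bil(2)[OF bB] psi_add mult.commute)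
  have "(\<Sum>y\<in>UNIV. \<psi> (B x y)) = (\<Sum>y\<in>UNIV. \<psi> (B x (y + y1)))"
    by (rule sum.reindex_bij_witness[of _ "\<lambda>y. y + y1" "\<lambda>y. y - y1"]) auto
  also have "\<dots> = \<psi> c * (\<Sum>y\<in>UNIV. \<psi> (B x y))" by (simp add: shift sum_distrib_left)
  finally have "(\<Sum>y\<in>UNIV. \<psi> (B x y)) = 0" using c by (metis mult_cancel_right1)
  then show ?thesis using False by simp
qed

lemma sum_psi_nonzero: "(\<Sum>t\<in>UNIV-{0}. \<psi> (c * t)) = (if c = 0 then of_nat CARD('a) else 0) - 1"
proof -
  have "(\<Sum>t\<in>UNIV. \<psi> (c * t)) = 1 + (\<Sum>t\<in>UNIV-{0}. \<psi> (c * t))"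
    by (subst sum.remove[of _ 0]) auto
  then have "(\<Sum>t\<in>UNIV-{0}. \<psi> (c * t)) = (\<Sum>t\<in>UNIV. \<psi> (c * t)) - 1" by simp
  then show ?thesis by (simp only: sum_psi)
qed

lemma d_level_minus_1:
  "complex_of_real (d_level \<phi> l x y - 1) = (\<Sum>t\<in>UNIV-{0}. \<psi> (t * (\<phi> x y - l)))"
  using sum_psi_nonzero[of "\<phi> x y - l"] by (simp add: d_level_def mult.commute)

lemma bilinear_kernel_correlation:
  fixes B :: "'a ^ 'n \<Rightarrow> 'a ^ 'n \<Rightarrow> 'a"
  assumes B: "nondegenerate_bilinear_form B" and l: "l \<noteq> 0"
  shows "(\<Sum>x\<in>UNIV. (d_level B l x y - 1) * (d_level B l x y' - 1))
    \<le> (if y = y' then real CARD('a) * real CARD('a ^ 'n) else 0)"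
proof -
  let ?N = "CARD('a ^ 'n)"
  have bB: "bilinear_form B" using B by (simp add: nondegenerate_bilinear_form_def)
  note bil = bilinear_form_simps[OF bB]
  \<comment> \<open>Orthogonality in \<open>x\<close> keeps the pairs with
    \<open>t y = s y'\<close>. For nonzero \<open>y = u y'\<close> this means
    \<open>s = t u\<close>, and the sum is \<open>q - 1\<close> if \<open>u = 1\<close> and
    \<open>-1\<close> otherwise; it is 0 for independent vectors or if just one vector vanishes, and
    1 if both do.\<close>
  define Z where "Z = (\<Sum>t\<in>UNIV-{0}. \<Sum>s\<in>UNIV-{0}. if t *s y = s *s y' then \<psi> (- l * (t - s)) else 0)"
  have real: "complex_of_real (d_level B l x y' - 1) = cnj (of_real (d_level B l x y' - 1))" for x
    by (rule complex_cnj_complex_of_real[symmetric])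
  have "complex_of_real (\<Sum>x\<in>UNIV. (d_level B l x y - 1) * (d_level B l x y' - 1))
      = (\<Sum>x\<in>UNIV. (\<Sum>t\<in>UNIV-{0}. \<psi> (t * (B x y - l))) * cnj (\<Sum>s\<in>UNIV-{0}. \<psi> (s * (B x y' - l))))"
    unfolding of_real_sum of_real_mult by (subst real) (simp only: d_level_minus_1)
  also have "\<dots> = (\<Sum>x\<in>UNIV. \<Sum>t\<in>UNIV-{0}. \<Sum>s\<in>UNIV-{0}. \<psi> (- l * (t - s)) * \<psi> (B x (t *s y - s *s y')))"
    unfolding cnj_sum sum_product
    by (intro sum.cong refl) (simp add: psi_diff[symmetric] psi_add[symmetric] bil algebra_simps)
  also have "\<dots> = (\<Sum>t\<in>UNIV-{0}. \<Sum>x\<in>UNIV. \<Sum>s\<in>UNIV-{0}. \<psi> (- l * (t - s)) * \<psi> (B x (t *s y - s *s y')))"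
    by (rule sum.swap)
  also have "\<dots> = (\<Sum>t\<in>UNIV-{0}. \<Sum>s\<in>UNIV-{0}. \<Sum>x\<in>UNIV. \<psi> (- l * (t - s)) * \<psi> (B x (t *s y - s *s y')))"
    by (intro sum.cong refl sum.swap)
  also have "\<dots> = of_nat ?N * Z"
    unfolding Z_def sum_distrib_left
  proof (intro sum.cong refl)
    fix t s :: 'a
    have "(\<Sum>x\<in>UNIV. \<psi> (B x (t *s y - s *s y'))) = (if t *s y - s *s y' = 0 then of_nat ?N else 0)"
      using sum_psi_bilinear[OF nondegenerate_bilinear_form_flip[OF B]] .
    then show "(\<Sum>x\<in>UNIV. \<psi> (- l * (t - s)) * \<psi> (B x (t *s y - s *s y')))
        = of_nat ?N * (if t *s y = s *s y' then \<psi> (- l * (t - s)) else 0)"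
      by (simp only: sum_distrib_left[symmetric]) simp
  qed
  finally have main: "complex_of_real (\<Sum>x\<in>UNIV. (d_level B l x y - 1) * (d_level B l x y' - 1)) = of_nat ?N * Z" .
  have "Re Z \<le> (if y = y' then real CARD('a) else 0)"
  proof (cases "y = 0 \<or> y' = 0")
    case True
    show ?thesis
    proof (cases "y = 0 \<and> y' = 0")
      case True
      then have "Z = (\<Sum>t\<in>UNIV-{0}. \<Sum>s\<in>UNIV-{0}. \<psi> (- l * t) * cnj (\<psi> (- l * s)))"
        unfolding Z_def by (simp add: psi_diff[symmetric] algebra_simps)
      also have "\<dots> = (\<Sum>t\<in>UNIV-{0}. \<psi> (- l * t)) * cnj (\<Sum>s\<in>UNIV-{0}. \<psi> (- l * s))"
        by (simp add: sum_product)
      also have "\<dots> = 1" unfolding sum_psi_nonzero using l by simp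
      finally show ?thesis using True by simp
    next
      case False
      then have "Z = 0"
        unfolding Z_def using True by (intro sum.neutral ballI) auto
      then show ?thesis using False True by simp
    qed
  next
    case False
    then have nz: "y \<noteq> 0" "y' \<noteq> 0" by auto
    show ?thesis
    proof (cases "\<exists>u. u \<noteq> 0 \<and> y = u *s y'")
      case True
      then obtain u where u: "u \<noteq> 0" "y = u *s y'" by blast
      have iff: "t *s y = s *s y' \<longleftrightarrow> s = t * u" for t s
        unfolding u(2) vector_smult_assoc vector_mul_rcancel using nz by auto
      have "Z = (\<Sum>t\<in>UNIV-{0}. \<Sum>s\<in>UNIV-{0}. if s = t * u then \<psi> (- l * (t - s)) else 0)"
        unfolding Z_def iff ..
      also have "\<dots> = (\<Sum>t\<in>UNIV-{0}. \<psi> ((- l * (1 - u)) * t))"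
        using u(1) by (intro sum.cong refl) (simp add: sum.delta algebra_simps)
      also have "\<dots> = (if u = 1 then of_nat CARD('a) else 0) - 1"
        unfolding sum_psi_nonzero using l by simp
      finally have Z: "Z = (if u = 1 then of_nat CARD('a) else 0) - 1" .
      have "u = 1 \<longleftrightarrow> y = y'"
        using nz u(2) vector_mul_rcancel[of u y' 1] by simp
      then show ?thesis unfolding Z by simp
    next
      case False
      have no: "t *s y \<noteq> s *s y'" if "t \<noteq> 0" "s \<noteq> 0" for t s
      proof
        assume "t *s y = s *s y'"
        then have "(1 / t) *s (t *s y) = (1 / t) *s (s *s y')" by simp
        then have "y = (s / t) *s y'" using that by (simp add: vector_smult_assoc)
        moreover have "s / t \<noteq> 0" using that by simp
        ultimately show False using False by blast
      qed
      then have "Z = 0" unfolding Z_def by (intro sum.neutral ballI) auto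
      moreover have "y \<noteq> y'"
      proof
        assume "y = y'"
        then have "1 \<noteq> (0 :: 'a) \<and> y = 1 *s y'" by simp
        then show False using False by blast
      qed
      ultimately show ?thesis by simp
    qed
  qed
  then have "real ?N * Re Z \<le> real ?N * (if y = y' then real CARD('a) else 0)"
    by (rule mult_left_mono) simp
  also have "\<dots> = (if y = y' then real CARD('a) * real ?N else 0)" by simp
  finally show ?thesis using arg_cong[OF main, of Re] by simp
qed

lemma bilinear_bound:
  fixes B :: "'a ^ 'n \<Rightarrow> 'a ^ 'n \<Rightarrow> 'a" and f g :: "'a ^ 'n \<Rightarrow> real"
  assumes B: "nondegenerate_bilinear_form B" and l: "l \<noteq> 0" and g: "\<And>y. 0 \<le> g y"
  shows "\<bar>\<Sum>x\<in>UNIV. \<Sum>y\<in>UNIV. f x * g y * (d_level B l x y - 1)\<bar>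
    \<le> sqrt (real CARD('a) * real CARD('a ^ 'n)) * sqrt (\<Sum>x\<in>UNIV. (f x)\<^sup>2) * sqrt (\<Sum>y\<in>UNIV. (g y)\<^sup>2)"
proof -
  define k where "k x y = d_level B l x y - 1" for x y
  define h where "h x = (\<Sum>y\<in>UNIV. g y * k x y)" for x
  let ?qN = "real CARD('a) * real CARD('a ^ 'n)"
  have "(\<Sum>x\<in>UNIV. (h x)\<^sup>2) = (\<Sum>x\<in>UNIV. \<Sum>y\<in>UNIV. \<Sum>y'\<in>UNIV. g y * g y' * (k x y * k x y'))"
    unfolding h_def power2_eq_square sum_product by (simp add: mult_ac)
  also have "\<dots> = (\<Sum>y\<in>UNIV. \<Sum>x\<in>UNIV. \<Sum>y'\<in>UNIV. g y * g y' * (k x y * k x y'))"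
    by (rule sum.swap)
  also have "\<dots> = (\<Sum>y\<in>UNIV. \<Sum>y'\<in>UNIV. g y * g y' * (\<Sum>x\<in>UNIV. k x y * k x y'))"
    unfolding sum_distrib_left by (intro sum.cong refl sum.swap)
  \<comment> \<open>The weights \<open>g y * g y'\<close> are nonnegative, so the one-sided bound on
    the correlations may be inserted term by term.\<close>
  also have "\<dots> \<le> (\<Sum>y\<in>UNIV. \<Sum>y'\<in>UNIV. g y * g y' * (if y = y' then ?qN else 0))"
    unfolding k_def by (intro sum_mono mult_left_mono bilinear_kernel_correlation[OF B l] mult_nonneg_nonneg g)
  also have "\<dots> = ?qN * (\<Sum>y\<in>UNIV. (g y)\<^sup>2)"
    by (simp add: if_distrib[of "\<lambda>x. _ * x"] sum.delta sum_distrib_left power2_eq_square mult_ac cong: if_cong)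
  finally have h: "(\<Sum>x\<in>UNIV. (h x)\<^sup>2) \<le> ?qN * (\<Sum>y\<in>UNIV. (g y)\<^sup>2)" .
  have "(\<Sum>x\<in>UNIV. \<Sum>y\<in>UNIV. f x * g y * (d_level B l x y - 1)) = (\<Sum>x\<in>UNIV. f x * h x)"
    unfolding h_def k_def by (simp add: sum_distrib_left mult.assoc)
  also have "\<bar>\<dots>\<bar> \<le> sqrt (\<Sum>x\<in>UNIV. (f x)\<^sup>2) * sqrt (\<Sum>x\<in>UNIV. (h x)\<^sup>2)"
  proof -
    have "(\<Sum>x\<in>UNIV. f x * h x)\<^sup>2 \<le> (\<Sum>x\<in>UNIV. (f x)\<^sup>2) * (\<Sum>x\<in>UNIV. (h x)\<^sup>2)"
      by (rule Cauchy_Schwarz_ineq_sum)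
    then have "sqrt ((\<Sum>x\<in>UNIV. f x * h x)\<^sup>2) \<le> sqrt ((\<Sum>x\<in>UNIV. (f x)\<^sup>2) * (\<Sum>x\<in>UNIV. (h x)\<^sup>2))"
      by (rule real_sqrt_le_mono)
    then show ?thesis by (simp add: real_sqrt_mult)
  qed
  also have "\<dots> \<le> sqrt (\<Sum>x\<in>UNIV. (f x)\<^sup>2) * sqrt (?qN * (\<Sum>y\<in>UNIV. (g y)\<^sup>2))"
    using h by (intro mult_left_mono real_sqrt_le_mono) (auto intro: sum_nonneg)
  finally show ?thesis by (simp add: real_sqrt_mult mult_ac)
qed

section \<open>Quadratic forms: Gauss sums, eigenvalues and Fourier analysis\<close>

definition quad_gauss :: "('a ^ 'n \<Rightarrow> 'a) \<Rightarrow> 'a \<Rightarrow> complex" where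
  "quad_gauss Q t = (\<Sum>z\<in>UNIV. \<psi> (t * Q z))"

context
  fixes Q :: "'a ^ 'n \<Rightarrow> 'a"
  assumes Q: "nondegenerate_quadratic_form Q" and 2: "(2 :: 'a) \<noteq> 0"
begin

lemma polar_bilinear: "bilinear_form (polar_form Q)"
  using Q by (simp add: nondegenerate_quadratic_form_def quadratic_form_def)

lemma polar_nondegenerate: "nondegenerate_bilinear_form (polar_form Q)"
  using Q by (simp add: nondegenerate_quadratic_form_def)

lemmas polar_simps = bilinear_form_simps[OF polar_bilinear]

lemma Q_scale: "Q (c *s x) = c\<^sup>2 * Q x"
  using Q by (simp add: nondegenerate_quadratic_form_def quadratic_form_def)

lemma Q_add: "Q (x + y) = Q x + Q y + polar_form Q x y"
  by (simp add: polar_form_def)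

lemma Q_diff: "Q (x - y) = Q x + Q y - polar_form Q x y"
proof -
  have "Q (x + (- 1) *s y) = Q x + Q y - polar_form Q x y"
    unfolding Q_add polar_simps(4) Q_scale by simp
  moreover have "x + (- 1) *s y = x - y" by (simp add: vec_eq_iff)
  ultimately show ?thesis by simp
qed

lemma polar_sym: "polar_form Q x y = polar_form Q y x"
  by (simp add: polar_form_def add.commute)

lemma quad_gauss_scale:
  assumes "s \<noteq> 0"
  shows "quad_gauss Q (t * s\<^sup>2) = quad_gauss Q t"
  unfolding quad_gauss_def
  by (rule sum.reindex_bij_witness[of _ "\<lambda>z. (1 / s) *s z" "\<lambda>z. s *s z"])
    (use assms in \<open>auto simp: Q_scale vector_smult_assoc mult.assoc\<close>)

text \<open>With \<open>z = h + w\<close> the variable \<open>w\<close> occurs only linearly,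
  through the polar form; by nondegeneracy only \<open>h = 0\<close> survives.\<close>

lemma norm_quad_gauss:
  assumes t: "t \<noteq> 0"
  shows "norm (quad_gauss Q t) = sqrt (real CARD('a ^ 'n))"
proof -
  define g where "g = quad_gauss Q t"
  have "g * cnj g = (\<Sum>w\<in>UNIV. \<Sum>z\<in>UNIV. \<psi> (t * Q z - t * Q w))"
    unfolding g_def quad_gauss_def cnj_sum sum_product by (subst sum.swap) (simp add: psi_diff)
  also have "\<dots> = (\<Sum>w\<in>UNIV. \<Sum>h\<in>UNIV. \<psi> (t * Q h) * \<psi> (polar_form Q (t *s h) w))"
  proof (rule sum.cong[OF refl])
    fix w :: "'a ^ 'n"
    have "\<psi> (t * Q (h + w) - t * Q w) = \<psi> (t * Q h) * \<psi> (polar_form Q (t *s h) w)" for h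
      by (simp add: Q_add polar_simps psi_add[symmetric] algebra_simps)
    moreover have "(\<Sum>z\<in>UNIV. \<psi> (t * Q z - t * Q w)) = (\<Sum>h\<in>UNIV. \<psi> (t * Q (h + w) - t * Q w))"
      by (rule sum.reindex_bij_witness[of _ "\<lambda>h. h + w" "\<lambda>z. z - w"]) auto
    ultimately show "(\<Sum>z\<in>UNIV. \<psi> (t * Q z - t * Q w))
        = (\<Sum>h\<in>UNIV. \<psi> (t * Q h) * \<psi> (polar_form Q (t *s h) w))" by simp
  qed
  also have "\<dots> = (\<Sum>h\<in>UNIV. \<psi> (t * Q h) * (\<Sum>w\<in>UNIV. \<psi> (polar_form Q (t *s h) w)))"
    unfolding sum_distrib_left by (rule sum.swap)
  also have "\<dots> = (\<Sum>h\<in>UNIV. if h = 0 then \<psi> (t * Q h) * of_nat CARD('a ^ 'n) else 0)"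
  proof (rule sum.cong[OF refl])
    fix h :: "'a ^ 'n"
    show "\<psi> (t * Q h) * (\<Sum>w\<in>UNIV. \<psi> (polar_form Q (t *s h) w))
        = (if h = 0 then \<psi> (t * Q h) * of_nat CARD('a ^ 'n) else 0)"
      unfolding sum_psi_bilinear[OF polar_nondegenerate] using t by simp
  qed
  also have "\<dots> = of_nat CARD('a ^ 'n)"
    using Q_scale[of 0 0] by (simp add: sum.delta)
  finally have "complex_of_real ((norm g)\<^sup>2) = of_real (real CARD('a ^ 'n))"
    by (simp only: complex_norm_square of_real_of_nat_eq)
  then have "(norm g)\<^sup>2 = real CARD('a ^ 'n)" by (simp only: of_real_eq_iff)
  then show ?thesis unfolding g_def[symmetric] by (metis norm_ge_zero real_sqrt_unique)
qed

text \<open>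
  Since \<open>t = u\<^sup>2 + v\<^sup>2\<close>, the form \<open>t * (Q z + Q w)\<close> is equivalent to \<open>Q z + Q w\<close> through
  \<open>(z, w) \<mapsto> (u z + v w, v z - u w)\<close>.
\<close>

lemma quad_gauss_square:
  assumes t: "t \<noteq> 0"
  shows "(quad_gauss Q t)\<^sup>2 = (quad_gauss Q 1)\<^sup>2"
proof -
  obtain u v where uv: "t = u\<^sup>2 + v\<^sup>2" using sum_of_two_squares[OF 2] by blast
  have sq: "(quad_gauss Q c)\<^sup>2 = (\<Sum>(z, w)\<in>UNIV. \<psi> (c * (Q z + Q w)))" for c
    unfolding quad_gauss_def power2_eq_square sum_product sum.cartesian_product
    by (simp add: distrib_left psi_add)
  \<comment> \<open>Applying this map twice multiplies by \<open>u^2 + v^2 = t\<close>, so its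
    inverse is itself divided by \<open>t\<close>.\<close>
  let ?h = "\<lambda>(z, w). (u *s z + v *s w, v *s z - u *s w)"
  let ?h' = "\<lambda>(z, w). ((1 / t) *s (u *s z + v *s w), (1 / t) *s (v *s z - u *s w))"
  have inv: "?h (?h' p) = p" "?h' (?h p) = p" for p
  proof -
    obtain z w where p: "p = (z, w)" by (cases p)
    have tx: "u * (u * x + v * y) + v * (v * x - u * y) = t * x"
      and ty: "v * (u * x + v * y) - u * (v * x - u * y) = t * y" for x y
      unfolding uv by (simp_all add: algebra_simps power2_eq_square)
    have "a * (c * d) + b * (c * e) = c * (a * d + b * e)"
      "a * (c * d) - b * (c * e) = c * (a * d - b * e)" for a b c d e :: 'a
      by (simp_all add: algebra_simps)
    moreover have "(1 / t) * (t * x) = x" for x using t by simp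
    ultimately have c: "u * ((1 / t) * (u * x + v * y)) + v * ((1 / t) * (v * x - u * y)) = x"
      "v * ((1 / t) * (u * x + v * y)) - u * ((1 / t) * (v * x - u * y)) = y"
      "(1 / t) * (u * (u * x + v * y) + v * (v * x - u * y)) = x"
      "(1 / t) * (v * (u * x + v * y) - u * (v * x - u * y)) = y" for x y
      by (simp_all only: tx ty)
    show "?h (?h' p) = p" "?h' (?h p) = p"
      by (simp_all only: p prod.case prod.inject vec_eq_iff vector_add_component
          vector_minus_component vector_smult_component c simp_thms)
  qed
  have "(quad_gauss Q 1)\<^sup>2 = (\<Sum>(z, w)\<in>UNIV. \<psi> (t * (Q z + Q w)))"
    unfolding sq
  proof (rule sum.reindex_bij_witness[of _ ?h ?h'])
    fix p :: "('a ^ 'n) \<times> ('a ^ 'n)"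
    obtain z w where p: "?h' p = (z, w)" by (cases "?h' p")
    then have "p = (u *s z + v *s w, v *s z - u *s w)" using inv(1)[of p] by simp
    moreover have "t * (Q z + Q w) = Q (u *s z + v *s w) + Q (v *s z - u *s w)"
      unfolding uv Q_add Q_diff Q_scale polar_simps by (simp add: algebra_simps)
    ultimately show "(case ?h' p of (z, w) \<Rightarrow> \<psi> (t * (Q z + Q w))) = (case p of (z, w) \<Rightarrow> \<psi> (1 * (Q z + Q w)))"
      unfolding p by simp
  qed (use inv in auto)
  then show ?thesis unfolding sq ..
qed

text \<open>The value at \<open>t\<close> depends only on the class of \<open>t\<close> modulo
  squares and is \<open>quad_gauss Q 1\<close> up to sign. There are two classes, so the sign is
  constant or the quadratic character.\<close>

lemma quad_gauss_cases:
  "(\<forall>t. t \<noteq> 0 \<longrightarrow> quad_gauss Q t = quad_gauss Q 1) \<or>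
   (\<forall>t. t \<noteq> 0 \<longrightarrow> quad_gauss Q t = quad_char t * quad_gauss Q 1)"
proof (cases "\<forall>t. t \<noteq> 0 \<longrightarrow> quad_gauss Q t = quad_gauss Q 1")
  case False
  then obtain e where e: "e \<noteq> 0" "quad_gauss Q e \<noteq> quad_gauss Q 1" by blast
  have e': "quad_gauss Q e = - quad_gauss Q 1"
    using quad_gauss_square[OF e(1)] e(2) by (simp add: power2_eq_iff)
  have square: "quad_gauss Q t = quad_gauss Q 1" if "quad_char t = 1" for t
  proof -
    from that obtain s where "t = s\<^sup>2" "s \<noteq> 0" by (auto simp: quad_char_def split: if_splits)
    then show ?thesis using quad_gauss_scale[of s 1] by simp
  qed
  have qe: "quad_char e = - 1" using quad_char_cases[OF e(1)] square e(2) by blast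
  have "quad_gauss Q t = quad_char t * quad_gauss Q 1" if t: "t \<noteq> 0" for t
  proof (cases "quad_char t = 1")
    case False
    then have qt: "quad_char t = - 1" using quad_char_cases[OF t] by blast
    from nonsquare_mult_square[OF 2 qe qt] obtain s where "s \<noteq> 0" "t = e * s\<^sup>2" by blast
    then show ?thesis using quad_gauss_scale[of s e] e' qt by simp
  next
    case True
    then show ?thesis using square[OF True] by simp
  qed
  then show ?thesis by blast
qed blast

text \<open>Shifting \<open>z\<close> by \<open>\<xi> / t\<close> completes the square:
  \<open>t Q(z) - P(\<xi>, z) = t Q(z - \<xi> / t) - Q(\<xi>) / t\<close>, where \<open>P\<close> is
  the polar form. What remains is a Gauss sum times a phase in \<open>t\<close>.\<close>

lemma quadratic_eigenvalue_bound:
  assumes odd: "odd CARD('a)" and l: "l \<noteq> 0"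
  shows "norm (\<Sum>z\<in>UNIV. (\<Sum>t\<in>UNIV-{0}. \<psi> (t * (Q z - l))) * \<psi> (- polar_form Q \<xi> z))
    \<le> 2 * sqrt (real CARD('a) * real CARD('a ^ 'n))"
proof -
  have "(\<Sum>z\<in>UNIV. (\<Sum>t\<in>UNIV-{0}. \<psi> (t * (Q z - l))) * \<psi> (- polar_form Q \<xi> z))
      = (\<Sum>t\<in>UNIV-{0}. \<Sum>z\<in>UNIV. \<psi> (t * (Q z - l)) * \<psi> (- polar_form Q \<xi> z))"
    unfolding sum_distrib_right by (rule sum.swap)
  also have "\<dots> = (\<Sum>t\<in>UNIV-{0}. quad_gauss Q t * \<psi> (- l * t + (- Q \<xi>) / t))"
  proof (rule sum.cong[OF refl])
    fix t :: 'a assume "t \<in> UNIV - {0}"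
    then have t: "t \<noteq> 0" by simp
    have "(\<Sum>z\<in>UNIV. \<psi> (t * (Q z - l)) * \<psi> (- polar_form Q \<xi> z))
        = (\<Sum>w\<in>UNIV. \<psi> (t * Q w) * \<psi> (- l * t + (- Q \<xi>) / t))"
    proof (rule sum.reindex_bij_witness[of _ "\<lambda>w. w + (1 / t) *s \<xi>" "\<lambda>z. z - (1 / t) *s \<xi>"])
      fix z :: "'a ^ 'n"
      have "t * Q (z - (1 / t) *s \<xi>) + (- l * t + (- Q \<xi>) / t) = t * (Q z - l) + - polar_form Q \<xi> z"
        unfolding Q_diff Q_scale polar_simps polar_sym[of z \<xi>]
        using t by (simp add: field_simps power2_eq_square)
      then show "\<psi> (t * Q (z - (1 / t) *s \<xi>)) * \<psi> (- l * t + (- Q \<xi>) / t)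
          = \<psi> (t * (Q z - l)) * \<psi> (- polar_form Q \<xi> z)"
        by (simp only: psi_add[symmetric])
    qed auto
    then show "(\<Sum>z\<in>UNIV. \<psi> (t * (Q z - l)) * \<psi> (- polar_form Q \<xi> z))
        = quad_gauss Q t * \<psi> (- l * t + (- Q \<xi>) / t)"
      by (simp only: quad_gauss_def sum_distrib_right)
  qed
  also have "norm \<dots> \<le> sqrt (real CARD('a ^ 'n)) * (2 * sqrt (real CARD('a)))"
    using quad_gauss_cases
  proof
    assume *: "\<forall>t. t \<noteq> 0 \<longrightarrow> quad_gauss Q t = quad_gauss Q 1"
    have "(\<Sum>t\<in>UNIV-{0}. quad_gauss Q t * \<psi> (- l * t + (- Q \<xi>) / t))
        = quad_gauss Q 1 * (\<Sum>t\<in>UNIV-{0}. \<psi> (- l * t + (- Q \<xi>) / t))"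
      unfolding sum_distrib_left
    proof (rule sum.cong[OF refl])
      fix t :: 'a assume "t \<in> UNIV - {0}"
      then have "quad_gauss Q t = quad_gauss Q 1" using * by blast
      then show "quad_gauss Q t * \<psi> (- l * t + (- Q \<xi>) / t) = quad_gauss Q 1 * \<psi> (- l * t + (- Q \<xi>) / t)"
        by (rule arg_cong)
    qed
    moreover have "norm (\<Sum>t\<in>UNIV-{0}. \<psi> (- l * t + (- Q \<xi>) / t)) \<le> 2 * sqrt (real CARD('a))"
    \<comment> \<open>On the isotropic vectors the Kloosterman sum degenerates to a punctured sum of
      a nontrivial character, which is \<open>- 1\<close>.\<close>
    proof (cases "Q \<xi> = 0")
      case True
      have "1 \<le> sqrt (real CARD('a))" using CARD_field_gt_1[where 'a='a] by simp
      then have "1 \<le> 2 * sqrt (real CARD('a))" by linarith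
      moreover have "(\<Sum>t\<in>UNIV-{0}. \<psi> (- l * t + - Q \<xi> / t)) = - 1"
        using sum_psi_nonzero[of "- l"] l by (simp add: True)
      ultimately show ?thesis by (simp only: norm_minus_cancel norm_one)
    next
      case False
      then show ?thesis using l by (intro norm_kloosterman_sum_le[OF odd]) auto
    qed
    ultimately show ?thesis
      by (simp only: norm_mult norm_quad_gauss[OF one_neq_zero]) (rule mult_left_mono, simp_all)
  next
    assume *: "\<forall>t. t \<noteq> 0 \<longrightarrow> quad_gauss Q t = quad_char t * quad_gauss Q 1"
    have "(\<Sum>t\<in>UNIV-{0}. quad_gauss Q t * \<psi> (- l * t + (- Q \<xi>) / t))
        = quad_gauss Q 1 * (\<Sum>t\<in>UNIV-{0}. quad_char t * \<psi> (- l * t + (- Q \<xi>) / t))"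
      unfolding sum_distrib_left
    proof (rule sum.cong[OF refl])
      fix t :: 'a assume "t \<in> UNIV - {0}"
      then have gt: "quad_gauss Q t = quad_char t * quad_gauss Q 1" using * by blast
      show "quad_gauss Q t * \<psi> (- l * t + (- Q \<xi>) / t)
          = quad_gauss Q 1 * (quad_char t * \<psi> (- l * t + (- Q \<xi>) / t))"
        unfolding gt by (simp only: mult_ac)
    qed
    moreover have "norm (\<Sum>t\<in>UNIV-{0}. quad_char t * \<psi> (- l * t + (- Q \<xi>) / t)) \<le> 2 * sqrt (real CARD('a))"
      using l by (intro norm_salie_sum_le[OF 2]) simp
    ultimately show ?thesis
      by (simp only: norm_mult norm_quad_gauss[OF one_neq_zero]) (rule mult_left_mono, simp_all)
  qed
  finally show ?thesis by (simp add: real_sqrt_mult mult_ac)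
qed

text \<open>The nondegenerate polar form identifies the space with its dual, so the functions
  \<open>x -> \<psi> (polar_form Q \<xi> x)\<close> are all its characters and satisfy
  orthogonality.\<close>

lemma parseval:
  fixes f :: "'a ^ 'n \<Rightarrow> real"
  shows "(\<Sum>\<xi>\<in>UNIV. (norm (\<Sum>x\<in>UNIV. of_real (f x) * \<psi> (polar_form Q \<xi> x)))\<^sup>2)
    = real CARD('a ^ 'n) * (\<Sum>x\<in>UNIV. (f x)\<^sup>2)"
proof -
  have "complex_of_real (\<Sum>\<xi>\<in>UNIV. (norm (\<Sum>x\<in>UNIV. of_real (f x) * \<psi> (polar_form Q \<xi> x)))\<^sup>2)
      = (\<Sum>\<xi>\<in>UNIV. \<Sum>x\<in>UNIV. \<Sum>y\<in>UNIV. of_real (f x * f y) * \<psi> (polar_form Q \<xi> (x - y)))"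
    unfolding of_real_sum complex_norm_square cnj_sum sum_product
    by (simp add: polar_simps psi_diff mult_ac)
  also have "\<dots> = (\<Sum>x\<in>UNIV. \<Sum>\<xi>\<in>UNIV. \<Sum>y\<in>UNIV. of_real (f x * f y) * \<psi> (polar_form Q \<xi> (x - y)))"
    by (rule sum.swap)
  also have "\<dots> = (\<Sum>x\<in>UNIV. \<Sum>y\<in>UNIV. \<Sum>\<xi>\<in>UNIV. of_real (f x * f y) * \<psi> (polar_form Q (x - y) \<xi>))"
    unfolding polar_sym[of _ "_ - _"] by (intro sum.cong refl sum.swap)
  also have "\<dots> = (\<Sum>x\<in>UNIV. \<Sum>y\<in>UNIV. of_real (f x * f y) * (if x = y then of_nat CARD('a ^ 'n) else 0))"
    unfolding sum_distrib_left[symmetric] sum_psi_bilinear[OF polar_nondegenerate] by simp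
  also have "\<dots> = (\<Sum>x\<in>UNIV. of_real (f x * f x) * of_nat CARD('a ^ 'n))"
    by (simp add: if_distrib[of "\<lambda>x. _ * x"] sum.delta cong: if_cong)
  also have "\<dots> = complex_of_real (real CARD('a ^ 'n) * (\<Sum>x\<in>UNIV. (f x)\<^sup>2))"
    by (simp add: sum_distrib_left power2_eq_square mult_ac)
  finally show ?thesis by (simp only: of_real_eq_iff)
qed

lemma quadratic_bound:
  fixes f g :: "'a ^ 'n \<Rightarrow> real"
  assumes odd: "odd CARD('a)" and l: "l \<noteq> 0"
  shows "\<bar>\<Sum>x\<in>UNIV. \<Sum>y\<in>UNIV. f x * g y * (d_level (\<lambda>x y. Q (x - y)) l x y - 1)\<bar>
    \<le> 2 * sqrt (real CARD('a) * real CARD('a ^ 'n)) * sqrt (\<Sum>x\<in>UNIV. (f x)\<^sup>2) * sqrt (\<Sum>y\<in>UNIV. (g y)\<^sup>2)"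
proof -
  let ?P = "polar_form Q"
  let ?S = "\<Sum>x\<in>UNIV. \<Sum>y\<in>UNIV. f x * g y * (d_level (\<lambda>x y. Q (x - y)) l x y - 1)"
  define N where "N = real CARD('a ^ 'n)"
  have N0: "0 < N" using CARD_field_gt_1[where 'a='a] by (simp add: N_def)
  define k where "k z = (\<Sum>t\<in>UNIV-{0}. \<psi> (t * (Q z - l)))" for z
  define \<kappa> where "\<kappa> \<xi> = (\<Sum>z\<in>UNIV. k z * \<psi> (- ?P \<xi> z))" for \<xi>
  define F where "F h \<xi> = (\<Sum>x\<in>UNIV. of_real (h x) * \<psi> (?P \<xi> x))" for h :: "'a ^ 'n \<Rightarrow> real" and \<xi>
  \<comment> \<open>Fourier inversion for the kernel, with \<open>\<kappa>\<close> its transform; it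
    turns the convolution into multiplication by the eigenvalues
    \<open>\<kappa> \<xi>\<close>.\<close>
  have inversion: "(\<Sum>\<xi>\<in>UNIV. \<kappa> \<xi> * \<psi> (?P \<xi> z)) = of_real N * k z" for z
  proof -
    have "(\<Sum>\<xi>\<in>UNIV. \<kappa> \<xi> * \<psi> (?P \<xi> z)) = (\<Sum>\<xi>\<in>UNIV. \<Sum>w\<in>UNIV. k w * \<psi> (?P \<xi> (z - w)))"
      unfolding \<kappa>_def sum_distrib_right by (simp add: polar_simps psi_diff psi_uminus mult_ac)
    also have "\<dots> = (\<Sum>w\<in>UNIV. k w * (\<Sum>\<xi>\<in>UNIV. \<psi> (?P (z - w) \<xi>)))"
      unfolding sum_distrib_left polar_sym[of "z - _"] by (rule sum.swap)
    also have "\<dots> = (\<Sum>w\<in>UNIV. if z = w then k w * of_real N else 0)"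
      unfolding sum_psi_bilinear[OF polar_nondegenerate] by (intro sum.cong) (auto simp: N_def)
    finally show ?thesis by (simp add: sum.delta mult.commute)
  qed
  have "of_real N * complex_of_real ?S = (\<Sum>x\<in>UNIV. \<Sum>y\<in>UNIV. of_real (f x) * of_real (g y) * (of_real N * k (x - y)))"
    unfolding of_real_sum of_real_mult d_level_minus_1 k_def by (simp add: sum_distrib_left mult_ac)
  also have "\<dots> = (\<Sum>x\<in>UNIV. \<Sum>y\<in>UNIV. \<Sum>\<xi>\<in>UNIV.
      \<kappa> \<xi> * ((of_real (f x) * \<psi> (?P \<xi> x)) * cnj (of_real (g y) * \<psi> (?P \<xi> y))))"
    unfolding inversion[symmetric] sum_distrib_left by (simp add: polar_simps psi_diff mult_ac)
  also have "\<dots> = (\<Sum>x\<in>UNIV. \<Sum>\<xi>\<in>UNIV. \<Sum>y\<in>UNIV.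
      \<kappa> \<xi> * ((of_real (f x) * \<psi> (?P \<xi> x)) * cnj (of_real (g y) * \<psi> (?P \<xi> y))))"
    by (intro sum.cong refl sum.swap)
  also have "\<dots> = (\<Sum>\<xi>\<in>UNIV. \<Sum>x\<in>UNIV. \<Sum>y\<in>UNIV.
      \<kappa> \<xi> * ((of_real (f x) * \<psi> (?P \<xi> x)) * cnj (of_real (g y) * \<psi> (?P \<xi> y))))"
    by (rule sum.swap)
  also have "\<dots> = (\<Sum>\<xi>\<in>UNIV. \<kappa> \<xi> * (F f \<xi> * cnj (F g \<xi>)))"
  proof (rule sum.cong[OF refl])
    fix \<xi>
    have "F f \<xi> * cnj (F g \<xi>) = (\<Sum>x\<in>UNIV. \<Sum>y\<in>UNIV.
        (of_real (f x) * \<psi> (?P \<xi> x)) * cnj (of_real (g y) * \<psi> (?P \<xi> y)))"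
      by (simp only: F_def cnj_sum sum_product)
    then show "(\<Sum>x\<in>UNIV. \<Sum>y\<in>UNIV.
        \<kappa> \<xi> * ((of_real (f x) * \<psi> (?P \<xi> x)) * cnj (of_real (g y) * \<psi> (?P \<xi> y))))
      = \<kappa> \<xi> * (F f \<xi> * cnj (F g \<xi>))"
      by (simp only: sum_distrib_left)
  qed
  finally have main: "of_real N * complex_of_real ?S = (\<Sum>\<xi>\<in>UNIV. \<kappa> \<xi> * (F f \<xi> * cnj (F g \<xi>)))" .
  let ?K = "2 * sqrt (real CARD('a) * N)"
  have "N * \<bar>?S\<bar> = norm (of_real N * complex_of_real ?S)"
    using N0 by (simp only: norm_mult norm_of_real abs_of_pos)
  also have "\<dots> \<le> (\<Sum>\<xi>\<in>UNIV. norm (\<kappa> \<xi> * (F f \<xi> * cnj (F g \<xi>))))"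
    unfolding main by (rule norm_sum)
  also have "\<dots> \<le> (\<Sum>\<xi>\<in>UNIV. ?K * (norm (F f \<xi>) * norm (F g \<xi>)))"
  proof (rule sum_mono)
    fix \<xi>
    have "norm (\<kappa> \<xi>) \<le> ?K"
      unfolding \<kappa>_def k_def N_def by (rule quadratic_eigenvalue_bound[OF odd l])
    then show "norm (\<kappa> \<xi> * (F f \<xi> * cnj (F g \<xi>))) \<le> ?K * (norm (F f \<xi>) * norm (F g \<xi>))"
      by (simp only: norm_mult complex_mod_cnj) (rule mult_right_mono, simp_all)
  qed
  also have "\<dots> = ?K * (\<Sum>\<xi>\<in>UNIV. norm (F f \<xi>) * norm (F g \<xi>))" by (simp only: sum_distrib_left)
  also have "\<dots> \<le> ?K * (sqrt (N * (\<Sum>x\<in>UNIV. (f x)\<^sup>2)) * sqrt (N * (\<Sum>x\<in>UNIV. (g x)\<^sup>2)))"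
  proof (rule mult_left_mono)
    have "(\<Sum>\<xi>\<in>UNIV. norm (F f \<xi>) * norm (F g \<xi>))\<^sup>2
        \<le> (\<Sum>\<xi>\<in>UNIV. (norm (F f \<xi>))\<^sup>2) * (\<Sum>\<xi>\<in>UNIV. (norm (F g \<xi>))\<^sup>2)"
      by (rule Cauchy_Schwarz_ineq_sum)
    also have "\<dots> = (N * (\<Sum>x\<in>UNIV. (f x)\<^sup>2)) * (N * (\<Sum>x\<in>UNIV. (g x)\<^sup>2))"
      unfolding F_def parseval N_def ..
    finally show "(\<Sum>\<xi>\<in>UNIV. norm (F f \<xi>) * norm (F g \<xi>))
        \<le> sqrt (N * (\<Sum>x\<in>UNIV. (f x)\<^sup>2)) * sqrt (N * (\<Sum>x\<in>UNIV. (g x)\<^sup>2))"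
      unfolding real_sqrt_mult[symmetric] by (rule real_le_rsqrt)
  qed (use N0 in simp)
  \<comment> \<open>The two factors \<open>sqrt N\<close> from Parseval combine to the
    \<open>N\<close> introduced by the inversion formula.\<close>
  also have "\<dots> = N * (?K * sqrt (\<Sum>x\<in>UNIV. (f x)\<^sup>2) * sqrt (\<Sum>x\<in>UNIV. (g x)\<^sup>2))"
    using N0 by (simp add: real_sqrt_mult mult_ac)
  finally show ?thesis using N0 unfolding N_def[symmetric] by (simp only: mult_le_cancel_left_pos)
qed

end

end

theorem theorem2p1:
  fixes \<phi> :: "'a::{field,finite} ^ 'n \<Rightarrow> 'a ^ 'n \<Rightarrow> 'a"
    and f g :: "'a ^ 'n \<Rightarrow> real"
    and l :: 'a
  assumes "odd CARD('a)"
    and "CARD('n) \<ge> 2"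
    and "distance_type \<phi>"
    and "\<And>x. f x \<ge> 0"
    and "\<And>x. g x \<ge> 0"
    and "l \<noteq> 0"
  shows "\<bar>avg (\<lambda>x. avg (\<lambda>y. f x * g y * d_level \<phi> l x y)) - avg f * avg g\<bar>
    \<le> C_dist \<phi> * real CARD('a) powr (- ((real CARD('n) - 1) / 2)) * norm2 f * norm2 g"
proof (rule correlation_bound)
  obtain \<psi> :: "'a \<Rightarrow> complex" where "additive_character \<psi>" using ex_additive_character by blast
  then interpret additive_character \<psi> .
  show "\<bar>\<Sum>x\<in>UNIV. \<Sum>y\<in>UNIV. f x * g y * (d_level \<phi> l x y - 1)\<bar>
    \<le> C_dist \<phi> * sqrt (real CARD('a) * real CARD('a ^ 'n)) * sqrt (\<Sum>x\<in>UNIV. (f x)\<^sup>2) * sqrt (\<Sum>y\<in>UNIV. (g y)\<^sup>2)"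
  proof (cases "defined_by_bilinear_form \<phi>")
    case True
    then have "nondegenerate_bilinear_form \<phi>"
      by (metis defined_by_bilinear_form_def ext)
    from bilinear_bound[OF this \<open>l \<noteq> 0\<close> assms(5), of f] show ?thesis
      using True by (simp add: C_dist_def)
  next
    case False
    then obtain Q where Q: "nondegenerate_quadratic_form Q" "\<phi> = (\<lambda>x y. Q (x - y))"
      using assms(3) by (auto simp: distance_type_def defined_by_quadratic_form_def fun_eq_iff)
    from quadratic_bound[OF Q(1) two_neq_0_if_odd_CARD[OF assms(1)] assms(1) \<open>l \<noteq> 0\<close>, of f g]
    show ?thesis using False unfolding Q(2) by (simp add: C_dist_def)
  qed
qed

end
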